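(* Let $n\in\{1,2,3\}$, $0<r<R$, $\beta>0$, and let $f\in C^1(\mathbb{R})\cap C^2(\mathbb{R}\setminus\{0\})$ be strictly increasing with $f(0)=0$ and $$f''(y)\neq 0\qquad \forall\, y\neq 0 .$$ Then there exists a target $z\in L^{\infty}(B(0,R)\setminus B(0,r))$ such that the coupled elliptic system $$\begin{cases}-\Delta \overline{y}+f(\overline{y})=-\overline{q}\,\chi_{B(0,r)} & \text{in } B(0,R),\\ \overline{y}=0 & \text{on }\partial B(0,R),\\ -\Delta \overline{q}+f'(\overline{y})\,\overline{q}=\beta(\overline{y}-z)\chi_{B(0,R)\setminus B(0,r)} & \text{in } B(0,R),\\ \overline{q}=0 & \text{on }\partial B(0,R)\end{cases}$$ admits at least two distinct solutions $(\overline{y}_1,\overline{q}_1)$ and $(\overline{y}_2,\overline{q}_2)$.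
   Context: $B(0,\rho)$ is the ball of $\mathbb{R}^n$ centered at the origin with radius $\rho$; $\chi_A$ denotes the characteristic function of the set $A$. Solutions $\overline y,\overline q$ are in $H^1_0(B(0,R))$ and the equations hold in the weak sense: the first means $f(\overline y)\in L^1(B(0,R))$ and $\int_{B(0,R)}[\nabla\overline y\cdot\nabla\varphi+f(\overline y)\varphi]\,dx=-\int_{B(0,r)}\overline q\varphi\,dx$ for all $\varphi\in H^1_0(B(0,R))\cap L^\infty(B(0,R))$, and the second is understood in the analogous weak sense. *)

theory Defs
  imports "HOL-Analysis.Analysis"
begin

text \<open>
  Throughout, \<open>\<Omega>\<close> is an open subset of a Euclidean space. A function on \<open>\<Omega>\<close> is represented by
  a total function of which only the values on \<open>\<Omega>\<close> matter. Elements of the spaces below are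
  representatives: functions equal almost everywhere on \<open>\<Omega>\<close> stand for the same element.
\<close>

definition L2 :: "'a::euclidean_space set \<Rightarrow> ('a \<Rightarrow> 'b::euclidean_space) set" where
  "L2 \<Omega> = {u. u \<in> borel_measurable (lebesgue_on \<Omega>) \<and>
               integrable (lebesgue_on \<Omega>) (\<lambda>x. (norm (u x))\<^sup>2)}"

definition Linf :: "'a::euclidean_space set \<Rightarrow> ('a \<Rightarrow> real) set" where
  "Linf \<Omega> = {u. u \<in> borel_measurable (lebesgue_on \<Omega>) \<and>
                 (\<exists>C. AE x in lebesgue_on \<Omega>. \<bar>u x\<bar> \<le> C)}"

primrec Ck :: "nat \<Rightarrow> ('a::euclidean_space \<Rightarrow> real) \<Rightarrow> bool" where
  "Ck 0 \<phi> \<longleftrightarrow> continuous_on UNIV \<phi>"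
| "Ck (Suc k) \<phi> \<longleftrightarrow> \<phi> differentiable_on UNIV \<and>
     (\<forall>i\<in>Basis. Ck k (\<lambda>x. frechet_derivative \<phi> (at x) i))"

definition test_functions :: "'a::euclidean_space set \<Rightarrow> ('a \<Rightarrow> real) set" where
  "test_functions \<Omega> = {\<phi>. (\<forall>k. Ck k \<phi>) \<and>
     compact (closure {x. \<phi> x \<noteq> 0}) \<and> closure {x. \<phi> x \<noteq> 0} \<subseteq> \<Omega>}"

definition classical_grad :: "('a::euclidean_space \<Rightarrow> real) \<Rightarrow> 'a \<Rightarrow> 'a" where
  "classical_grad \<phi> x = (\<Sum>i\<in>Basis. frechet_derivative \<phi> (at x) i *\<^sub>R i)"

definition is_weak_grad ::
    "'a::euclidean_space set \<Rightarrow> ('a \<Rightarrow> real) \<Rightarrow> ('a \<Rightarrow> 'a) \<Rightarrow> bool" where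
  "is_weak_grad \<Omega> u g \<longleftrightarrow> (\<forall>\<phi>\<in>test_functions \<Omega>.
     (LINT x|lebesgue_on \<Omega>. u x *\<^sub>R classical_grad \<phi> x) = - (LINT x|lebesgue_on \<Omega>. \<phi> x *\<^sub>R g x))"

definition H1 :: "'a::euclidean_space set \<Rightarrow> ('a \<Rightarrow> real) set" where
  "H1 \<Omega> = {u \<in> L2 \<Omega>. \<exists>g\<in>L2 \<Omega>. is_weak_grad \<Omega> u g}"

text \<open>
  The weak gradient of an element of \<open>H1 \<Omega>\<close>; the choice is immaterial because weak gradients
  agree almost everywhere on \<open>\<Omega>\<close>.
\<close>

definition weak_grad :: "'a::euclidean_space set \<Rightarrow> ('a \<Rightarrow> real) \<Rightarrow> 'a \<Rightarrow> 'a" where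
  "weak_grad \<Omega> u = (SOME g. g \<in> L2 \<Omega> \<and> is_weak_grad \<Omega> u g)"

definition H1_norm :: "'a::euclidean_space set \<Rightarrow> ('a \<Rightarrow> real) \<Rightarrow> real" where
  "H1_norm \<Omega> u = sqrt ((LINT x|lebesgue_on \<Omega>. (u x)\<^sup>2) +
                       (LINT x|lebesgue_on \<Omega>. (norm (weak_grad \<Omega> u x))\<^sup>2))"

definition H10 :: "'a::euclidean_space set \<Rightarrow> ('a \<Rightarrow> real) set" where
  "H10 \<Omega> = {u \<in> H1 \<Omega>. \<exists>\<phi>. (\<forall>k. \<phi> k \<in> test_functions \<Omega>) \<and>
     (\<lambda>k::nat. H1_norm \<Omega> (\<lambda>x. \<phi> k x - u x)) \<longlonglongrightarrow> 0}"

text \<open>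
  Weak solutions of \<open>-\<Delta>u + c = h\<close> in \<open>\<Omega>\<close>, \<open>u = 0\<close> on the boundary, for an \<open>L\<^sup>1\<close> zero-order
  term \<open>c\<close> (which below depends on the solution) and a source \<open>h\<close> in \<open>L\<^sup>2\<close>. Test functions are
  bounded, so all the integrals converge.
\<close>

definition weak_dirichlet_solution ::
    "'a::euclidean_space set \<Rightarrow> ('a \<Rightarrow> real) \<Rightarrow> ('a \<Rightarrow> real) \<Rightarrow> ('a \<Rightarrow> real) \<Rightarrow> bool" where
  "weak_dirichlet_solution \<Omega> u c h \<longleftrightarrow>
     u \<in> H10 \<Omega> \<and> integrable (lebesgue_on \<Omega>) c \<and>
     (\<forall>\<phi> \<in> H10 \<Omega> \<inter> Linf \<Omega>.
        (LINT x|lebesgue_on \<Omega>. weak_grad \<Omega> u x \<bullet> weak_grad \<Omega> \<phi> x + c x * \<phi> x) =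
        (LINT x|lebesgue_on \<Omega>. h x * \<phi> x))"

definition coupled_system_solution ::
    "real \<Rightarrow> real \<Rightarrow> real \<Rightarrow> (real \<Rightarrow> real) \<Rightarrow> ('a::euclidean_space \<Rightarrow> real) \<Rightarrow>
     ('a \<Rightarrow> real) \<Rightarrow> ('a \<Rightarrow> real) \<Rightarrow> bool" where
  "coupled_system_solution r R \<beta> f z y q \<longleftrightarrow>
     weak_dirichlet_solution (ball 0 R) y (\<lambda>x. f (y x))
       (\<lambda>x. - q x * indicator (ball 0 r) x) \<and>
     weak_dirichlet_solution (ball 0 R) q (\<lambda>x. deriv f (y x) * q x)
       (\<lambda>x. \<beta> * (y x - z x) * indicator (ball 0 R - ball 0 r) x)"

end

theory Submission
  imports Defs
begin

text \<open>
  Since \<open>z\<close> is at our disposal, the equation for \<open>q\<close> in the annulus only says that both solutions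
  lead to the same \<open>z\<close>. Everything is sought radial. One solution has \<open>y = 0\<close> and \<open>q = p\<close> with \<open>p\<close>
  supported in the annulus, which determines \<open>z\<close>. For the other one, shooting gives a pair
  \<open>(y, q)\<close> with \<open>\<Delta>y = f(y) + q \<chi>\<close> in the large ball, \<open>\<Delta>q = f'(y) q\<close> in the small ball, \<open>y < 0\<close>,
  and \<open>y = 0\<close> on the boundary. In the annulus \<open>w = q - p\<close> has to solve
  \<open>\<Delta>w = f'(y) w + (f'(y) - f'(0)) p - \<beta> y\<close>, an initial value problem in the radius. Because
  \<open>f''\<close> does not vanish on the negative half-line, \<open>f'(y) - f'(0)\<close> has a strict sign, so scaling \<open>p\<close>
  moves the boundary value of \<open>w\<close> through all reals, and some multiple gives \<open>w = 0\<close> there.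
\<close>


subsection \<open>Smooth functions\<close>

text \<open>The obstacle is that \<open>f'\<close> need not be Lipschitz near 0, since f'' may be
  unbounded there, while \<open>y\<close> must reach 0 at the boundary; the coupled initial value
  problem for \<open>(y, q)\<close> may then fail to depend continuously on its data. But
  \<open>q\<close> acts on \<open>y\<close> only in the small ball, and there \<open>y\<close> stays
  below some -d < 0: a barrier, fixed before any truncation, shows this. So \<open>f'\<close> can be
  cut off near 0 for the shooting. In the annulus, where the cut-off equation for \<open>q\<close>
  would be the wrong one, \<open>q\<close> is discarded and continued by a linear problem whose
  coefficient \<open>f' (y t)\<close> is then known. All radial problems are Volterra equations in t
  = |x|^2: this variable keeps profiles smooth at the origin, and the integral form copes with the
  jump of the sources at t = r^2. The passage to weak solutions rests on one divergence identity.
  The two solutions differ because \<open>y < 0\<close> is compared with the zero state, whatever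
  multiple of the annular profile is chosen.\<close>

lemma Ck_SucI:
  assumes "\<And>x. (\<phi> has_derivative D x) (at x)" and "\<And>i. i \<in> Basis \<Longrightarrow> Ck k (\<lambda>x. D x i)"
  shows "Ck (Suc k) \<phi>"
proof -
  have "frechet_derivative \<phi> (at x) = D x" for x
    using frechet_derivative_at[OF assms(1)] by simp
  then show ?thesis
    using assms by (auto simp: differentiable_on_def differentiable_def)
qed

lemma Ck_SucD:
  assumes "Ck (Suc k) \<phi>"
  shows "(\<phi> has_derivative frechet_derivative \<phi> (at x)) (at x)"
    and "i \<in> Basis \<Longrightarrow> Ck k (\<lambda>x. frechet_derivative \<phi> (at x) i)"
  using assms by (auto simp: differentiable_on_def frechet_derivative_works[symmetric])

lemma Ck_decr: "Ck (Suc k) \<phi> \<Longrightarrow> Ck k \<phi>"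
proof (induction k arbitrary: \<phi>)
  case 0
  then show ?case by (simp add: differentiable_imp_continuous_on)
next
  case (Suc k)
  show ?case
    by (rule Ck_SucI[where D = "\<lambda>x. frechet_derivative \<phi> (at x)"])
      (use Suc.IH Ck_SucD[OF Suc.prems] in blast)+
qed

lemma Ck_continuous_on: "Ck k \<phi> \<Longrightarrow> continuous_on UNIV \<phi>"
  by (induction k arbitrary: \<phi>) (auto intro: differentiable_imp_continuous_on)

lemma Ck_const: "Ck k (\<lambda>_. c)"
  by (induction k arbitrary: c) (use Ck_SucI[where D = "\<lambda>_ _. 0"] in auto)

lemma Ck_inner: "Ck k (\<lambda>x. x \<bullet> a)"
proof (cases k)
  case 0
  then show ?thesis by (auto intro!: continuous_intros)
next
  case (Suc j)
  show ?thesis unfolding Suc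
    by (rule Ck_SucI[where D = "\<lambda>_ h. h \<bullet> a"])
      (auto intro!: derivative_eq_intros Ck_const)
qed

lemma Ck_id: "Ck k (\<lambda>x::real. x)"
  using Ck_inner[of k "1::real"] by simp

lemma Ck_add:
  assumes "Ck k f" "Ck k g"
  shows "Ck k (\<lambda>x. f x + g x)"
  using assms
proof (induction k arbitrary: f g)
  case 0
  then show ?case by (auto intro!: continuous_intros)
next
  case (Suc k)
  show ?case
  proof (rule Ck_SucI)
    show "((\<lambda>x. f x + g x) has_derivative
        (\<lambda>h. frechet_derivative f (at x) h + frechet_derivative g (at x) h)) (at x)" for x
      by (intro has_derivative_add Ck_SucD(1)[OF Suc.prems(1)] Ck_SucD(1)[OF Suc.prems(2)])
  next
    show "Ck k (\<lambda>x. frechet_derivative f (at x) i + frechet_derivative g (at x) i)"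
      if "i \<in> Basis" for i
      by (intro Suc.IH Ck_SucD(2)[OF Suc.prems(1) that] Ck_SucD(2)[OF Suc.prems(2) that])
  qed
qed

lemma Ck_mult:
  assumes "Ck k f" "Ck k g"
  shows "Ck k (\<lambda>x. f x * g x)"
  using assms
proof (induction k arbitrary: f g)
  case 0
  then show ?case by (auto intro!: continuous_intros)
next
  case (Suc k)
  show ?case
  proof (rule Ck_SucI)
    show "((\<lambda>x. f x * g x) has_derivative
        (\<lambda>h. f x * frechet_derivative g (at x) h + frechet_derivative f (at x) h * g x)) (at x)" for x
      by (intro has_derivative_mult Ck_SucD(1)[OF Suc.prems(1)] Ck_SucD(1)[OF Suc.prems(2)])
  next
    show "Ck k (\<lambda>x. f x * frechet_derivative g (at x) i + frechet_derivative f (at x) i * g x)"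
      if "i \<in> Basis" for i
      by (intro Ck_add Suc.IH Ck_SucD(2)[OF Suc.prems(1) that] Ck_SucD(2)[OF Suc.prems(2) that]
          Suc.prems[THEN Ck_decr])
  qed
qed

lemma Ck_sum: "(\<And>i. i \<in> I \<Longrightarrow> Ck k (f i)) \<Longrightarrow> Ck k (\<lambda>x. \<Sum>i\<in>I. f i x)"
  by (induction I rule: infinite_finite_induct) (auto intro: Ck_add Ck_const)

lemma Ck_prod: "(\<And>i. i \<in> I \<Longrightarrow> Ck k (f i)) \<Longrightarrow> Ck k (\<lambda>x. \<Prod>i\<in>I. f i x)"
  by (induction I rule: infinite_finite_induct) (auto intro: Ck_mult Ck_const)

lemma Ck_power: "Ck k f \<Longrightarrow> Ck k (\<lambda>x. f x ^ m)"
  by (induction m) (auto intro: Ck_mult Ck_const)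

text \<open>With a real outer function the chain rule is a product of two scalar functions, so
  \<open>Ck_mult\<close> applies. The induction generalises over both functions because it composes
  the derivative of \<open>g\<close> with \<open>h\<close>, regarded as one order less
  smooth.\<close>

lemma Ck_compose:
  fixes g :: "real \<Rightarrow> real"
  assumes "Ck k g" "Ck k h"
  shows "Ck k (\<lambda>x. g (h x))"
  using assms
proof (induction k arbitrary: g h)
  case 0
  then show ?case by (auto intro: continuous_on_compose2)
next
  case (Suc k)
  have g': "(g has_derivative (\<lambda>h. h * frechet_derivative g (at t) 1)) (at t)" for t
  proof -
    let ?D = "frechet_derivative g (at t)"
    have D: "(g has_derivative ?D) (at t)"
      by (rule Ck_SucD(1)[OF Suc.prems(1)])
    have eq: "?D = (\<lambda>h. h * ?D 1)"
    proof
      show "?D h = h * ?D 1" for h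
        using linear_scale[OF has_derivative_linear[OF D], of h 1] by simp
    qed
    show ?thesis
      using D by (subst (asm) eq)
  qed
  show ?case
  proof (rule Ck_SucI)
    show "((\<lambda>x. g (h x)) has_derivative
        (\<lambda>v. frechet_derivative h (at x) v * frechet_derivative g (at (h x)) 1)) (at x)" for x
      by (rule has_derivative_compose[OF Ck_SucD(1)[OF Suc.prems(2)] g'])
  next
    show "Ck k (\<lambda>x. frechet_derivative h (at x) i * frechet_derivative g (at (h x)) 1)"
      if "i \<in> Basis" for i
      by (rule Ck_mult[OF Ck_SucD(2)[OF Suc.prems(2) that]
            Suc.IH[OF Ck_SucD(2)[OF Suc.prems(1)] Ck_decr[OF Suc.prems(2)]]]) simp
  qed
qed

lemma Ck_Suc_realI:
  assumes "\<And>t. (g has_real_derivative g' t) (at t)" and "Ck k g'"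
  shows "Ck (Suc k) g"
  by (rule Ck_SucI[where D = "\<lambda>t h. g' t * h"])
    (use assms in \<open>auto simp: has_field_derivative_def\<close>)

section \<open>Smooth cutoffs on the real line\<close>

definition bump :: "real poly \<Rightarrow> real \<Rightarrow> real" where
  "bump p t = (if t > 0 then poly p (1/t) * exp (- (1/t)) else 0)"

lemma tendsto_poly_mult_exp_neg: "((\<lambda>x::real. poly p x * exp (- x)) \<longlongrightarrow> 0) at_top"
proof -
  have "((\<lambda>x::real. \<Sum>i\<le>degree p. coeff p i * (x ^ i / exp x)) \<longlongrightarrow> (\<Sum>i\<le>degree p. coeff p i * 0)) at_top"
    by (intro tendsto_intros tendsto_power_div_exp_0)
  moreover have "(\<Sum>i\<le>degree p. coeff p i * (x ^ i / exp x)) = poly p x * exp (- x)" for x :: real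
    unfolding poly_altdef sum_distrib_right by (intro sum.cong) (simp_all add: exp_minus divide_inverse)
  ultimately show ?thesis by simp
qed

text \<open>The polynomial in \<open>bump\<close> is there for this: the derivative of p(1/t)
  exp(-1/t) is x^2 (p(x) - p'(x)) exp(-x) at x = 1/t, again a member of the family. One induction
  then proves all members smooth.\<close>

lemma bump_has_derivative:
  "(bump p has_real_derivative bump ([:0,0,1:] * (p - pderiv p)) t) (at t)"
proof -
  consider "t > 0" | "t < 0" | "t = 0" by linarith
  then show ?thesis
  proof cases
    case 1
    have inv: "((\<lambda>t. 1/t) has_real_derivative - (1/t^2)) (at t)"
      using 1 by (auto intro!: derivative_eq_intros simp: power2_eq_square)
    have "((\<lambda>t. poly p (1/t) * exp (- (1/t))) has_real_derivative
        (poly (pderiv p) (1/t) * - (1/t^2)) * exp (- (1/t)) +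
        (exp (- (1/t)) * - (- (1/t^2))) * poly p (1/t)) (at t)"
      by (intro DERIV_mult DERIV_chain2[OF poly_DERIV inv] DERIV_chain2[OF DERIV_exp] DERIV_minus inv)
    then have "((\<lambda>t. poly p (1/t) * exp (- (1/t))) has_real_derivative
        bump ([:0,0,1:] * (p - pderiv p)) t) (at t)"
      by (rule DERIV_cong) (use 1 in \<open>simp add: bump_def algebra_simps power2_eq_square\<close>)
    moreover have "\<forall>\<^sub>F s in nhds t. bump p s = poly p (1/s) * exp (- (1/s))"
      using eventually_nhds_in_open[of "{0<..}" t] 1 by (auto simp: bump_def elim: eventually_mono)
    ultimately show ?thesis
      by (subst DERIV_cong_ev[OF refl _ refl])
  next
    case 2
    have "\<forall>\<^sub>F s in nhds t. bump p s = 0"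
      using eventually_nhds_in_open[of "{..<0}" t] 2 by (auto simp: bump_def elim: eventually_mono)
    then have "(bump p has_real_derivative 0) (at t)"
      by (subst DERIV_cong_ev[OF refl _ refl]) auto
    then show ?thesis using 2 by (simp add: bump_def)
  next
    case 3
    \<comment> \<open>Dividing by \<open>h\<close> in the difference quotient at 0 multiplies the
      polynomial in 1/h by its variable, hence \<open>pCons 0 p\<close>.\<close>
    have "((\<lambda>h. poly (pCons 0 p) (1/h) * exp (- (1/h))) \<longlongrightarrow> 0) (at_right 0)"
      using filterlim_compose[OF tendsto_poly_mult_exp_neg[of "pCons 0 p"]
          filterlim_inverse_at_top_right]
      by (simp add: inverse_eq_divide)
    then have r: "((\<lambda>h. bump p h / h) \<longlongrightarrow> 0) (at_right 0)"
      by (rule Lim_transform_eventually)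
        (auto simp: bump_def eventually_at_right_less eventually_at_filter intro!: always_eventually)
    have l: "((\<lambda>h. bump p h / h) \<longlongrightarrow> 0) (at_left 0)"
      by (rule Lim_transform_eventually[where f = "\<lambda>_. 0"])
        (auto simp: bump_def eventually_at_filter intro!: always_eventually)
    show ?thesis
      using filterlim_split_at[OF l r] 3 by (simp add: DERIV_def bump_def)
  qed
qed

lemma Ck_bump: "Ck k (bump p)"
proof (induction k arbitrary: p)
  case 0
  show ?case
    using bump_has_derivative[of p, THEN DERIV_isCont] by (simp add: continuous_on_eq_continuous_at)
next
  case (Suc k)
  show ?case by (rule Ck_Suc_realI[OF bump_has_derivative Suc])
qed

definition step :: "real \<Rightarrow> real" where "step = bump 1"

lemma step_simps: "t \<le> 0 \<Longrightarrow> step t = 0" "0 \<le> step t" "step t \<le> 1"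
  by (auto simp: step_def bump_def)

lemma Ck_step: "Ck k step"
  by (simp add: step_def Ck_bump)

text \<open>The shift by 1 makes the k-th cutoff vanish for t <= 1/(k+1), which leaves room for
  compact supports; the pointwise limit for t > 0 is not affected.\<close>

lemma tendsto_step:
  assumes "t > 0"
  shows "(\<lambda>k. step (real (Suc k) * t - 1)) \<longlonglongrightarrow> 1"
proof -
  have "filterlim (\<lambda>k. real (Suc k)) at_top sequentially"
    using filterlim_compose[OF filterlim_real_sequentially filterlim_Suc] by simp
  then have *: "filterlim (\<lambda>k. -1 + t * real (Suc k)) at_top sequentially"
    by (intro filterlim_tendsto_add_at_top[OF tendsto_const]
        filterlim_tendsto_pos_mult_at_top[OF tendsto_const assms])
  from * have top: "filterlim (\<lambda>k. real (Suc k) * t - 1) at_top sequentially"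
    by (simp add: algebra_simps)
  then have "(\<lambda>k. exp (- inverse (real (Suc k) * t - 1))) \<longlonglongrightarrow> exp (- 0)"
    by (intro tendsto_exp tendsto_minus tendsto_inverse_0_at_top top)
  moreover have "\<forall>\<^sub>F k in sequentially. real (Suc k) * t - 1 > 0"
    using top unfolding filterlim_at_top_dense by blast
  ultimately show ?thesis
    by (auto simp: step_def bump_def field_simps elim!: Lim_transform_eventually eventually_mono)
qed


subsection \<open>Test functions and weak gradients\<close>

lemma compact_support_bounded:
  fixes h :: "'a::euclidean_space \<Rightarrow> 'b::real_normed_vector"
  assumes "continuous_on UNIV h" "compact K" "\<And>x. x \<notin> K \<Longrightarrow> h x = 0"
  obtains C where "0 \<le> C" "\<And>x. norm (h x) \<le> C"
proof -
  have "bounded (h ` K)"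
    using assms by (meson compact_continuous_image compact_imp_bounded continuous_on_subset subset_UNIV)
  then obtain C where C: "\<And>x. x \<in> K \<Longrightarrow> norm (h x) \<le> C"
    by (auto simp: bounded_iff)
  have "norm (h x) \<le> max C 0" for x
    using C[of x] assms(3)[of x] by (cases "x \<in> K") auto
  then show thesis using that[of "max C 0"] by auto
qed

lemma has_derivative_zero_off_support:
  fixes \<theta> :: "'a::euclidean_space \<Rightarrow> real"
  assumes "(\<theta> has_derivative D) (at x)" "closed K" "\<And>x. x \<notin> K \<Longrightarrow> \<theta> x = 0" "x \<notin> K"
  shows "D = (\<lambda>_. 0)"
proof -
  have "(\<theta> has_derivative (\<lambda>_. 0)) (at x)"
    by (rule has_derivative_transform_within_open[of "\<lambda>_. 0" _ _ _ "- K"]) (use assms in auto)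
  then show ?thesis
    by (rule has_derivative_unique[OF assms(1)])
qed

text \<open>The integral of a difference quotient vanishes by translation invariance of the measure.\<close>

lemma integral_derivative_compact_support:
  fixes \<theta> :: "'a::euclidean_space \<Rightarrow> real"
  assumes D: "\<And>x. (\<theta> has_derivative \<theta>' x) (at x)" and cont: "continuous_on UNIV (\<lambda>x. \<theta>' x v)"
    and K: "compact K" and supp: "\<And>x. x \<notin> K \<Longrightarrow> \<theta> x = 0"
  shows "(LINT x|lborel. \<theta>' x v) = 0"
proof -
  have c\<theta>: "continuous_on UNIV \<theta>"
    by (meson D continuous_at_imp_continuous_on has_derivative_continuous)
  have supp': "\<theta>' x v = 0" if "x \<notin> K" for x
    using has_derivative_zero_off_support[OF D compact_imp_closed[OF K] supp that] by simp
  obtain C where C: "0 \<le> C" "\<And>x. norm (\<theta>' x v) \<le> C"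
    using compact_support_bounded[OF cont K supp'] by metis
  \<comment> \<open>The difference quotients \<open>q k\<close> shift by at most the vector
    \<open>v\<close>, so this one compact set contains all their supports and carries the dominating
    function.\<close>
  define K' where "K' = {x + y |x y. x \<in> K \<and> y \<in> cball 0 (norm v)}"
  have K': "compact K'"
    unfolding K'_def by (intro compact_sums K compact_cball)
  define q where "q k x = (\<theta> (x + v /\<^sub>R Suc k) - \<theta> x) * real (Suc k)" for k x
  have int: "integrable lborel \<theta>"
  proof -
    have "integrable lborel (\<lambda>x. indicator K x *\<^sub>R \<theta> x)"
      by (rule borel_integrable_compact[OF K]) (use c\<theta> continuous_on_subset in blast)
    moreover have "(\<lambda>x. indicator K x *\<^sub>R \<theta> x) = \<theta>"
      using supp by (auto simp: indicator_def fun_eq_iff)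
    ultimately show ?thesis by simp
  qed
  have m\<theta>: "\<theta> \<in> borel_measurable borel"
    by (rule borel_measurable_continuous_onI[OF c\<theta>])
  have trans: "integrable lborel (\<lambda>x. \<theta> (x + w))" "(LINT x|lborel. \<theta> (x + w)) = (LINT x|lborel. \<theta> x)" for w
  proof -
    have *: "lborel = distr lborel borel ((+) w)" by (simp add: lborel_distr_plus)
    show "integrable lborel (\<lambda>x. \<theta> (x + w))"
      using int by (subst (asm) *) (simp add: integrable_distr_eq m\<theta> add.commute)
    show "(LINT x|lborel. \<theta> (x + w)) = (LINT x|lborel. \<theta> x)"
      by (subst (2) *) (simp add: integral_distr m\<theta> add.commute)
  qed
  have zero: "(LINT x|lborel. q k x) = 0" for k
    unfolding q_def using trans[of "v /\<^sub>R Suc k"] int by simp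
  have bound: "norm (q k x) \<le> C * indicator K' x" for k x
  proof -
    have has_derivative_line: "((\<lambda>t. \<theta> (x + t *\<^sub>R v)) has_derivative
        (\<lambda>h. \<theta>' (x + t *\<^sub>R v) (h *\<^sub>R v))) (at t)" for t
      by (rule has_derivative_compose[OF _ D]) (auto intro!: derivative_eq_intros)
    have "\<exists>s\<in>{0..1/Suc k}. q k x = \<theta>' (x + s *\<^sub>R v) v"
    proof -
      have "\<exists>s\<in>{0<..<1/Suc k}. \<theta> (x + (1/Suc k) *\<^sub>R v) - \<theta> (x + 0 *\<^sub>R v) =
          (\<lambda>h. \<theta>' (x + s *\<^sub>R v) (h *\<^sub>R v)) (1/Suc k - 0)"
      proof (rule mvt[where f = "\<lambda>t. \<theta> (x + t *\<^sub>R v)"])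
        show "continuous_on {0..1/Suc k} (\<lambda>t. \<theta> (x + t *\<^sub>R v))"
          by (intro continuous_at_imp_continuous_on ballI has_derivative_continuous[OF has_derivative_line])
      qed (use has_derivative_line in auto)
      then obtain s where s: "s \<in> {0<..<1/Suc k}"
        "\<theta> (x + v /\<^sub>R Suc k) - \<theta> x = \<theta>' (x + s *\<^sub>R v) ((1/Suc k) *\<^sub>R v)"
        by (auto simp: divide_inverse)
      have "\<theta>' (x + s *\<^sub>R v) ((1/Suc k) *\<^sub>R v) = (1/Suc k) * \<theta>' (x + s *\<^sub>R v) v"
        using linear_scale[OF has_derivative_linear[OF D]] by (metis real_scaleR_def)
      then have "q k x = \<theta>' (x + s *\<^sub>R v) v"
        unfolding q_def s(2) by (simp add: field_simps)
      with s(1) show ?thesis by force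
    qed
    then obtain s where s: "0 \<le> s" "s \<le> 1/Suc k" "q k x = \<theta>' (x + s *\<^sub>R v) v" by auto
    show ?thesis
    proof (cases "x + s *\<^sub>R v \<in> K")
      case True
      have "1 / real (Suc k) \<le> 1" by simp
      then have "s \<le> 1" using s(2) by linarith
      then have "norm (- (s *\<^sub>R v)) \<le> norm v" using s(1) by (simp add: mult_left_le_one_le)
      then have "x \<in> K'"
        unfolding K'_def mem_Collect_eq using True
        by (intro exI[of _ "x + s *\<^sub>R v"] exI[of _ "- (s *\<^sub>R v)"]) simp
      then show ?thesis using C(2) s(3) by simp
    next
      case False
      then show ?thesis using s(3) supp' C(1) by simp
    qed
  qed
  have lim: "(\<lambda>k. q k x) \<longlonglongrightarrow> \<theta>' x v" for x
  proof -
    have "((\<lambda>t. \<theta> (x + t *\<^sub>R v)) has_derivative (\<lambda>h. \<theta>' (x + 0 *\<^sub>R v) (h *\<^sub>R v))) (at 0)"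
      by (rule has_derivative_compose[OF _ D]) (auto intro!: derivative_eq_intros)
    moreover have "(\<lambda>h. \<theta>' (x + 0 *\<^sub>R v) (h *\<^sub>R v)) = (*) (\<theta>' x v)"
      using linear_scale[OF has_derivative_linear[OF D]] by (auto simp: mult.commute)
    ultimately have "((\<lambda>t. \<theta> (x + t *\<^sub>R v)) has_real_derivative \<theta>' x v) (at 0)"
      by (simp add: has_field_derivative_def)
    then have "((\<lambda>h. (\<theta> (x + h *\<^sub>R v) - \<theta> x) / h) \<longlongrightarrow> \<theta>' x v) (at 0)"
      by (simp add: DERIV_def)
    then have "((\<lambda>k. (\<theta> (x + inverse (real (Suc k)) *\<^sub>R v) - \<theta> x) / inverse (real (Suc k))) \<longlongrightarrow> \<theta>' x v) sequentially"
      by (rule filterlim_compose)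
        (use LIMSEQ_inverse_real_of_nat in \<open>auto simp: filterlim_at\<close>)
    then show ?thesis unfolding q_def by (simp add: divide_inverse)
  qed
  have "(\<lambda>k. LINT x|lborel. q k x) \<longlonglongrightarrow> (LINT x|lborel. \<theta>' x v)"
  proof (rule integral_dominated_convergence)
    show "(\<lambda>x. \<theta>' x v) \<in> borel_measurable lborel"
      using borel_measurable_continuous_onI[OF cont] by simp
    show "q k \<in> borel_measurable lborel" for k
      unfolding q_def using trans(1)[of "v /\<^sub>R Suc k"] m\<theta> by measurable
    show "integrable lborel (\<lambda>x. C * indicator K' x)"
      using borel_integrable_compact[OF K', of "\<lambda>_. C"] by (simp add: mult.commute)
  qed (use lim bound in auto)
  then show ?thesis by (simp add: zero LIMSEQ_const_iff)
qed

lemma lborel_integral_lebesgue_on: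
  fixes h :: "'a::euclidean_space \<Rightarrow> 'b::euclidean_space"
  assumes "h \<in> borel_measurable borel" "\<Omega> \<in> sets lebesgue" "\<And>x. x \<notin> \<Omega> \<Longrightarrow> h x = 0"
  shows "(LINT x|lebesgue_on \<Omega>. h x) = (LINT x|lborel. h x)"
proof -
  have "(LINT x|lebesgue_on \<Omega>. h x) = (LINT x|lebesgue. indicator \<Omega> x *\<^sub>R h x)"
    using assms(2) by (intro integral_restrict_space) auto
  also have "(\<lambda>x. indicator \<Omega> x *\<^sub>R h x) = h"
    using assms(3) by (auto simp: indicator_def)
  also have "(LINT x|lebesgue. h x) = (LINT x|lborel. h x)"
    using assms(1) by (intro integral_completion) auto
  finally show ?thesis .
qed

lemma classical_grad_inner:
  assumes "(\<phi> has_derivative D) (at x)"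
  shows "classical_grad \<phi> x \<bullet> v = D v"
proof -
  have D: "frechet_derivative \<phi> (at x) = D"
    using frechet_derivative_at[OF assms] by simp
  have "D v = D (\<Sum>i\<in>Basis. (v \<bullet> i) *\<^sub>R i)" by (simp add: euclidean_representation)
  also have "\<dots> = (\<Sum>i\<in>Basis. (v \<bullet> i) * D i)"
    using has_derivative_linear[OF assms] by (simp add: linear_sum linear_scale)
  finally show ?thesis
    by (simp add: classical_grad_def D inner_sum_left inner_commute[of v] mult.commute)
qed

lemma test_functionsD:
  assumes "\<phi> \<in> test_functions \<Omega>"
  shows "Ck k \<phi>" "continuous_on UNIV \<phi>"
    "(\<phi> has_derivative (\<lambda>v. classical_grad \<phi> x \<bullet> v)) (at x)"
    "continuous_on UNIV (classical_grad \<phi>)"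
    "\<exists>K. compact K \<and> K \<subseteq> \<Omega> \<and> (\<forall>x. x \<notin> K \<longrightarrow> \<phi> x = 0 \<and> classical_grad \<phi> x = 0)"
    "x \<notin> \<Omega> \<Longrightarrow> \<phi> x = 0" "x \<notin> \<Omega> \<Longrightarrow> classical_grad \<phi> x = 0"
proof -
  show Ck: "Ck k \<phi>" for k using assms by (auto simp: test_functions_def)
  show "continuous_on UNIV \<phi>" using Ck_continuous_on[OF Ck[of 0]] .
  have D: "(\<phi> has_derivative frechet_derivative \<phi> (at x)) (at x)" for x
    using Ck_SucD(1)[OF Ck] .
  then show D': "(\<phi> has_derivative (\<lambda>v. classical_grad \<phi> x \<bullet> v)) (at x)" for x
    using classical_grad_inner[OF D] by simp
  have "continuous_on UNIV (\<lambda>x. frechet_derivative \<phi> (at x) i)" if "i \<in> Basis" for i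
    using Ck_SucD(2)[OF Ck that] Ck_continuous_on by blast
  then show "continuous_on UNIV (classical_grad \<phi>)"
    unfolding classical_grad_def by (intro continuous_intros) auto
  let ?K = "closure {x. \<phi> x \<noteq> 0}"
  have 0: "\<phi> x = 0" if "x \<notin> ?K" for x
    using that closure_subset[of "{x. \<phi> x \<noteq> 0}"] by auto
  have 1: "classical_grad \<phi> x = 0" if "x \<notin> ?K" for x
    using has_derivative_zero_off_support[OF D' closed_closure 0 that]
    by (metis inner_eq_zero_iff)
  show K: "\<exists>K. compact K \<and> K \<subseteq> \<Omega> \<and> (\<forall>x. x \<notin> K \<longrightarrow> \<phi> x = 0 \<and> classical_grad \<phi> x = 0)"
  proof (intro exI conjI)
    show "compact ?K" "?K \<subseteq> \<Omega>" using assms by (simp_all add: test_functions_def)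
    show "\<forall>x. x \<notin> ?K \<longrightarrow> \<phi> x = 0 \<and> classical_grad \<phi> x = 0" using 0 1 by blast
  qed
  show "x \<notin> \<Omega> \<Longrightarrow> \<phi> x = 0" "x \<notin> \<Omega> \<Longrightarrow> classical_grad \<phi> x = 0" using K by blast+
qed

lemma test_functionsI:
  assumes "\<And>k. Ck k \<phi>" "compact K" "K \<subseteq> \<Omega>" "\<And>x. x \<notin> K \<Longrightarrow> \<phi> x = 0"
  shows "\<phi> \<in> test_functions \<Omega>"
proof -
  have "closure {x. \<phi> x \<noteq> 0} \<subseteq> K"
    using assms by (intro closure_minimal) (auto intro: compact_imp_closed)
  moreover have "compact (closure {x. \<phi> x \<noteq> 0})"
    using calculation assms(2) by (metis closed_closure compact_Int_closed inf.absorb_iff2)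
  ultimately show ?thesis
    using assms(1,3) by (simp add: test_functions_def)
qed

lemma test_function_bounded:
  assumes "\<phi> \<in> test_functions \<Omega>"
  obtains C where "0 \<le> C" "\<And>x. \<bar>\<phi> x\<bar> \<le> C" "\<And>x. norm (classical_grad \<phi> x) \<le> C"
proof -
  obtain K where K: "compact K" "\<And>x. x \<notin> K \<Longrightarrow> \<phi> x = 0" "\<And>x. x \<notin> K \<Longrightarrow> classical_grad \<phi> x = 0"
    using test_functionsD(5)[OF assms] by auto
  obtain C where "0 \<le> C" "\<And>x. norm (\<phi> x) \<le> C"
    using compact_support_bounded[OF test_functionsD(2)[OF assms] K(1,2)] by metis
  moreover obtain C' where "0 \<le> C'" "\<And>x. norm (classical_grad \<phi> x) \<le> C'"
    using compact_support_bounded[OF test_functionsD(4)[OF assms] K(1,3)] by metis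
  ultimately show thesis
    using that[of "max C C'"] by (auto simp: le_max_iff_disj)
qed

section \<open>Integrability and convergence on bounded open sets\<close>

lemma finite_measure_lebesgue_on_bounded:
  "open \<Omega> \<Longrightarrow> bounded \<Omega> \<Longrightarrow> finite_measure (lebesgue_on \<Omega>)"
  by (intro finite_measure_lebesgue_on lmeasurable_open)

lemma integrable_lebesgue_on_bounded:
  fixes h :: "'a::euclidean_space \<Rightarrow> 'b::euclidean_space"
  assumes "open \<Omega>" "bounded \<Omega>" "h \<in> borel_measurable (lebesgue_on \<Omega>)" "\<And>x. x \<in> \<Omega> \<Longrightarrow> norm (h x) \<le> C"
  shows "integrable (lebesgue_on \<Omega>) h"
  by (rule finite_measure.integrable_const_bound[OF finite_measure_lebesgue_on_bounded[OF assms(1,2)], of _ C])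
    (use assms in auto)

lemma bounded_convergence:
  fixes h :: "nat \<Rightarrow> 'a::euclidean_space \<Rightarrow> 'b::euclidean_space"
  assumes "open \<Omega>" "bounded \<Omega>" and h: "\<And>k. h k \<in> borel_measurable (lebesgue_on \<Omega>)"
    and C: "\<And>k x. x \<in> \<Omega> \<Longrightarrow> norm (h k x) \<le> C" and lim: "\<And>x. x \<in> \<Omega> \<Longrightarrow> (\<lambda>k. h k x) \<longlonglongrightarrow> w x"
  shows "(\<lambda>k. LINT x|lebesgue_on \<Omega>. h k x) \<longlonglongrightarrow> (LINT x|lebesgue_on \<Omega>. w x)"
proof (rule integral_dominated_convergence)
  show "w \<in> borel_measurable (lebesgue_on \<Omega>)"
    by (rule borel_measurable_LIMSEQ_metric[OF h]) (use lim in auto)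
  show "integrable (lebesgue_on \<Omega>) (\<lambda>x. C)"
    by (rule finite_measure.integrable_const[OF finite_measure_lebesgue_on_bounded[OF assms(1,2)]])
qed (use assms in auto)

lemma borel_measurable_lebesgue_onI:
  "h \<in> borel_measurable borel \<Longrightarrow> h \<in> borel_measurable (lebesgue_on \<Omega>)"
  by (intro measurable_restrict_space1 measurable_completion) auto

lemma bounded_imp_L2:
  fixes h :: "'a::euclidean_space \<Rightarrow> 'b::euclidean_space"
  assumes "open \<Omega>" "bounded \<Omega>" "h \<in> borel_measurable (lebesgue_on \<Omega>)" "\<And>x. x \<in> \<Omega> \<Longrightarrow> norm (h x) \<le> C"
  shows "h \<in> L2 \<Omega>"
proof -
  have "integrable (lebesgue_on \<Omega>) (\<lambda>x. (norm (h x))\<^sup>2)"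
    by (rule integrable_lebesgue_on_bounded[of _ _ "C\<^sup>2"])
      (use assms in \<open>auto intro!: power_mono\<close>)
  then show ?thesis using assms by (simp add: L2_def)
qed

lemma L2_imp_integrable:
  assumes "open \<Omega>" "bounded \<Omega>" "h \<in> L2 \<Omega>"
  shows "integrable (lebesgue_on \<Omega>) h"
proof (rule Bochner_Integration.integrable_bound)
  show "integrable (lebesgue_on \<Omega>) (\<lambda>x. 1 + (norm (h x))\<^sup>2)"
    using assms by (intro Bochner_Integration.integrable_add
        finite_measure.integrable_const[OF finite_measure_lebesgue_on_bounded]) (auto simp: L2_def)
  show "h \<in> borel_measurable (lebesgue_on \<Omega>)" using assms by (simp add: L2_def)
  have "norm (h x) \<le> norm (1 + (norm (h x))\<^sup>2)" for x
    using sum_squares_bound[of 1 "norm (h x)"] norm_ge_zero[of "h x"] unfolding power_one real_norm_def by linarith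
  then show "AE x in lebesgue_on \<Omega>. norm (h x) \<le> norm (1 + (norm (h x))\<^sup>2)" by simp
qed

lemma test_function_measurable:
  assumes "\<phi> \<in> test_functions \<Omega>"
  shows "\<phi> \<in> borel_measurable (lebesgue_on S)" "classical_grad \<phi> \<in> borel_measurable (lebesgue_on S)"
  by (intro borel_measurable_lebesgue_onI borel_measurable_continuous_onI
      test_functionsD(2)[OF assms] test_functionsD(4)[OF assms])+

lemma test_function_L2:
  assumes "open \<Omega>" "bounded \<Omega>" "\<phi> \<in> test_functions \<Omega>"
  shows "\<phi> \<in> L2 \<Omega>" "classical_grad \<phi> \<in> L2 \<Omega>"
proof -
  obtain C where "\<And>x. \<bar>\<phi> x\<bar> \<le> C" "\<And>x. norm (classical_grad \<phi> x) \<le> C"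
    using test_function_bounded[OF assms(3)] by metis
  then show "\<phi> \<in> L2 \<Omega>" "classical_grad \<phi> \<in> L2 \<Omega>"
    using assms test_function_measurable[OF assms(3)] by (auto intro!: bounded_imp_L2)
qed

text \<open>The integrand is the derivative of \<open>g x * \<phi> x\<close> in direction
  \<open>v\<close>; the product has compact support although \<open>g\<close> is arbitrary outside
  the support of \<open>\<phi>\<close>.\<close>

lemma integral_by_parts_test:
  fixes \<phi> :: "'a::euclidean_space \<Rightarrow> real"
  assumes "open \<Omega>" and \<phi>: "\<phi> \<in> test_functions \<Omega>"
    and g: "\<And>x. (g has_derivative g' x) (at x)" "continuous_on UNIV (\<lambda>x. g' x v)"
  shows "(LINT x|lebesgue_on \<Omega>. g x * (classical_grad \<phi> x \<bullet> v) + g' x v * \<phi> x) = 0"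
proof -
  let ?h = "\<lambda>x. g x * (classical_grad \<phi> x \<bullet> v) + g' x v * \<phi> x"
  obtain K where K: "compact K" "\<And>x. x \<notin> K \<Longrightarrow> \<phi> x = 0"
    using test_functionsD(5)[OF \<phi>] by auto
  have cg: "continuous_on UNIV g"
    by (meson g continuous_at_imp_continuous_on has_derivative_continuous)
  have c: "continuous_on UNIV ?h"
    using test_functionsD(2,4)[OF \<phi>] g(2) cg by (intro continuous_intros)
  have "(LINT x|lebesgue_on \<Omega>. ?h x) = (LINT x|lborel. ?h x)"
    by (rule lborel_integral_lebesgue_on)
      (use assms test_functionsD[OF \<phi>] c in \<open>auto intro: borel_measurable_continuous_onI lmeasurable_open\<close>)
  also have "\<dots> = 0"
    by (rule integral_derivative_compact_support[where \<theta> = "\<lambda>x. g x * \<phi> x"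
          and \<theta>' = "\<lambda>x v. g x * (classical_grad \<phi> x \<bullet> v) + g' x v * \<phi> x", OF _ c K(1)])
      (use K in \<open>auto intro!: has_derivative_mult g test_functionsD(3)[OF \<phi>]\<close>)
  finally show ?thesis .
qed

lemma test_function_weak_grad:
  fixes \<phi> :: "'a::euclidean_space \<Rightarrow> real"
  assumes "open \<Omega>" "bounded \<Omega>" and \<phi>: "\<phi> \<in> test_functions \<Omega>"
  shows "is_weak_grad \<Omega> \<phi> (classical_grad \<phi>)"
  unfolding is_weak_grad_def
proof
  fix \<psi> :: "'a \<Rightarrow> real" assume \<psi>: "\<psi> \<in> test_functions \<Omega>"
  have int: "integrable (lebesgue_on \<Omega>) (\<lambda>x. \<phi> x *\<^sub>R classical_grad \<psi> x)"
    if \<phi>: "\<phi> \<in> test_functions \<Omega>" and \<psi>: "\<psi> \<in> test_functions \<Omega>" for \<phi> \<psi>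
  proof -
    obtain C where "0 \<le> C" "\<And>x. \<bar>\<phi> x\<bar> \<le> C" using test_function_bounded[OF \<phi>] by metis
    moreover obtain C' where "\<And>x. norm (classical_grad \<psi> x) \<le> C'" using test_function_bounded[OF \<psi>] by metis
    ultimately show ?thesis
      using assms test_function_measurable[OF \<phi>] test_function_measurable[OF \<psi>]
      by (intro integrable_lebesgue_on_bounded[where C = "C * C'"]) (auto intro!: mult_mono)
  qed
  have "(LINT x|lebesgue_on \<Omega>. \<phi> x *\<^sub>R classical_grad \<psi> x + \<psi> x *\<^sub>R classical_grad \<phi> x) \<bullet> i = 0"
    if "i \<in> Basis" for i
  proof -
    have "(LINT x|lebesgue_on \<Omega>. \<phi> x *\<^sub>R classical_grad \<psi> x + \<psi> x *\<^sub>R classical_grad \<phi> x) \<bullet> i =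
        (LINT x|lebesgue_on \<Omega>. \<phi> x * (classical_grad \<psi> x \<bullet> i) + (classical_grad \<phi> x \<bullet> i) * \<psi> x)"
      using int[OF \<phi> \<psi>] int[OF \<psi> \<phi>]
      by (subst integral_inner_left[symmetric]) (auto simp: inner_add_left mult.commute)
    also have "\<dots> = 0"
      by (rule integral_by_parts_test[OF assms(1) \<psi> test_functionsD(3)[OF \<phi>]])
        (intro continuous_intros test_functionsD(4)[OF \<phi>])
    finally show ?thesis .
  qed
  then have "(LINT x|lebesgue_on \<Omega>. \<phi> x *\<^sub>R classical_grad \<psi> x + \<psi> x *\<^sub>R classical_grad \<phi> x) = 0"
    by (metis euclidean_all_zero_iff)
  then show "(LINT x|lebesgue_on \<Omega>. \<phi> x *\<^sub>R classical_grad \<psi> x) = - (LINT x|lebesgue_on \<Omega>. \<psi> x *\<^sub>R classical_grad \<phi> x)"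
    using int[OF \<phi> \<psi>] int[OF \<psi> \<phi>] by (simp add: eq_neg_iff_add_eq_0)
qed

section \<open>The fundamental lemma of the calculus of variations\<close>

lemma test_function_box:
  fixes a b :: "'a::euclidean_space"
  assumes "cbox a b \<subseteq> \<Omega>"
  obtains \<phi> where "\<And>k::nat. \<phi> k \<in> test_functions \<Omega>" "\<And>k x. \<bar>\<phi> k x\<bar> \<le> 1"
    "\<And>x. (\<lambda>k. \<phi> k x) \<longlonglongrightarrow> indicator (box a b) x"
proof -
  let ?s = "\<lambda>k (x::'a) i. step (real (Suc k) * ((x \<bullet> i) - a \<bullet> i) - 1) * step (real (Suc k) * ((b \<bullet> i) - x \<bullet> i) - 1)"
  define \<phi> where "\<phi> k x = (\<Prod>i\<in>Basis. ?s k x i)" for k x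
  have s0: "?s k x i = 0" if "\<not> (a \<bullet> i < x \<bullet> i \<and> x \<bullet> i < b \<bullet> i)" for k x i
  proof -
    from that consider "x \<bullet> i - a \<bullet> i \<le> 0" | "b \<bullet> i - x \<bullet> i \<le> 0" by linarith
    then show ?thesis
    proof cases
      case 1
      then have "real (Suc k) * (x \<bullet> i - a \<bullet> i) \<le> 0" by (intro mult_nonneg_nonpos) auto
      then show ?thesis by (simp add: step_simps)
    next
      case 2
      then have "real (Suc k) * (b \<bullet> i - x \<bullet> i) \<le> 0" by (intro mult_nonneg_nonpos) auto
      then show ?thesis by (simp add: step_simps)
    qed
  qed
  have Ck: "Ck m (\<phi> k)" for k m
    unfolding \<phi>_def diff_conv_add_uminus
    by (intro Ck_prod Ck_mult Ck_compose[OF Ck_step] Ck_add Ck_const Ck_inner)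
      (use Ck_mult[OF Ck_const Ck_inner, of m "-1"] in simp)
  have off: "\<phi> k x = 0" if "x \<notin> box a b" for k x
    using that s0 unfolding \<phi>_def by (auto simp: mem_box intro!: prod_zero)
  show thesis
  proof
    show "\<phi> k \<in> test_functions \<Omega>" for k
      using Ck off box_subset_cbox by (intro test_functionsI[OF _ compact_cbox assms]) blast+
    show "\<bar>\<phi> k x\<bar> \<le> 1" for k x
      unfolding \<phi>_def abs_prod by (intro prod_le_1) (auto simp: step_simps abs_mult intro: mult_le_one)
    show "(\<lambda>k. \<phi> k x) \<longlonglongrightarrow> indicator (box a b) x" for x
    proof (cases "x \<in> box a b")
      case True
      have "(\<lambda>k. \<phi> k x) \<longlonglongrightarrow> (\<Prod>i\<in>(Basis::'a set). 1 * 1)"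
        unfolding \<phi>_def by (intro tendsto_prod tendsto_mult tendsto_step) (use True in \<open>auto simp: mem_box\<close>)
      then show ?thesis using True by simp
    next
      case False
      then show ?thesis using off by simp
    qed
  qed
qed

text \<open>Indicators of boxes are bounded limits of test functions, so \<open>h\<close> has
  integral zero over every box inside \<open>\<Omega>\<close>. Lebesgue differentiation along cubes
  with corner \<open>x\<close> recovers \<open>h x\<close> for almost every
  \<open>x\<close>.\<close>

lemma fundamental_lemma_variations:
  fixes h :: "'a::euclidean_space \<Rightarrow> 'b::euclidean_space"
  assumes "open \<Omega>" and h: "integrable (lebesgue_on \<Omega>) h"
    and zero: "\<And>\<phi>. \<phi> \<in> test_functions \<Omega> \<Longrightarrow> (LINT x|lebesgue_on \<Omega>. \<phi> x *\<^sub>R h x) = 0"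
  shows "AE x in lebesgue_on \<Omega>. h x = 0"
proof -
  have \<Omega>: "\<Omega> \<in> sets lebesgue" using assms(1) by auto
  define H where "H x = indicator \<Omega> x *\<^sub>R h x" for x
  have H: "integrable lebesgue H"
    unfolding H_def using h \<Omega> by (subst (asm) integrable_restrict_space) auto
  have Hzero: "(LINT x|lebesgue. \<phi> x *\<^sub>R H x) = 0" if "\<phi> \<in> test_functions \<Omega>" for \<phi>
    using zero[OF that] \<Omega> by (subst (asm) integral_restrict_space) (auto simp: H_def mult.commute)
  have box0: "integral (cbox a b) H = 0" if sub: "cbox a b \<subseteq> \<Omega>" for a b
  proof -
    obtain \<phi> where \<phi>: "\<And>k::nat. \<phi> k \<in> test_functions \<Omega>" "\<And>k x. \<bar>\<phi> k x\<bar> \<le> 1"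
      "\<And>x. (\<lambda>k. \<phi> k x) \<longlonglongrightarrow> indicator (box a b) x"
      using test_function_box[OF sub] by blast
    have "(\<lambda>k. LINT x|lebesgue. \<phi> k x *\<^sub>R H x) \<longlonglongrightarrow> (LINT x|lebesgue. indicator (box a b) x *\<^sub>R H x)"
    proof (rule integral_dominated_convergence)
      show "integrable lebesgue (\<lambda>x. norm (H x))" using H by simp
      show "AE x in lebesgue. (\<lambda>k. \<phi> k x *\<^sub>R H x) \<longlonglongrightarrow> indicator (box a b) x *\<^sub>R H x"
        using \<phi>(3) by (intro always_eventually allI tendsto_scaleR) auto
      have "norm (\<phi> k x *\<^sub>R H x) \<le> norm (H x)" for k x
        using mult_right_mono[OF \<phi>(2), of "norm (H x)"] by simp
      then show "AE x in lebesgue. norm (\<phi> k x *\<^sub>R H x) \<le> norm (H x)" for k by simp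
      show "(\<lambda>x. \<phi> k x *\<^sub>R H x) \<in> borel_measurable lebesgue" for k
        using test_function_measurable(1)[OF \<phi>(1), where S = UNIV] borel_measurable_integrable[OF H]
        by (simp add: lebesgue_on_UNIV_eq)
      show "(\<lambda>x. indicator (box a b) x *\<^sub>R H x) \<in> borel_measurable lebesgue"
        using borel_measurable_integrable[OF H]
        by (intro borel_measurable_scaleR borel_measurable_indicator fmeasurableD lmeasurable_box)
    qed
    then have "(LINT x|lebesgue. indicator (box a b) x *\<^sub>R H x) = 0"
      using Hzero[OF \<phi>(1)] by (simp add: LIMSEQ_const_iff)
    moreover have "(LINT x|lebesgue. indicator (box a b) x *\<^sub>R H x) = integral (box a b) H"
    proof -
      have "integrable (lebesgue_on (box a b)) H"
        using integrable_mult_indicator[OF fmeasurableD[OF lmeasurable_box] H, of a b]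
        by (subst integrable_restrict_space) (auto intro: fmeasurableD)
      then show ?thesis
        using lebesgue_integral_eq_integral[of "box a b" H]
          integral_restrict_space[of "box a b" lebesgue H] fmeasurableD[OF lmeasurable_box, of a b]
        by simp
    qed
    ultimately show ?thesis by (simp add: integral_open_interval)
  qed
  have "H integrable_on cbox a b" for a b
    using integrable_on_lebesgue[OF H] integrable_on_subcbox by blast
  then obtain N where N: "negligible N"
    "\<And>x e. \<lbrakk>x \<notin> N; 0 < e\<rbrakk> \<Longrightarrow> \<exists>d>0. \<forall>h. 0 < h \<and> h < d \<longrightarrow>
       norm (integral (cbox x (x + h *\<^sub>R One)) H /\<^sub>R h ^ DIM('a) - H x) < e"
    using integrable_ccontinuous_explicit by blast
  have "h x = 0" if xN: "x \<in> \<Omega>" "x \<notin> N" for x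
  proof (rule ccontr)
    assume "h x \<noteq> 0"
    then have "0 < norm (H x)" using xN by (simp add: H_def)
    from N(2)[OF xN(2) this] obtain d where "d > 0" and d: "\<forall>t. 0 < t \<and> t < d \<longrightarrow>
        norm (integral (cbox x (x + t *\<^sub>R One)) H /\<^sub>R t ^ DIM('a) - H x) < norm (H x)"
      by (elim exE conjE)
    obtain e where e: "e > 0" "cball x e \<subseteq> \<Omega>"
      using assms(1) \<open>x \<in> \<Omega>\<close> open_contains_cball by blast
    \<comment> \<open>The l1 bound for the norm puts the cube with corner \<open>x\<close> and side
      \<open>t\<close> into the ball of radius DIM * t about \<open>x\<close>; halving
      \<open>d\<close> makes t < d strict.\<close>
    define t where "t = min (d/2) (e / DIM('a))"
    have t: "0 < t" "t < d" "t * DIM('a) \<le> e"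
      using \<open>d > 0\<close> e by (auto simp: t_def min_def field_simps)
    have "cbox x (x + t *\<^sub>R One) \<subseteq> cball x e"
    proof
      fix y assume y: "y \<in> cbox x (x + t *\<^sub>R One)"
      have "norm (y - x) \<le> (\<Sum>i\<in>Basis. \<bar>(y - x) \<bullet> i\<bar>)" by (rule norm_le_l1)
      also have "\<dots> \<le> (\<Sum>i\<in>(Basis::'a set). t)"
        by (intro sum_mono) (use y in \<open>auto simp: mem_box inner_diff_left inner_add_left\<close>)
      also have "\<dots> \<le> e" using t by (simp add: mult.commute)
      finally show "y \<in> cball x e" by (simp add: dist_norm norm_minus_commute)
    qed
    then have "integral (cbox x (x + t *\<^sub>R One)) H = 0" using box0 e(2) by blast
    then show False using d t(1,2) by fastforce
  qed
  then show ?thesis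
    using N(1) \<Omega> unfolding AE_restrict_space_iff[OF sets.Int_space_eq2[OF \<Omega>, THEN ssubst[where P = "\<lambda>S. S \<in> sets lebesgue"], OF \<Omega>]]
    by (auto simp: negligible_iff_null_sets intro: AE_I'[of N])
qed

text \<open>The difference of two weak gradients integrates to zero against every test function.
  This is what makes the choice operator in \<open>weak_grad\<close> harmless.\<close>

lemma weak_grad_unique:
  fixes u :: "'a::euclidean_space \<Rightarrow> real"
  assumes \<Omega>: "open \<Omega>" "bounded \<Omega>"
    and "g \<in> L2 \<Omega>" "is_weak_grad \<Omega> u g" "g' \<in> L2 \<Omega>" "is_weak_grad \<Omega> u g'"
  shows "AE x in lebesgue_on \<Omega>. g x = g' x"
proof -
  have int: "integrable (lebesgue_on \<Omega>) g" "integrable (lebesgue_on \<Omega>) g'"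
    using assms L2_imp_integrable by blast+
  have i: "integrable (lebesgue_on \<Omega>) (\<lambda>x. \<phi> x *\<^sub>R g x)"
    if \<phi>: "\<phi> \<in> test_functions \<Omega>" and g: "integrable (lebesgue_on \<Omega>) g" for \<phi> and g :: "'a \<Rightarrow> 'a"
  proof -
    obtain C where C: "0 \<le> C" "\<And>x. \<bar>\<phi> x\<bar> \<le> C" using test_function_bounded[OF \<phi>] by metis
    show ?thesis
      by (rule Bochner_Integration.integrable_bound[of _ "\<lambda>x. C *\<^sub>R g x"])
        (use g C test_function_measurable[OF \<phi>] in \<open>auto intro!: mult_right_mono\<close>)
  qed
  have "AE x in lebesgue_on \<Omega>. g x - g' x = 0"
  proof (rule fundamental_lemma_variations[OF \<Omega>(1)])
    show "(LINT x|lebesgue_on \<Omega>. \<phi> x *\<^sub>R (g x - g' x)) = 0" if \<phi>: "\<phi> \<in> test_functions \<Omega>" for \<phi>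
      using i[OF \<phi> int(1)] i[OF \<phi> int(2)] assms \<phi>
      by (simp add: scaleR_diff_right is_weak_grad_def)
  qed (use int in auto)
  then show ?thesis by simp
qed


subsection \<open>The radial Laplacian\<close>

text \<open>
  Radial functions are written \<open>x \<mapsto> U (x \<bullet> x)\<close>. With \<open>U' = ravg n F / 2\<close> the gradient of such a
  function is \<open>ravg n F (x \<bullet> x) *\<^sub>R x\<close>, and its divergence is \<open>F (x \<bullet> x)\<close> in dimension \<open>n\<close>.
\<close>

definition ravg :: "nat \<Rightarrow> (real \<Rightarrow> 'b::euclidean_space) \<Rightarrow> real \<Rightarrow> 'b" where
  "ravg n F t = (LINT s|lebesgue_on {0..1}. s ^ (n - 1) *\<^sub>R F (t * s\<^sup>2))"

text \<open>The profile of the radial function that vanishes at the origin and has Laplacian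
  \<open>F\<close>. The factor 1/2 comes from the chain rule for t = |x|^2.\<close>

definition rint :: "nat \<Rightarrow> (real \<Rightarrow> 'b::euclidean_space) \<Rightarrow> real \<Rightarrow> 'b" where
  "rint n F t = (1/2) *\<^sub>R integral {0..t} (ravg n F)"

text \<open>The characteristic functions of the system produce a single jump, at the squared radius
  \<open>t0\<close> of the small ball. Writing \<open>F\<close> with two functions continuous on the
  whole closed interval reduces bounds, measurability and limits to the continuous case.\<close>

definition pwc :: "real \<Rightarrow> real \<Rightarrow> (real \<Rightarrow> 'b::euclidean_space) \<Rightarrow> bool" where
  "pwc t0 T F \<longleftrightarrow> (\<exists>A B. continuous_on {0..T} A \<and> continuous_on {0..T} B \<and>
     (\<forall>t\<in>{0..T}. F t = A t + (if t < t0 then B t else 0)))"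

lemma pwc_if:
  assumes "continuous_on {0..T} A" "continuous_on {0..T} B"
  shows "pwc t0 T (\<lambda>t. if t < t0 then A t else B t)"
  unfolding pwc_def
  by (rule exI[of _ B], rule exI[of _ "\<lambda>t. A t - B t"]) (use assms in \<open>auto intro: continuous_intros\<close>)

lemma pwc_continuous: "continuous_on {0..T} F \<Longrightarrow> pwc t0 T F"
  using pwc_if[of T F F t0] by simp

lemma pwc_cong: "(\<And>t. t \<in> {0..T} \<Longrightarrow> F t = G t) \<Longrightarrow> pwc t0 T F \<longleftrightarrow> pwc t0 T G"
  unfolding pwc_def by simp

lemma pwc_add:
  assumes "pwc t0 T F" "pwc t0 T G"
  shows "pwc t0 T (\<lambda>t. F t + G t)"
proof -
  obtain A B A' B' where
    "continuous_on {0..T} A" "continuous_on {0..T} B" "continuous_on {0..T} A'" "continuous_on {0..T} B'"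
    "\<And>t. t\<in>{0..T} \<Longrightarrow> F t = A t + (if t < t0 then B t else 0)"
    "\<And>t. t\<in>{0..T} \<Longrightarrow> G t = A' t + (if t < t0 then B' t else 0)"
    using assms unfolding pwc_def by metis
  then show ?thesis
    unfolding pwc_def
    by (intro exI[of _ "\<lambda>t. A t + A' t"] exI[of _ "\<lambda>t. B t + B' t"]) (auto intro: continuous_intros)
qed

lemma pwc_scaleR:
  assumes "pwc t0 T F"
  shows "pwc t0 T (\<lambda>t. c *\<^sub>R F t)"
proof -
  obtain A B where
    "continuous_on {0..T} A" "continuous_on {0..T} B"
    "\<And>t. t\<in>{0..T} \<Longrightarrow> F t = A t + (if t < t0 then B t else 0)"
    using assms unfolding pwc_def by metis
  then show ?thesis
    unfolding pwc_def
    by (intro exI[of _ "\<lambda>t. c *\<^sub>R A t"] exI[of _ "\<lambda>t. c *\<^sub>R B t"])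
      (auto intro: continuous_intros simp: scaleR_add_right)
qed

lemma pwc_bounded:
  assumes "pwc t0 T F"
  obtains C where "0 \<le> C" "\<And>t. t \<in> {0..T} \<Longrightarrow> norm (F t) \<le> C"
proof -
  obtain A B where AB:
    "continuous_on {0..T} A" "continuous_on {0..T} B"
    "\<And>t. t\<in>{0..T} \<Longrightarrow> F t = A t + (if t < t0 then B t else 0)"
    using assms unfolding pwc_def by metis
  have "bounded (A ` {0..T})" "bounded (B ` {0..T})"
    using AB by (auto intro!: compact_imp_bounded compact_continuous_image)
  then obtain a b where "\<And>t. t \<in> {0..T} \<Longrightarrow> norm (A t) \<le> a" "\<And>t. t \<in> {0..T} \<Longrightarrow> norm (B t) \<le> b"
    unfolding bounded_iff by blast
  then have "norm (F t) \<le> max 0 (a + b)" if "t \<in> {0..T}" for t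
    using AB(3)[OF that] that norm_triangle_ineq[of "A t" "B t"] norm_ge_zero[of "B t"]
    by (smt (verit, best) add.right_neutral)
  then show thesis using that[of "max 0 (a + b)"] by simp
qed

lemma pwc_measurable:
  fixes F :: "real \<Rightarrow> 'b::euclidean_space" and h :: "'a::euclidean_space \<Rightarrow> real"
  assumes F: "pwc t0 T F" and h: "continuous_on UNIV h" and S: "S \<in> sets lebesgue" and hS: "h ` S \<subseteq> {0..T}"
  shows "(\<lambda>x. F (h x)) \<in> borel_measurable (lebesgue_on S)"
proof -
  obtain A B where AB:
    "continuous_on {0..T} A" "continuous_on {0..T} B"
    "\<And>t. t\<in>{0..T} \<Longrightarrow> F t = A t + (if t < t0 then B t else 0)"
    using F unfolding pwc_def by metis
  have c: "continuous_on S h" using h continuous_on_subset by blast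
  have meas: "(\<lambda>x. A (h x)) \<in> borel_measurable (lebesgue_on S)" "(\<lambda>x. B (h x)) \<in> borel_measurable (lebesgue_on S)"
    by (intro continuous_imp_measurable_on_sets_lebesgue continuous_on_compose2[OF AB(1) c]
        continuous_on_compose2[OF AB(2) c] S hS)+
  have hm: "h \<in> borel_measurable (lebesgue_on S)"
    by (intro continuous_imp_measurable_on_sets_lebesgue c S)
  have "(\<lambda>x. A (h x) + (if h x < t0 then B (h x) else 0)) \<in> borel_measurable (lebesgue_on S)"
    using meas hm by measurable
  then show ?thesis
    by (rule measurable_cong[THEN iffD2, rotated]) (use AB(3) hS in auto)
qed

lemma measure_unit_interval: "measure (lebesgue_on {0..1::real}) (space (lebesgue_on {0..1})) = 1"
  by (simp add: measure_restrict_space space_restrict_space)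

lemma finite_measure_unit_interval: "finite_measure (lebesgue_on {0..1::real})"
  by (intro finite_measure_lebesgue_on) auto

lemma mult_square_mem: "t \<in> {0..T} \<Longrightarrow> s \<in> {0..1} \<Longrightarrow> t * s\<^sup>2 \<in> {0..t::real}"
  using power_le_one[of s 2] by (auto simp: mult_left_le)

section \<open>Averages of functions with one jump\<close>

context
  fixes t0 T t :: real and n :: nat
  assumes t: "t \<in> {0..T}"
begin

lemma ravg_integrand_measurable:
  fixes F :: "real \<Rightarrow> 'b::euclidean_space"
  assumes "pwc t0 T F"
  shows "(\<lambda>s. s ^ (n - 1) *\<^sub>R F (t * s\<^sup>2)) \<in> borel_measurable (lebesgue_on {0..1})"
proof (rule borel_measurable_scaleR)
  show "(\<lambda>s::real. s ^ (n - 1)) \<in> borel_measurable (lebesgue_on {0..1})"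
    by (intro continuous_imp_measurable_on_sets_lebesgue continuous_intros) auto
  show "(\<lambda>s. F (t * s\<^sup>2)) \<in> borel_measurable (lebesgue_on {0..1})"
    using mult_square_mem[OF t] t
    by (intro pwc_measurable[OF assms] continuous_intros) (auto, fastforce)
qed

lemma ravg_integrand_bound:
  assumes "\<And>r. r \<in> {0..t} \<Longrightarrow> norm (F r) \<le> C" and "s \<in> {0..1}"
  shows "norm (s ^ (n - 1) *\<^sub>R F (t * s\<^sup>2)) \<le> C"
proof -
  have "s ^ (n - 1) * norm (F (t * s\<^sup>2)) \<le> 1 * C"
    using assms mult_square_mem[OF t] power_le_one[of s "n - 1"]
    by (intro mult_mono) auto
  then show ?thesis using assms(2) by simp
qed

lemma ravg_integrable:
  fixes F :: "real \<Rightarrow> 'b::euclidean_space"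
  assumes "pwc t0 T F"
  shows "integrable (lebesgue_on {0..1}) (\<lambda>s. s ^ (n - 1) *\<^sub>R F (t * s\<^sup>2))"
proof -
  obtain C where "\<And>t. t \<in> {0..T} \<Longrightarrow> norm (F t) \<le> C" using pwc_bounded[OF assms] by metis
  then have "norm (s ^ (n - 1) *\<^sub>R F (t * s\<^sup>2)) \<le> C" if "s \<in> {0..1}" for s
    using ravg_integrand_bound[of F C s] t that by auto
  then show ?thesis
    by (intro finite_measure.integrable_const_bound[OF finite_measure_unit_interval, of _ C]
        ravg_integrand_measurable assms) auto
qed

lemma ravg_bound:
  fixes F :: "real \<Rightarrow> 'b::euclidean_space"
  assumes "pwc t0 T F" and "\<And>r. r \<in> {0..t} \<Longrightarrow> norm (F r) \<le> C"
  shows "norm (ravg n F t) \<le> C"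
proof -
  have "norm (ravg n F t) \<le> (LINT s|lebesgue_on {0..1}. norm (s ^ (n - 1) *\<^sub>R F (t * s\<^sup>2)))"
    unfolding ravg_def by (rule integral_norm_bound)
  also have "\<dots> \<le> (LINT s|lebesgue_on {0..1::real}. C)"
    using ravg_integrand_bound[of F C] assms(2)
    by (intro integral_mono integrable_norm ravg_integrable assms(1)
        finite_measure.integrable_const[OF finite_measure_unit_interval]) auto
  also have "\<dots> = C"
    by (simp only: lebesgue_integral_const measure_unit_interval) simp
  finally show ?thesis .
qed

lemma ravg_add:
  fixes F :: "real \<Rightarrow> 'b::euclidean_space"
  assumes "pwc t0 T F" "pwc t0 T G"
  shows "ravg n (\<lambda>t. F t + G t) t = ravg n F t + ravg n G t"
  unfolding ravg_def scaleR_add_right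
  by (rule Bochner_Integration.integral_add) (intro ravg_integrable assms)+

lemma ravg_diff:
  fixes F :: "real \<Rightarrow> 'b::euclidean_space"
  assumes "pwc t0 T F" "pwc t0 T G"
  shows "ravg n (\<lambda>t. F t - G t) t = ravg n F t - ravg n G t"
  unfolding ravg_def scaleR_diff_right
  by (rule Bochner_Integration.integral_diff) (intro ravg_integrable assms)+

lemma ravg_mono:
  fixes F G :: "real \<Rightarrow> real"
  assumes "pwc t0 T F" "pwc t0 T G" "\<And>r. r \<in> {0..t} \<Longrightarrow> F r \<le> G r"
  shows "ravg n F t \<le> ravg n G t"
  unfolding ravg_def
  using assms(3) mult_square_mem[OF t]
  by (intro integral_mono ravg_integrable assms(1,2)) (auto intro!: mult_left_mono)

lemma ravg_cong:
  assumes "\<And>r. r \<in> {0..t} \<Longrightarrow> F r = G r"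
  shows "ravg n F t = ravg n G t"
  unfolding ravg_def using assms mult_square_mem[OF t] by (intro Bochner_Integration.integral_cong) auto

lemma tendsto_ravg:
  fixes F :: "nat \<Rightarrow> real \<Rightarrow> 'b::euclidean_space"
  assumes "\<And>k. pwc t0 T (F k)" "pwc t0 T G" "\<And>k r. r \<in> {0..T} \<Longrightarrow> norm (F k r) \<le> C"
    and lim: "\<And>r. r \<in> {0..T} \<Longrightarrow> (\<lambda>k. F k r) \<longlonglongrightarrow> G r"
  shows "(\<lambda>k. ravg n (F k) t) \<longlonglongrightarrow> ravg n G t"
  unfolding ravg_def
proof (rule integral_dominated_convergence)
  show "integrable (lebesgue_on {0..1}) (\<lambda>s::real. C)"
    by (rule finite_measure.integrable_const[OF finite_measure_unit_interval])
  have "t * s\<^sup>2 \<in> {0..T}" if "s \<in> {0..1}" for s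
    using mult_square_mem[OF t that] t by auto
  then show "AE s in lebesgue_on {0..1}. (\<lambda>k. s ^ (n - 1) *\<^sub>R F k (t * s\<^sup>2)) \<longlonglongrightarrow> s ^ (n - 1) *\<^sub>R G (t * s\<^sup>2)"
    by (intro AE_I2 tendsto_intros lim) auto
  show "AE s in lebesgue_on {0..1}. norm (s ^ (n - 1) *\<^sub>R F k (t * s\<^sup>2)) \<le> C" for k
    using t by (intro AE_I2 ravg_integrand_bound assms(3)) auto
qed (intro ravg_integrand_measurable assms)+

end

lemma ravg_scaleR:
  fixes F :: "real \<Rightarrow> 'b::euclidean_space"
  shows "ravg n (\<lambda>t. c *\<^sub>R F t) t = c *\<^sub>R ravg n F t"
  unfolding ravg_def integral_scaleR_right[symmetric] by (simp add: mult.commute)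

text \<open>Averaging removes the jump: for given \<open>a\<close> there is at most one
  \<open>s\<close> with a * s^2 = t0, and at every other \<open>s\<close> the integrand converges,
  so dominated convergence applies.\<close>

lemma continuous_on_ravg:
  fixes F :: "real \<Rightarrow> 'b::euclidean_space"
  assumes "pwc t0 T F" "0 < t0"
  shows "continuous_on {0..T} (ravg n F)"
proof (rule continuous_on_sequentiallyI)
  fix u :: "nat \<Rightarrow> real" and a
  assume u: "\<forall>k. u k \<in> {0..T}" and a: "a \<in> {0..T}" and lim: "u \<longlonglongrightarrow> a"
  obtain A B where AB:
    "continuous_on {0..T} A" "continuous_on {0..T} B"
    "\<And>t. t\<in>{0..T} \<Longrightarrow> F t = A t + (if t < t0 then B t else 0)"
    using assms unfolding pwc_def by metis
  obtain C where C: "\<And>t. t \<in> {0..T} \<Longrightarrow> norm (F t) \<le> C" using pwc_bounded[OF assms(1)] by metis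
  \<comment> \<open>For a = 0 the division yields \<open>Z = {0}\<close>, which does no harm because
    then a * s^2 = 0 < t0 for all \<open>s\<close>.\<close>
  define Z where "Z = {sqrt (t0 / a)}"
  have conv: "(\<lambda>k. F (u k * s\<^sup>2)) \<longlonglongrightarrow> F (a * s\<^sup>2)" if s: "s \<in> {0..1}" "s \<notin> Z" for s
  proof -
    have ne: "a * s\<^sup>2 \<noteq> t0"
    proof
      assume eq: "a * s\<^sup>2 = t0"
      then have "a \<noteq> 0" using assms(2) by auto
      then have "s\<^sup>2 = t0 / a" using eq by (simp add: field_simps)
      then have "s = sqrt (t0 / a)" using s(1) by (metis atLeastAtMost_iff real_sqrt_abs abs_of_nonneg)
      then show False using s(2) by (simp add: Z_def)
    qed
    have in_T: "u k * s\<^sup>2 \<in> {0..T}" "a * s\<^sup>2 \<in> {0..T}" for k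
      using mult_square_mem[OF u[rule_format] s(1), of k] u[rule_format, of k] mult_square_mem[OF a s(1)] a by auto
    have l: "(\<lambda>k. u k * s\<^sup>2) \<longlonglongrightarrow> a * s\<^sup>2" by (intro tendsto_intros lim)
    have lA: "(\<lambda>k. A (u k * s\<^sup>2)) \<longlonglongrightarrow> A (a * s\<^sup>2)"
      using AB(1) l in_T unfolding continuous_on_sequentially by (auto simp: o_def)
    have lB: "(\<lambda>k. B (u k * s\<^sup>2)) \<longlonglongrightarrow> B (a * s\<^sup>2)"
      using AB(2) l in_T unfolding continuous_on_sequentially by (auto simp: o_def)
    have "(\<lambda>k. if u k * s\<^sup>2 < t0 then B (u k * s\<^sup>2) else 0) \<longlonglongrightarrow> (if a * s\<^sup>2 < t0 then B (a * s\<^sup>2) else 0)"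
    proof (cases "a * s\<^sup>2 < t0")
      case True
      then have "\<forall>\<^sub>F k in sequentially. u k * s\<^sup>2 < t0" using l by (simp add: order_tendsto_iff)
      then have "\<forall>\<^sub>F k in sequentially. B (u k * s\<^sup>2) = (if u k * s\<^sup>2 < t0 then B (u k * s\<^sup>2) else 0)"
        by eventually_elim auto
      then show ?thesis using Lim_transform_eventually[OF lB] True by simp
    next
      case False
      then have "t0 < a * s\<^sup>2" using ne by simp
      then have "\<forall>\<^sub>F k in sequentially. t0 < u k * s\<^sup>2" using l by (simp add: order_tendsto_iff)
      then have "\<forall>\<^sub>F k in sequentially. (if u k * s\<^sup>2 < t0 then B (u k * s\<^sup>2) else 0) = 0"
        by eventually_elim auto
      then show ?thesis using False by (simp add: tendsto_eventually)
    qed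
    then show ?thesis
      using tendsto_add[OF lA] AB(3)[OF in_T(1)] AB(3)[OF in_T(2)] by simp
  qed
  show "(\<lambda>k. ravg n F (u k)) \<longlonglongrightarrow> ravg n F a"
    unfolding ravg_def
  proof (rule integral_dominated_convergence)
    show "integrable (lebesgue_on {0..1}) (\<lambda>s::real. C)"
      by (rule finite_measure.integrable_const[OF finite_measure_unit_interval])
    have "AE s in lebesgue_on {0..1}. s \<notin> Z"
      unfolding Z_def by (intro AE_I'[of "{sqrt (t0/a)} \<inter> {0..1}"]) (auto simp: null_sets_restrict_space
          intro: null_sets_subset[OF null_sets_completionI[OF finite_imp_null_set_lborel[of "{sqrt (t0/a)}"]]])
    then show "AE s in lebesgue_on {0..1}. (\<lambda>k. s ^ (n - 1) *\<^sub>R F (u k * s\<^sup>2)) \<longlonglongrightarrow> s ^ (n - 1) *\<^sub>R F (a * s\<^sup>2)"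
    proof (rule AE_mp, intro AE_I2 impI)
      show "(\<lambda>k. s ^ (n - 1) *\<^sub>R F (u k * s\<^sup>2)) \<longlonglongrightarrow> s ^ (n - 1) *\<^sub>R F (a * s\<^sup>2)"
        if "s \<in> space (lebesgue_on {0..1})" "s \<notin> Z" for s
        using that by (intro tendsto_intros conv) auto
    qed
    show "AE s in lebesgue_on {0..1}. norm (s ^ (n - 1) *\<^sub>R F (u k * s\<^sup>2)) \<le> C" for k
      using u[rule_format, of k] by (intro AE_I2 ravg_integrand_bound[OF u[rule_format]] C) auto
  qed (rule ravg_integrand_measurable[OF _ assms(1)], use u a in simp)+
qed

lemma rint_has_derivative:
  fixes F :: "real \<Rightarrow> 'b::euclidean_space"
  assumes "pwc t0 T F" "0 < t0" "t \<in> {0..T}"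
  shows "(rint n F has_vector_derivative (1/2) *\<^sub>R ravg n F t) (at t within {0..T})"
  unfolding rint_def
  by (intro bounded_linear.has_vector_derivative[OF bounded_linear_scaleR_right]
      integral_has_vector_derivative continuous_on_ravg[OF assms(1,2)] assms(3))

text \<open>The averaged function is the Laplacian of x -> p(|x|^2) in dimension \<open>n\<close>.
  Evaluated at t * s^2 and weighted by s^(n-1) it is the derivative of 2 s^n p'(t s^2) in
  \<open>s\<close>, so the fundamental theorem evaluates the average.\<close>

lemma ravg_laplacian:
  assumes "\<And>t. (p' has_real_derivative p'' t) (at t)" "continuous_on UNIV p''" "1 \<le> n"
  shows "ravg n (\<lambda>t. 4 * t * p'' t + 2 * real n * p' t) t = 2 * p' t"
proof -
  let ?h = "\<lambda>s. s ^ (n - 1) * (4 * (t * s\<^sup>2) * p'' (t * s\<^sup>2) + 2 * real n * p' (t * s\<^sup>2))"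
  have c: "continuous_on UNIV p'"
    using assms(1) DERIV_continuous_on by (metis has_field_derivative_at_within)
  have "((\<lambda>s. 2 * s ^ n * p' (t * s\<^sup>2)) has_real_derivative ?h s) (at s)" for s
  proof -
    have "((\<lambda>s. 2 * s ^ n * p' (t * s\<^sup>2)) has_real_derivative
        2 * (real n * s ^ (n - 1)) * p' (t * s\<^sup>2) + 2 * s ^ n * (p'' (t * s\<^sup>2) * (t * (2 * s)))) (at s)"
      by (auto intro!: derivative_eq_intros DERIV_chain2[OF assms(1)])
    moreover have "s ^ n = s * s ^ (n - 1)" using assms(3) by (simp add: power_eq_if)
    ultimately show ?thesis
      by (elim DERIV_cong) (simp add: algebra_simps power2_eq_square)
  qed
  then have "(?h has_integral (2 * 1 ^ n * p' (t * 1\<^sup>2) - 2 * 0 ^ n * p' (t * 0\<^sup>2))) {0..1}"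
    by (intro fundamental_theorem_of_calculus)
      (auto simp: has_real_derivative_iff_has_vector_derivative[symmetric] intro: has_field_derivative_at_within)
  then have "integral {0..1} ?h = 2 * p' t"
    using assms(3) by (simp add: integral_unique power_0_left)
  moreover have "integrable (lebesgue_on {0..1}) ?h"
    by (intro continuous_imp_integrable_real continuous_intros continuous_on_compose2[OF c]
        continuous_on_compose2[OF assms(2)]) auto
  ultimately show ?thesis
    unfolding ravg_def using lebesgue_integral_eq_integral[of "{0..1}" ?h] by simp
qed

text \<open>Brings explicit profiles, later the exponential barrier and the annular bump, into the
  integral form in which all equations are stated.\<close>

lemma rint_laplacian:
  assumes "\<And>t. (p has_real_derivative p' t) (at t)"
    and "\<And>t. (p' has_real_derivative p'' t) (at t)" "continuous_on UNIV p''" "1 \<le> n" "0 \<le> t"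
  shows "p t = p 0 + rint n (\<lambda>t. 4 * t * p'' t + 2 * real n * p' t) t"
proof -
  have "ravg n (\<lambda>t. 4 * t * p'' t + 2 * real n * p' t) = (\<lambda>t. 2 * p' t)"
    using ravg_laplacian[OF assms(2-4)] by blast
  moreover have "(p' has_integral (p t - p 0)) {0..t}"
    using assms(1,5) by (intro fundamental_theorem_of_calculus)
      (auto simp: has_real_derivative_iff_has_vector_derivative[symmetric] intro: has_field_derivative_at_within)
  ultimately show ?thesis
    by (simp add: rint_def integral_unique field_simps)
qed


section \<open>The weak divergence identity for radial vector fields\<close>

lemma inner_self_mem_ball:
  fixes x :: "'a::euclidean_space"
  assumes "x \<in> ball 0 R"
  shows "x \<bullet> x \<in> {0..R\<^sup>2}"
  using assms power_mono[of "norm x" R 2] by (simp add: power2_norm_eq_inner)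

lemma inner_self_less:
  fixes x :: "'a::euclidean_space"
  assumes "0 < R"
  shows "x \<bullet> x < R\<^sup>2 \<longleftrightarrow> x \<in> ball 0 R"
  using assms by (simp add: norm_lt_square)

context
  fixes R :: real and \<phi> :: "'a::euclidean_space \<Rightarrow> real"
  assumes R: "0 < R" and \<phi>: "\<phi> \<in> test_functions (ball 0 R)"
begin

text \<open>A vanishing integral for all \<open>\<phi>\<close> says that the radial field with value
  \<open>ravg DIM('a) F (x \<bullet> x)\<close> times \<open>x\<close> has weak divergence
  \<open>F (x \<bullet> x)\<close>.\<close>

definition div_defect :: "(real \<Rightarrow> real) \<Rightarrow> 'a \<Rightarrow> real" where
  "div_defect F x = ravg DIM('a) F (x \<bullet> x) * (x \<bullet> classical_grad \<phi> x) + F (x \<bullet> x) * \<phi> x"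

lemma div_defect_measurable:
  assumes "pwc t0 (R\<^sup>2) F" "0 < t0"
  shows "div_defect F \<in> borel_measurable (lebesgue_on (ball 0 R))"
proof -
  let ?M = "lebesgue_on (ball (0::'a) R)"
  have sub: "(\<lambda>x::'a. x \<bullet> x) ` ball 0 R \<subseteq> {0..R\<^sup>2}"
    using inner_self_mem_ball by blast
  have c: "continuous_on UNIV (\<lambda>x::'a. x \<bullet> x)" by (intro continuous_intros)
  have "(\<lambda>x. F (x \<bullet> x)) \<in> borel_measurable ?M"
    by (rule pwc_measurable[OF assms(1) c _ sub]) auto
  moreover have "(\<lambda>x. ravg DIM('a) F (x \<bullet> x)) \<in> borel_measurable ?M"
    by (rule pwc_measurable[OF pwc_continuous[OF continuous_on_ravg[OF assms]] c _ sub]) auto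
  moreover have "(\<lambda>x. x \<bullet> classical_grad \<phi> x) \<in> borel_measurable ?M"
    by (intro borel_measurable_lebesgue_onI borel_measurable_continuous_onI continuous_intros
        test_functionsD(4)[OF \<phi>])
  ultimately show ?thesis
    unfolding div_defect_def using test_function_measurable(1)[OF \<phi>] by measurable
qed

text \<open>\<open>C'\<close> depends on \<open>R\<close> and \<open>\<phi>\<close> only, not on
  \<open>F\<close>; so one constant dominates a whole sequence of right-hand sides.\<close>

lemma div_defect_bound:
  obtains C' where "0 \<le> C'"
    "\<And>t0 (F :: real \<Rightarrow> real) C x. pwc t0 (R\<^sup>2) F \<Longrightarrow> (\<And>t. t \<in> {0..R\<^sup>2} \<Longrightarrow> norm (F t) \<le> C) \<Longrightarrow> x \<in> ball 0 R \<Longrightarrow>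
      norm (div_defect F x) \<le> C * C'"
proof -
  obtain B where B: "0 \<le> B" "\<And>x. \<bar>\<phi> x\<bar> \<le> B" "\<And>x. norm (classical_grad \<phi> x) \<le> B"
    using test_function_bounded[OF \<phi>] by metis
  show thesis
  proof (rule that)
    show "0 \<le> R * B + B" using R B by simp
    fix t0 C and F :: "real \<Rightarrow> real" and x :: 'a
    assume F: "pwc t0 (R\<^sup>2) F" and C: "\<And>t. t \<in> {0..R\<^sup>2} \<Longrightarrow> norm (F t) \<le> C" and x: "x \<in> ball 0 R"
    have "norm (F 0) \<le> C" using C[of 0] by simp
    then have "0 \<le> C" using norm_ge_zero order_trans by blast
    have xx: "x \<bullet> x \<in> {0..R\<^sup>2}" using inner_self_mem_ball[OF x] .
    then have 1: "\<bar>ravg DIM('a) F (x \<bullet> x)\<bar> \<le> C"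
      using ravg_bound[OF xx F, where C = C and n = "DIM('a)"] C by simp
    have 2: "\<bar>x \<bullet> classical_grad \<phi> x\<bar> \<le> R * B"
      using Cauchy_Schwarz_ineq2[of x "classical_grad \<phi> x"] x B mult_mono[of "norm x" R "norm (classical_grad \<phi> x)" B] R
      by (smt (verit) mem_ball_0 norm_ge_zero)
    have 3: "\<bar>F (x \<bullet> x)\<bar> \<le> C" using C[OF xx] by simp
    have "\<bar>div_defect F x\<bar> \<le> \<bar>ravg DIM('a) F (x \<bullet> x)\<bar> * \<bar>x \<bullet> classical_grad \<phi> x\<bar> + \<bar>F (x \<bullet> x)\<bar> * \<bar>\<phi> x\<bar>"
      unfolding div_defect_def using abs_triangle_ineq by (metis abs_mult)
    also have "\<dots> \<le> C * (R * B) + C * B"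
      using 1 2 3 B(2) \<open>0 \<le> C\<close> by (intro add_mono mult_mono) auto
    finally show "norm (div_defect F x) \<le> C * (R * B + B)" by (simp add: algebra_simps)
  qed
qed

lemma div_defect_integrable:
  assumes "pwc t0 (R\<^sup>2) F" "0 < t0"
  shows "integrable (lebesgue_on (ball 0 R)) (div_defect F)"
proof -
  obtain C where C: "\<And>t. t \<in> {0..R\<^sup>2} \<Longrightarrow> norm (F t) \<le> C" using pwc_bounded[OF assms(1)] by metis
  obtain C' where "\<And>x. x \<in> ball 0 R \<Longrightarrow> norm (div_defect F x) \<le> C * C'"
    using div_defect_bound assms(1) C by metis
  then show ?thesis
    by (intro integrable_lebesgue_on_bounded[OF open_ball bounded_ball div_defect_measurable[OF assms]])
qed

text \<open>The identity is stable under bounded pointwise limits. This carries it from polynomials,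
  where the field is smooth, to continuous functions and then to functions with a jump, without ever
  differentiating a nonsmooth field.\<close>

lemma div_defect_limit:
  assumes F: "\<And>k. pwc t0 (R\<^sup>2) (F k)" "pwc t0 (R\<^sup>2) G" "0 < t0"
    and bd: "\<And>k r. r \<in> {0..R\<^sup>2} \<Longrightarrow> norm (F k r) \<le> C"
    and lim: "\<And>r. r \<in> {0..R\<^sup>2} \<Longrightarrow> (\<lambda>k. F k r) \<longlonglongrightarrow> G r"
    and zero: "\<And>k. (LINT x|lebesgue_on (ball 0 R). div_defect (F k) x) = 0"
  shows "(LINT x|lebesgue_on (ball 0 R). div_defect G x) = 0"
proof -
  obtain C' where C': "\<And>k x. x \<in> ball 0 R \<Longrightarrow> norm (div_defect (F k) x) \<le> C * C'"
    using div_defect_bound F(1) bd by metis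
  have "(\<lambda>k. LINT x|lebesgue_on (ball 0 R). div_defect (F k) x) \<longlonglongrightarrow> (LINT x|lebesgue_on (ball 0 R). div_defect G x)"
  proof (rule bounded_convergence[OF open_ball bounded_ball div_defect_measurable[OF F(1,3)] C'])
    fix x :: 'a assume "x \<in> ball 0 R"
    then have xx: "x \<bullet> x \<in> {0..R\<^sup>2}" by (rule inner_self_mem_ball)
    show "(\<lambda>k. div_defect (F k) x) \<longlonglongrightarrow> div_defect G x"
      unfolding div_defect_def
      by (intro tendsto_intros tendsto_ravg[OF xx F(1) F(2) bd lim] lim[OF xx])
  qed
  then show ?thesis by (simp add: zero LIMSEQ_const_iff)
qed

text \<open>For F = t^m the field is the polynomial field |x|^(2m) x / c, smooth also at the origin,
  and each component can be integrated by parts classically.\<close>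

lemma div_defect_monomial:
  "(LINT x|lebesgue_on (ball 0 R). div_defect (\<lambda>t. t ^ m) x) = 0"
proof -
  \<comment> \<open>The divergence of |x|^(2m) x is (DIM + 2 m) |x|^(2m); \<open>c\<close>
    normalises it.\<close>
  define c where "c = real DIM('a) + 2 * real m"
  have c0: "c > 0" using DIM_positive[where 'a='a] by (simp add: c_def add_pos_nonneg)
  have r: "ravg DIM('a) (\<lambda>t. t ^ m) t = t ^ m / c" for t
  proof -
    \<comment> \<open>Prepares \<open>ravg_laplacian\<close> with p' t = t^m / (2 c): the radial
      Laplacian of that profile is exactly t^m.\<close>
    have "(\<lambda>t. 4 * t * (real m * t ^ (m - 1) / (2 * c)) + 2 * real DIM('a) * (t ^ m / (2 * c))) = (\<lambda>t. t ^ m)"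
    proof
      fix t :: real
      \<comment> \<open>For m = 0 the subtraction in the exponent is truncated, but the factor
        \<open>m\<close> removes the term.\<close>
      have "t * (real m * t ^ (m - 1)) = real m * t ^ m" by (cases m) auto
      then have "4 * t * (real m * t ^ (m - 1) / (2 * c)) + 2 * real DIM('a) * (t ^ m / (2 * c)) =
        (4 * (real m * t ^ m) + 2 * real DIM('a) * t ^ m) / (2 * c)"
        by (simp add: add_divide_distrib mult.assoc)
      also have "\<dots> = t ^ m" using c0 by (simp add: c_def field_simps)
      finally show "4 * t * (real m * t ^ (m - 1) / (2 * c)) + 2 * real DIM('a) * (t ^ m / (2 * c)) = t ^ m" .
    qed
    moreover have "ravg DIM('a) (\<lambda>t. 4 * t * (real m * t ^ (m - 1) / (2 * c)) + 2 * real DIM('a) * (t ^ m / (2 * c))) t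
        = 2 * (t ^ m / (2 * c))"
      by (rule ravg_laplacian) (use c0 DIM_positive[where 'a='a] in
          \<open>auto intro!: derivative_eq_intros continuous_intros simp: Suc_leI\<close>)
    ultimately show ?thesis by simp
  qed
  define g where "g i x = (x \<bullet> x) ^ m * (x \<bullet> i) / c" for i x :: 'a
  define g' where "g' i x v = ((x \<bullet> x) ^ m * (v \<bullet> i) + (real m * (2 * (v \<bullet> x)) * (x \<bullet> x) ^ (m - 1)) * (x \<bullet> i)) / c" for i x v :: 'a
  have D: "(g i has_derivative g' i x) (at x)" for i x
    unfolding g_def g'_def
    by (auto intro!: derivative_eq_intros simp: fun_eq_iff inner_commute algebra_simps divide_inverse)
  have cont: "continuous_on UNIV (\<lambda>x. g' i x i)" for i
    unfolding g'_def using c0 by (intro continuous_intros) auto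
  let ?I = "\<lambda>i x. g i x * (classical_grad \<phi> x \<bullet> i) + g' i x i * \<phi> x"
  have eq: "div_defect (\<lambda>t. t ^ m) x = (\<Sum>i\<in>Basis. ?I i x)" for x
  proof -
    have 1: "(\<Sum>i\<in>Basis. g i x * (classical_grad \<phi> x \<bullet> i)) = (x \<bullet> x) ^ m / c * (x \<bullet> classical_grad \<phi> x)"
      unfolding g_def by (subst (2) euclidean_inner) (simp add: sum_distrib_left mult.assoc)
    have pow: "real m * ((x \<bullet> x) ^ (m - 1) * (x \<bullet> x)) = real m * (x \<bullet> x) ^ m" by (cases m) auto
    have "(\<Sum>i\<in>Basis. g' i x i) = (\<Sum>i\<in>Basis. ((x \<bullet> x) ^ m + 2 * (real m * ((x \<bullet> x) ^ (m - 1) * ((x \<bullet> i) * (x \<bullet> i))))) / c)"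
      unfolding g'_def by (intro sum.cong) (auto simp: inner_commute algebra_simps)
    also have "\<dots> = (real DIM('a) * (x \<bullet> x) ^ m + 2 * (real m * ((x \<bullet> x) ^ (m - 1) * (x \<bullet> x)))) / c"
      unfolding sum_divide_distrib[symmetric] sum.distrib sum_distrib_left[symmetric]
      by (subst (6) euclidean_inner) simp
    also have "\<dots> = (x \<bullet> x) ^ m"
      unfolding pow using c0 by (simp add: c_def field_simps)
    finally have "(\<Sum>i\<in>Basis. g' i x i) = (x \<bullet> x) ^ m" .
    then have 2: "(\<Sum>i\<in>Basis. g' i x i * \<phi> x) = (x \<bullet> x) ^ m * \<phi> x"
      by (simp add: sum_distrib_right[symmetric])
    show ?thesis
      unfolding div_defect_def r sum.distrib 1 2 by simp
  qed
  have int: "integrable (lebesgue_on (ball 0 R)) (?I i)" if "i \<in> Basis" for i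
  proof -
    have c: "continuous_on UNIV (?I i)"
    proof (intro continuous_on_add continuous_on_mult cont test_functionsD[OF \<phi>] continuous_on_inner continuous_on_const)
      show "continuous_on UNIV (g i)"
        by (meson D continuous_at_imp_continuous_on has_derivative_continuous)
    qed
    have "bounded (?I i ` cball 0 R)"
      by (intro compact_imp_bounded compact_continuous_image continuous_on_subset[OF c]) auto
    then obtain B where B: "\<And>x. x \<in> cball 0 R \<Longrightarrow> norm (?I i x) \<le> B"
      unfolding bounded_iff by blast
    show ?thesis
      by (rule integrable_lebesgue_on_bounded[OF open_ball bounded_ball, where C = B])
        (use B c in \<open>auto intro!: borel_measurable_lebesgue_onI borel_measurable_continuous_onI\<close>)
  qed
  have "(LINT x|lebesgue_on (ball 0 R). div_defect (\<lambda>t. t ^ m) x) =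
      (\<Sum>i\<in>Basis. LINT x|lebesgue_on (ball 0 R). ?I i x)"
    unfolding eq using int by (rule Bochner_Integration.integral_sum)
  also have "\<dots> = 0"
    by (intro sum.neutral ballI integral_by_parts_test[OF open_ball \<phi> D cont])
  finally show ?thesis .
qed

lemma div_defect_sum:
  assumes "finite I" "\<And>i. i \<in> I \<Longrightarrow> pwc t0 (R\<^sup>2) (F i)" "0 < t0"
    and "\<And>i. i \<in> I \<Longrightarrow> (LINT x|lebesgue_on (ball 0 R). div_defect (F i) x) = 0"
  shows "(LINT x|lebesgue_on (ball 0 R). div_defect (\<lambda>t. \<Sum>i\<in>I. F i t) x) = 0 \<and> pwc t0 (R\<^sup>2) (\<lambda>t. \<Sum>i\<in>I. F i t)"
  using assms(1,2,4)
proof (induction I rule: finite_induct)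
  case empty
  then show ?case by (simp add: div_defect_def ravg_def pwc_continuous)
next
  case (insert i I)
  let ?S = "\<lambda>t. \<Sum>i\<in>I. F i t"
  have IH: "(LINT x|lebesgue_on (ball 0 R). div_defect ?S x) = 0" "pwc t0 (R\<^sup>2) ?S"
    using insert by auto
  have Fi: "pwc t0 (R\<^sup>2) (F i)" using insert by auto
  have "(LINT x|lebesgue_on (ball 0 R). div_defect (\<lambda>t. F i t + ?S t) x) =
      (LINT x|lebesgue_on (ball 0 R). div_defect (F i) x + div_defect ?S x)"
  proof (rule Bochner_Integration.integral_cong[OF refl])
    fix x :: 'a assume "x \<in> space (lebesgue_on (ball 0 R))"
    then have xx: "x \<bullet> x \<in> {0..R\<^sup>2}" by (intro inner_self_mem_ball) simp
    show "div_defect (\<lambda>t. F i t + ?S t) x = div_defect (F i) x + div_defect ?S x"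
      unfolding div_defect_def ravg_add[OF xx Fi IH(2)] by (simp add: algebra_simps)
  qed
  also have "\<dots> = 0"
    using div_defect_integrable[OF Fi assms(3)] div_defect_integrable[OF IH(2) assms(3)] IH(1) insert.prems
    by simp
  finally show ?case using insert.hyps pwc_add[OF Fi IH(2)] by simp
qed

lemma div_defect_scale:
  "(LINT x|lebesgue_on (ball 0 R). div_defect F x) = 0 \<Longrightarrow>
   (LINT x|lebesgue_on (ball 0 R). div_defect (\<lambda>t. c * F t) x) = 0"
proof -
  assume "(LINT x|lebesgue_on (ball 0 R). div_defect F x) = 0"
  moreover have "div_defect (\<lambda>t. c * F t) = (\<lambda>x. c * div_defect F x)"
    unfolding div_defect_def using ravg_scaleR[of "DIM('a)" c F] by (simp add: fun_eq_iff algebra_simps)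
  ultimately show ?thesis by simp
qed

lemma div_defect_continuous:
  assumes "continuous_on {0..R\<^sup>2} F"
  shows "(LINT x|lebesgue_on (ball 0 R). div_defect F x) = 0"
proof -
  have "\<exists>g. real_polynomial_function g \<and> (\<forall>x\<in>{0..R\<^sup>2}. \<bar>F x - g x\<bar> < 1 / real (Suc k))" for k
    using Stone_Weierstrass_real_polynomial_function[OF compact_Icc assms, of "1 / real (Suc k)"]
    by (metis of_nat_0_less_iff zero_less_Suc zero_less_divide_1_iff)
  then obtain g where g: "\<And>k. real_polynomial_function (g k)"
    "\<And>k x. x \<in> {0..R\<^sup>2} \<Longrightarrow> \<bar>F x - g k x\<bar> < 1 / real (Suc k)"
    by metis
  have pg: "pwc 1 (R\<^sup>2) (g k)" for k
    by (intro pwc_continuous continuous_on_polymonial_function) (use g(1) in \<open>simp add: real_polynomial_function_eq\<close>)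
  have zero: "(LINT x|lebesgue_on (ball 0 R). div_defect (g k) x) = 0" for k
  proof -
    obtain a m where gk: "g k = (\<lambda>x. \<Sum>i\<le>m. a i * x ^ i)"
      using g(1)[of k] unfolding real_polynomial_function_iff_sum by blast
    show ?thesis
      unfolding gk
      by (rule div_defect_sum[of _ 1, THEN conjunct1])
        (auto intro!: div_defect_scale div_defect_monomial pwc_continuous continuous_intros)
  qed
  obtain C where C: "\<And>t. t \<in> {0..R\<^sup>2} \<Longrightarrow> norm (F t) \<le> C"
    using pwc_bounded[OF pwc_continuous[OF assms]] by metis
  show ?thesis
  proof (rule div_defect_limit[OF pg pwc_continuous[OF assms] _ _ _ zero])
    show "norm (g k r) \<le> C + 1" if "r \<in> {0..R\<^sup>2}" for k r
    proof -
      have "1 / real (Suc k) \<le> 1" by simp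
      then show ?thesis using g(2)[OF that, of k] C[OF that] unfolding real_norm_def by linarith
    qed
    show "(\<lambda>k. g k r) \<longlonglongrightarrow> F r" if "r \<in> {0..R\<^sup>2}" for r
    proof -
      have "(\<lambda>k. F r - g k r) \<longlonglongrightarrow> 0"
        by (rule Lim_null_comparison[OF _ LIMSEQ_inverse_real_of_nat])
          (use g(2)[OF that] in \<open>auto simp: inverse_eq_divide intro!: always_eventually less_imp_le\<close>)
      then show ?thesis using tendsto_diff[OF tendsto_const[of "F r"]] by fastforce
    qed
  qed auto
qed

lemma div_defect_pwc:
  assumes F: "pwc t0 (R\<^sup>2) F" and t0: "0 < t0"
  shows "(LINT x|lebesgue_on (ball 0 R). div_defect F x) = 0"
proof -
  obtain A B where AB: "continuous_on {0..R\<^sup>2} A" "continuous_on {0..R\<^sup>2} B"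
    "\<And>t. t\<in>{0..R\<^sup>2} \<Longrightarrow> F t = A t + (if t < t0 then B t else 0)"
    using F unfolding pwc_def by metis
  \<comment> \<open>The jump is replaced by a continuous ramp of slope k that ends at
    \<open>t0\<close>; it converges to the indicator of t < t0 at every point, \<open>t0\<close>
    included.\<close>
  define G where "G k t = A t + min 1 (max 0 (real k * (t0 - t))) * B t" for k t
  have G: "continuous_on {0..R\<^sup>2} (G k)" for k
    unfolding G_def using AB by (intro continuous_intros)
  obtain a where a: "\<And>t. t \<in> {0..R\<^sup>2} \<Longrightarrow> norm (A t) \<le> a"
    using pwc_bounded[OF pwc_continuous[OF AB(1)]] by metis
  obtain b where b: "0 \<le> b" "\<And>t. t \<in> {0..R\<^sup>2} \<Longrightarrow> norm (B t) \<le> b"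
    using pwc_bounded[OF pwc_continuous[OF AB(2)]] by metis
  show ?thesis
  proof (rule div_defect_limit[OF pwc_continuous[OF G] F t0 _ _ div_defect_continuous[OF G]])
    show "norm (G k r) \<le> a + 1 * b" if "r \<in> {0..R\<^sup>2}" for k r
    proof -
      have "norm (G k r) \<le> norm (A r) + norm (min 1 (max 0 (real k * (t0 - r)))) * norm (B r)"
        unfolding G_def norm_mult[symmetric] by (rule norm_triangle_ineq)
      also have "\<dots> \<le> a + 1 * b"
        using a[OF that] b[of] b(2)[OF that] by (intro add_mono mult_mono) auto
      finally show ?thesis .
    qed
    show "(\<lambda>k. G k r) \<longlonglongrightarrow> F r" if r: "r \<in> {0..R\<^sup>2}" for r
    proof (cases "r < t0")
      case True
      obtain N :: nat where N: "1 < real N * (t0 - r)" using reals_Archimedean3[of "t0 - r"] True by auto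
      have "G k r = F r" if "k \<ge> N" for k
      proof -
        have "1 < real k * (t0 - r)"
          using N mult_right_mono[of "real N" "real k" "t0 - r"] that True by linarith
        then show ?thesis using AB(3)[OF r] True by (simp add: G_def)
      qed
      then show ?thesis by (intro tendsto_eventually) (auto simp: eventually_sequentially)
    next
      case False
      then have "real k * (t0 - r) \<le> 0" for k by (simp add: mult_nonneg_nonpos)
      then have "G k r = F r" for k using AB(3)[OF r] False by (simp add: G_def max_absorb1)
      then show ?thesis by simp
    qed
  qed
qed

end


subsection \<open>Radial weak solutions\<close>

lemma L2_diff:
  assumes "u \<in> L2 \<Omega>" "v \<in> L2 \<Omega>"
  shows "(\<lambda>x. u x - v x) \<in> L2 \<Omega>"
proof -
  have m: "(\<lambda>x. u x - v x) \<in> borel_measurable (lebesgue_on \<Omega>)"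
    using assms by (auto simp: L2_def)
  have "integrable (lebesgue_on \<Omega>) (\<lambda>x. (norm (u x - v x))\<^sup>2)"
  proof (rule Bochner_Integration.integrable_bound)
    show "integrable (lebesgue_on \<Omega>) (\<lambda>x. 2 * (norm (u x))\<^sup>2 + 2 * (norm (v x))\<^sup>2)"
      using assms by (auto simp: L2_def)
    show "(\<lambda>x. (norm (u x - v x))\<^sup>2) \<in> borel_measurable (lebesgue_on \<Omega>)"
      using m by measurable
    have "(norm (u x - v x))\<^sup>2 \<le> 2 * (norm (u x))\<^sup>2 + 2 * (norm (v x))\<^sup>2" for x
    proof -
      have "(norm (u x - v x))\<^sup>2 \<le> (norm (u x) + norm (v x))\<^sup>2"
        by (intro power_mono norm_triangle_ineq4) auto
      also have "\<dots> \<le> 2 * (norm (u x))\<^sup>2 + 2 * (norm (v x))\<^sup>2"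
        using sum_squares_bound[of "norm (u x)" "norm (v x)"] by (simp add: power2_sum)
      finally show ?thesis .
    qed
    then show "AE x in lebesgue_on \<Omega>. norm ((norm (u x - v x))\<^sup>2) \<le> norm (2 * (norm (u x))\<^sup>2 + 2 * (norm (v x))\<^sup>2)"
      by simp
  qed
  with m show ?thesis by (simp add: L2_def)
qed

lemma integrable_bounded_scaleR:
  fixes g :: "'a::euclidean_space \<Rightarrow> 'b::euclidean_space" and w :: "'a \<Rightarrow> real"
  assumes "integrable (lebesgue_on \<Omega>) g" "w \<in> borel_measurable (lebesgue_on \<Omega>)"
    and "\<And>x. x \<in> \<Omega> \<Longrightarrow> \<bar>w x\<bar> \<le> C"
  shows "integrable (lebesgue_on \<Omega>) (\<lambda>x. w x *\<^sub>R g x)"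
  by (rule Bochner_Integration.integrable_bound[of _ "\<lambda>x. C *\<^sub>R g x"])
    (use assms in \<open>auto intro!: mult_right_mono AE_I2 order_trans[OF _ abs_ge_self]\<close>)

lemma integrable_bounded_inner:
  fixes g G :: "'a::euclidean_space \<Rightarrow> 'b::euclidean_space"
  assumes "integrable (lebesgue_on \<Omega>) g" "G \<in> borel_measurable (lebesgue_on \<Omega>)"
    and "\<And>x. x \<in> \<Omega> \<Longrightarrow> norm (G x) \<le> C"
  shows "integrable (lebesgue_on \<Omega>) (\<lambda>x. G x \<bullet> g x)"
proof (rule Bochner_Integration.integrable_bound[of _ "\<lambda>x. C *\<^sub>R g x"])
  show "AE x in lebesgue_on \<Omega>. norm (G x \<bullet> g x) \<le> norm (C *\<^sub>R g x)"
  proof (intro AE_I2)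
    fix x assume "x \<in> space (lebesgue_on \<Omega>)"
    then have "norm (G x) * norm (g x) \<le> \<bar>C\<bar> * norm (g x)"
      using assms(3)[of x] by (intro mult_right_mono) auto
    then show "norm (G x \<bullet> g x) \<le> norm (C *\<^sub>R g x)"
      using Cauchy_Schwarz_ineq2[of "G x" "g x"] by simp
  qed
  show "(\<lambda>x. G x \<bullet> g x) \<in> borel_measurable (lebesgue_on \<Omega>)"
    using assms(1,2) borel_measurable_integrable by (intro borel_measurable_inner) auto
qed (use assms in auto)

section \<open>Weak gradients and the space H^1_0 on a bounded open set\<close>

context
  fixes \<Omega> :: "'a::euclidean_space set"
  assumes \<Omega>: "open \<Omega>" "bounded \<Omega>"
begin

lemma integrable_test_scaleR:
  fixes u :: "'a \<Rightarrow> 'b::euclidean_space"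
  assumes "\<phi> \<in> test_functions \<Omega>" "u \<in> L2 \<Omega>"
  shows "integrable (lebesgue_on \<Omega>) (\<lambda>x. \<phi> x *\<^sub>R u x)"
proof -
  obtain C where "\<And>x. \<bar>\<phi> x\<bar> \<le> C" using test_function_bounded[OF assms(1)] by metis
  then show ?thesis
    by (intro integrable_bounded_scaleR L2_imp_integrable[OF \<Omega>] assms(2) test_function_measurable[OF assms(1)])
qed

lemma integrable_scaleR_test_grad:
  fixes u :: "'a \<Rightarrow> real"
  assumes "\<phi> \<in> test_functions \<Omega>" "u \<in> L2 \<Omega>"
  shows "integrable (lebesgue_on \<Omega>) (\<lambda>x. u x *\<^sub>R classical_grad \<phi> x)"
proof -
  obtain C where C: "0 \<le> C" "\<And>x. norm (classical_grad \<phi> x) \<le> C" using test_function_bounded[OF assms(1)] by metis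
  show ?thesis
  proof (rule Bochner_Integration.integrable_bound[of _ "\<lambda>x. C * u x"])
    show "integrable (lebesgue_on \<Omega>) (\<lambda>x. C * u x)"
      using L2_imp_integrable[OF \<Omega> assms(2)] by simp
    show "(\<lambda>x. u x *\<^sub>R classical_grad \<phi> x) \<in> borel_measurable (lebesgue_on \<Omega>)"
      using assms(2) test_function_measurable[OF assms(1)] by (auto simp: L2_def)
    have "\<bar>u x\<bar> * norm (classical_grad \<phi> x) \<le> C * \<bar>u x\<bar>" for x
      using mult_left_mono[OF C(2), of "\<bar>u x\<bar>"] by (simp add: mult.commute)
    then show "AE x in lebesgue_on \<Omega>. norm (u x *\<^sub>R classical_grad \<phi> x) \<le> norm (C * u x)"
      using C(1) by (simp add: abs_mult)
  qed
qed

lemma is_weak_grad_diff: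
  assumes "u \<in> L2 \<Omega>" "v \<in> L2 \<Omega>" "g \<in> L2 \<Omega>" "h \<in> L2 \<Omega>" "is_weak_grad \<Omega> u g" "is_weak_grad \<Omega> v h"
  shows "is_weak_grad \<Omega> (\<lambda>x. u x - v x) (\<lambda>x. g x - h x)"
  using assms unfolding is_weak_grad_def
  by (simp add: scaleR_diff_left scaleR_diff_right integrable_test_scaleR integrable_scaleR_test_grad)

text \<open>Access to the chosen gradient: any weak gradient in L^2 that can be exhibited may
  replace \<open>weak_grad\<close> under integrals.\<close>

lemma weak_gradI:
  assumes "g \<in> L2 \<Omega>" "is_weak_grad \<Omega> u g"
  shows "weak_grad \<Omega> u \<in> L2 \<Omega>" "is_weak_grad \<Omega> u (weak_grad \<Omega> u)"
    "AE x in lebesgue_on \<Omega>. weak_grad \<Omega> u x = g x"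
proof -
  have "weak_grad \<Omega> u \<in> L2 \<Omega> \<and> is_weak_grad \<Omega> u (weak_grad \<Omega> u)"
    unfolding weak_grad_def by (rule someI[of _ g]) (use assms in simp)
  then show "weak_grad \<Omega> u \<in> L2 \<Omega>" "is_weak_grad \<Omega> u (weak_grad \<Omega> u)"
    "AE x in lebesgue_on \<Omega>. weak_grad \<Omega> u x = g x"
    using weak_grad_unique[OF \<Omega>] assms by auto
qed

lemma H1_norm_eq:
  assumes "g \<in> L2 \<Omega>" "is_weak_grad \<Omega> u g"
  shows "H1_norm \<Omega> u = sqrt ((LINT x|lebesgue_on \<Omega>. (u x)\<^sup>2) + (LINT x|lebesgue_on \<Omega>. (norm (g x))\<^sup>2))"
proof -
  have m: "g \<in> borel_measurable (lebesgue_on \<Omega>)" "weak_grad \<Omega> u \<in> borel_measurable (lebesgue_on \<Omega>)"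
    using assms(1) weak_gradI(1)[OF assms] by (auto simp: L2_def)
  have "(LINT x|lebesgue_on \<Omega>. (norm (weak_grad \<Omega> u x))\<^sup>2) = (LINT x|lebesgue_on \<Omega>. (norm (g x))\<^sup>2)"
  proof (rule integral_cong_AE)
    show "AE x in lebesgue_on \<Omega>. (norm (weak_grad \<Omega> u x))\<^sup>2 = (norm (g x))\<^sup>2"
      using weak_gradI(3)[OF assms] by eventually_elim simp
  qed (use m in measurable)
  then show ?thesis by (simp add: H1_norm_def)
qed

lemma tendsto_integral_norm_square:
  fixes h :: "nat \<Rightarrow> 'a \<Rightarrow> 'b::euclidean_space"
  assumes m: "\<And>k. h k \<in> borel_measurable (lebesgue_on \<Omega>)" "w \<in> borel_measurable (lebesgue_on \<Omega>)"
    and C: "\<And>k x. x \<in> \<Omega> \<Longrightarrow> norm (h k x) \<le> C" and lim: "\<And>x. x \<in> \<Omega> \<Longrightarrow> (\<lambda>k. h k x) \<longlonglongrightarrow> w x"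
  shows "(\<lambda>k. LINT x|lebesgue_on \<Omega>. (norm (h k x - w x))\<^sup>2) \<longlonglongrightarrow> 0"
proof -
  have "(\<lambda>k. LINT x|lebesgue_on \<Omega>. (norm (h k x - w x))\<^sup>2) \<longlonglongrightarrow> (LINT x|lebesgue_on \<Omega>. 0)"
  proof (rule bounded_convergence[OF \<Omega>])
    show "(\<lambda>x. (norm (h k x - w x))\<^sup>2) \<in> borel_measurable (lebesgue_on \<Omega>)" for k
      using m by measurable
    fix x assume x: "x \<in> \<Omega>"
    have "(\<lambda>k. (norm (h k x - w x))\<^sup>2) \<longlonglongrightarrow> (norm (w x - w x))\<^sup>2"
      by (intro tendsto_intros lim[OF x])
    then show "(\<lambda>k. (norm (h k x - w x))\<^sup>2) \<longlonglongrightarrow> 0" by simp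
    have "norm (w x) \<le> C"
      using tendsto_norm[OF lim[OF x]] C[OF x] by (intro LIMSEQ_le_const2) auto
    then have "norm (h k x - w x) \<le> 2 * C" for k
      using C[OF x, of k] norm_triangle_ineq4[of "h k x" "w x"] by simp
    then have "(norm (h k x - w x))\<^sup>2 \<le> (2 * C)\<^sup>2" for k by (intro power_mono) auto
    then show "norm ((norm (h k x - w x))\<^sup>2) \<le> (2 * C)\<^sup>2" for k by simp
  qed
  then show ?thesis by simp
qed

text \<open>On a bounded set, uniform bounds and pointwise convergence give L^2 convergence of
  functions and gradients by dominated convergence, and the defining identity of the weak gradient
  passes to the limit.\<close>

lemma H10_limit:
  fixes \<phi> :: "nat \<Rightarrow> 'a \<Rightarrow> real"
  assumes \<phi>: "\<And>k. \<phi> k \<in> test_functions \<Omega>"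
    and C: "\<And>k x. x \<in> \<Omega> \<Longrightarrow> \<bar>\<phi> k x\<bar> \<le> C" "\<And>k x. x \<in> \<Omega> \<Longrightarrow> norm (classical_grad (\<phi> k) x) \<le> C"
    and u: "\<And>x. x \<in> \<Omega> \<Longrightarrow> (\<lambda>k. \<phi> k x) \<longlonglongrightarrow> u x"
    and g: "\<And>x. x \<in> \<Omega> \<Longrightarrow> (\<lambda>k. classical_grad (\<phi> k) x) \<longlonglongrightarrow> g x"
  shows "u \<in> H10 \<Omega>" "g \<in> L2 \<Omega>" "is_weak_grad \<Omega> u g"
proof -
  let ?M = "lebesgue_on \<Omega>"
  note m\<phi> = test_function_measurable[OF \<phi>, where S = \<Omega>]
  have um: "u \<in> borel_measurable ?M"
    by (rule borel_measurable_LIMSEQ_metric[OF m\<phi>(1)]) (use u in auto)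
  have gm: "g \<in> borel_measurable ?M"
    by (rule borel_measurable_LIMSEQ_metric[OF m\<phi>(2)]) (use g in auto)
  have uC: "\<bar>u x\<bar> \<le> C" if "x \<in> \<Omega>" for x
    using tendsto_rabs[OF u[OF that]] C(1)[OF that] by (intro LIMSEQ_le_const2) auto
  have gC: "norm (g x) \<le> C" if "x \<in> \<Omega>" for x
    using tendsto_norm[OF g[OF that]] C(2)[OF that] by (intro LIMSEQ_le_const2) auto
  have uL: "u \<in> L2 \<Omega>" using bounded_imp_L2[OF \<Omega> um, of C] uC by simp
  show gL: "g \<in> L2 \<Omega>" using bounded_imp_L2[OF \<Omega> gm, of C] gC by simp
  show wg: "is_weak_grad \<Omega> u g"
    unfolding is_weak_grad_def
  proof
    fix \<psi> :: "'a \<Rightarrow> real" assume \<psi>: "\<psi> \<in> test_functions \<Omega>"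
    note m\<psi> = test_function_measurable[OF \<psi>, where S = \<Omega>]
    obtain D where D: "0 \<le> D" "\<And>x. \<bar>\<psi> x\<bar> \<le> D" "\<And>x. norm (classical_grad \<psi> x) \<le> D"
      using test_function_bounded[OF \<psi>] by metis
    have "(\<lambda>k. LINT x|?M. \<phi> k x *\<^sub>R classical_grad \<psi> x) \<longlonglongrightarrow> (LINT x|?M. u x *\<^sub>R classical_grad \<psi> x)"
    proof (rule bounded_convergence[OF \<Omega>])
      fix k and x :: 'a assume x: "x \<in> \<Omega>"
      have "\<bar>\<phi> k x\<bar> * norm (classical_grad \<psi> x) \<le> C * D"
        using C(1)[OF x, of k] D(3)[of x] abs_ge_zero[of "\<phi> k x"] by (intro mult_mono norm_ge_zero) linarith+
      then show "norm (\<phi> k x *\<^sub>R classical_grad \<psi> x) \<le> C * D" by simp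
    qed (use m\<phi> m\<psi> u in \<open>auto intro!: tendsto_intros\<close>)
    then have *: "(\<lambda>k. - (LINT x|?M. \<psi> x *\<^sub>R classical_grad (\<phi> k) x)) \<longlonglongrightarrow> (LINT x|?M. u x *\<^sub>R classical_grad \<psi> x)"
      using test_function_weak_grad[OF \<Omega> \<phi>] \<psi> by (simp add: is_weak_grad_def)
    have "(\<lambda>k. LINT x|?M. \<psi> x *\<^sub>R classical_grad (\<phi> k) x) \<longlonglongrightarrow> (LINT x|?M. \<psi> x *\<^sub>R g x)"
    proof (rule bounded_convergence[OF \<Omega>])
      fix k and x :: 'a assume x: "x \<in> \<Omega>"
      have "\<bar>\<psi> x\<bar> * norm (classical_grad (\<phi> k) x) \<le> D * C"
        using C(2)[OF x, of k] D(1) D(2)[of x] by (intro mult_mono) auto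
      then show "norm (\<psi> x *\<^sub>R classical_grad (\<phi> k) x) \<le> D * C" by simp
    qed (use m\<phi> m\<psi> g in \<open>auto intro!: tendsto_intros\<close>)
    from LIMSEQ_unique[OF * tendsto_minus[OF this]]
    show "(LINT x|?M. u x *\<^sub>R classical_grad \<psi> x) = - (LINT x|?M. \<psi> x *\<^sub>R g x)" .
  qed
  have "(\<lambda>k. LINT x|?M. (norm (\<phi> k x - u x))\<^sup>2) \<longlonglongrightarrow> 0"
    using m\<phi>(1) um C(1) u by (intro tendsto_integral_norm_square) auto
  then have "(\<lambda>k. LINT x|?M. (\<phi> k x - u x)\<^sup>2) \<longlonglongrightarrow> 0" by simp
  moreover have "(\<lambda>k. LINT x|?M. (norm (classical_grad (\<phi> k) x - g x))\<^sup>2) \<longlonglongrightarrow> 0"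
    using m\<phi>(2) gm C(2) g by (intro tendsto_integral_norm_square) auto
  moreover have "H1_norm \<Omega> (\<lambda>x. \<phi> k x - u x) = sqrt ((LINT x|?M. (\<phi> k x - u x)\<^sup>2) +
      (LINT x|?M. (norm (classical_grad (\<phi> k) x - g x))\<^sup>2))" for k
    using test_function_L2[OF \<Omega> \<phi>] test_function_weak_grad[OF \<Omega> \<phi>] uL gL wg
    by (intro H1_norm_eq is_weak_grad_diff L2_diff) auto
  ultimately have "(\<lambda>k. H1_norm \<Omega> (\<lambda>x. \<phi> k x - u x)) \<longlonglongrightarrow> sqrt (0 + 0)"
    by (simp only:) (intro tendsto_intros, simp_all)
  then show "u \<in> H10 \<Omega>"
    using \<phi> uL gL wg by (auto simp: H10_def H1_def)
qed

text \<open>In place of an integral Cauchy-Schwarz inequality, a pointwise Young inequality with a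
  parameter is integrated; the parameter tends to 0 at the rate of the L^2 norm of
  \<open>h k\<close>.\<close>

lemma tendsto_integral_inner_L2:
  fixes h :: "nat \<Rightarrow> 'a \<Rightarrow> 'b::euclidean_space"
  assumes h: "\<And>k. h k \<in> L2 \<Omega>" "(\<lambda>k. LINT x|lebesgue_on \<Omega>. (norm (h k x))\<^sup>2) \<longlonglongrightarrow> 0"
    and G: "G \<in> borel_measurable (lebesgue_on \<Omega>)" "\<And>x. x \<in> \<Omega> \<Longrightarrow> norm (G x) \<le> C"
  shows "(\<lambda>k. LINT x|lebesgue_on \<Omega>. G x \<bullet> h k x) \<longlonglongrightarrow> 0"
proof -
  let ?M = "lebesgue_on \<Omega>"
  define N where "N k = (LINT x|?M. (norm (h k x))\<^sup>2)" for k
  \<comment> \<open>The Young parameter. The first summand gives N k / \<eta> k <= sqrt (N k); the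
    second keeps \<open>\<eta> k\<close> positive when the norm is 0.\<close>
  define \<eta> where "\<eta> k = sqrt (N k) + inverse (real (Suc k))" for k
  define \<mu> where "\<mu> = measure ?M (space ?M)"
  have N0: "0 \<le> N k" for k unfolding N_def by (intro integral_nonneg_AE) simp
  have \<eta>0: "0 < \<eta> k" for k unfolding \<eta>_def using N0[of k] by (intro add_nonneg_pos) auto
  have const: "integrable ?M (\<lambda>x. c)" for c :: real
    by (rule finite_measure.integrable_const[OF finite_measure_lebesgue_on_bounded[OF \<Omega>]])
  have le: "\<bar>LINT x|?M. G x \<bullet> h k x\<bar> \<le> \<eta> k * \<mu> + C\<^sup>2 * sqrt (N k)" for k
  proof -
    have int: "integrable ?M (\<lambda>x. (norm (h k x))\<^sup>2)" using h(1)[of k] by (simp add: L2_def)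
    have "\<bar>LINT x|?M. G x \<bullet> h k x\<bar> \<le> (LINT x|?M. \<bar>G x \<bullet> h k x\<bar>)"
      by (rule integral_abs_bound)
    also have "\<dots> \<le> (LINT x|?M. \<eta> k + C\<^sup>2 * (norm (h k x))\<^sup>2 / \<eta> k)"
    proof (rule integral_mono)
      show "integrable ?M (\<lambda>x. \<bar>G x \<bullet> h k x\<bar>)"
        using integrable_bounded_inner[OF L2_imp_integrable[OF \<Omega> h(1)] G] by simp
      show "integrable ?M (\<lambda>x. \<eta> k + C\<^sup>2 * (norm (h k x))\<^sup>2 / \<eta> k)"
        using const int by simp
      fix x assume "x \<in> space ?M"
      then have GC: "norm (G x) \<le> C" using G(2) by simp
      have "\<bar>G x \<bullet> h k x\<bar> \<le> norm (G x) * norm (h k x)" by (rule Cauchy_Schwarz_ineq2)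
      also have "\<dots> \<le> C * norm (h k x)" using GC by (rule mult_right_mono) simp
      also have "\<dots> \<le> \<eta> k + C\<^sup>2 * (norm (h k x))\<^sup>2 / \<eta> k"
      proof -
        define a where "a = C * norm (h k x)"
        have "2 * \<eta> k * a \<le> (\<eta> k)\<^sup>2 + a\<^sup>2" by (rule sum_squares_bound)
        moreover have "0 \<le> a" unfolding a_def using GC norm_ge_zero[of "G x"] by (intro mult_nonneg_nonneg norm_ge_zero) linarith
        moreover have "0 \<le> \<eta> k * a" using \<open>0 \<le> a\<close> \<eta>0[of k] by simp
        ultimately have "\<eta> k * a \<le> (\<eta> k)\<^sup>2 + a\<^sup>2" by linarith
        then have "a \<le> \<eta> k + a\<^sup>2 / \<eta> k" using \<eta>0[of k] by (simp add: field_simps power2_eq_square)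
        then show ?thesis by (simp add: a_def power_mult_distrib)
      qed
      finally show "\<bar>G x \<bullet> h k x\<bar> \<le> \<eta> k + C\<^sup>2 * (norm (h k x))\<^sup>2 / \<eta> k" .
    qed
    also have "\<dots> = \<eta> k * \<mu> + C\<^sup>2 * (N k / \<eta> k)"
      using const int by (simp add: N_def \<mu>_def)
    also have "N k / \<eta> k \<le> sqrt (N k)"
    proof -
      have "N k = sqrt (N k) * sqrt (N k)" using N0 by simp
      also have "\<dots> \<le> sqrt (N k) * \<eta> k" unfolding \<eta>_def using N0 by (intro mult_left_mono) auto
      finally show ?thesis using \<eta>0[of k] by (simp add: field_simps)
    qed
    finally show ?thesis by (simp add: mult_left_mono)
  qed
  have "(\<lambda>k. \<eta> k * \<mu> + C\<^sup>2 * sqrt (N k)) \<longlonglongrightarrow> (sqrt 0 + 0) * \<mu> + C\<^sup>2 * sqrt 0"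
    unfolding \<eta>_def by (intro tendsto_intros LIMSEQ_inverse_real_of_nat h(2)[folded N_def])
  then have "(\<lambda>k. \<eta> k * \<mu> + C\<^sup>2 * sqrt (N k)) \<longlonglongrightarrow> 0" by simp
  then show ?thesis
    by (rule Lim_null_comparison[rotated]) (use le in simp)
qed

text \<open>Bounded \<open>G\<close> and \<open>F\<close> on a bounded set make the functional
  continuous in the H^1 norm, and test functions are dense in H^1_0 by definition.\<close>

lemma H10_density:
  fixes G :: "'a \<Rightarrow> 'a" and F :: "'a \<Rightarrow> real"
  assumes \<phi>: "\<phi> \<in> H10 \<Omega>"
    and G: "G \<in> borel_measurable (lebesgue_on \<Omega>)" "\<And>x. x \<in> \<Omega> \<Longrightarrow> norm (G x) \<le> C"
    and F: "F \<in> borel_measurable (lebesgue_on \<Omega>)" "\<And>x. x \<in> \<Omega> \<Longrightarrow> \<bar>F x\<bar> \<le> C"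
    and zero: "\<And>\<phi>. \<phi> \<in> test_functions \<Omega> \<Longrightarrow> (LINT x|lebesgue_on \<Omega>. G x \<bullet> classical_grad \<phi> x + F x * \<phi> x) = 0"
  shows "(LINT x|lebesgue_on \<Omega>. G x \<bullet> weak_grad \<Omega> \<phi> x + F x * \<phi> x) = 0"
proof -
  let ?M = "lebesgue_on \<Omega>"
  obtain \<psi> where \<psi>: "\<And>k::nat. \<psi> k \<in> test_functions \<Omega>" "(\<lambda>k. H1_norm \<Omega> (\<lambda>x. \<psi> k x - \<phi> x)) \<longlonglongrightarrow> 0"
    using \<phi> by (auto simp: H10_def)
  obtain g where g: "g \<in> L2 \<Omega>" "is_weak_grad \<Omega> \<phi> g" and \<phi>L: "\<phi> \<in> L2 \<Omega>"
    using \<phi> by (auto simp: H10_def H1_def)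
  note w = weak_gradI[OF g]
  define e where "e k x = \<psi> k x - \<phi> x" for k x
  define D where "D k x = classical_grad (\<psi> k) x - weak_grad \<Omega> \<phi> x" for k x
  have eL: "e k \<in> L2 \<Omega>" and DL: "D k \<in> L2 \<Omega>" for k
    unfolding e_def D_def using test_function_L2[OF \<Omega> \<psi>(1)] \<phi>L w(1) by (auto intro: L2_diff)
  have wD: "is_weak_grad \<Omega> (e k) (D k)" for k
    unfolding e_def D_def
    by (intro is_weak_grad_diff test_function_L2[OF \<Omega> \<psi>(1)] \<phi>L w test_function_weak_grad[OF \<Omega> \<psi>(1)])
  have H: "H1_norm \<Omega> (e k) = sqrt ((LINT x|?M. (e k x)\<^sup>2) + (LINT x|?M. (norm (D k x))\<^sup>2))" for k
    by (rule H1_norm_eq[OF DL wD])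
  have H': "(\<lambda>k. (H1_norm \<Omega> (e k))\<^sup>2) \<longlonglongrightarrow> 0"
    using tendsto_power[OF \<psi>(2), of 2] by (simp add: e_def[abs_def])
  have nn: "0 \<le> (LINT x|?M. (e k x)\<^sup>2)" "0 \<le> (LINT x|?M. (norm (D k x))\<^sup>2)" for k
    by (intro integral_nonneg_AE; simp)+
  have le: "(LINT x|?M. (norm (e k x))\<^sup>2) \<le> (H1_norm \<Omega> (e k))\<^sup>2"
    "(LINT x|?M. (norm (D k x))\<^sup>2) \<le> (H1_norm \<Omega> (e k))\<^sup>2" for k
    using nn[of k] unfolding H by simp_all
  have e0: "(\<lambda>k. LINT x|?M. (norm (e k x))\<^sup>2) \<longlonglongrightarrow> 0"
    by (rule tendsto_sandwich[OF _ _ tendsto_const H']) (use le nn in auto)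
  have D0: "(\<lambda>k. LINT x|?M. (norm (D k x))\<^sup>2) \<longlonglongrightarrow> 0"
    by (rule tendsto_sandwich[OF _ _ tendsto_const H']) (use le nn in auto)
  have lim1: "(\<lambda>k. LINT x|?M. G x \<bullet> D k x) \<longlonglongrightarrow> 0"
    by (rule tendsto_integral_inner_L2[OF DL D0 G])
  have lim2: "(\<lambda>k. LINT x|?M. F x * e k x) \<longlonglongrightarrow> 0"
    using tendsto_integral_inner_L2[OF eL e0 F(1), of C] F(2) by simp
  \<comment> \<open>The left side does not involve \<open>k\<close>, while the right side consists
    of errors that tend to 0; hence the left side is 0.\<close>
  have eq: "(LINT x|?M. G x \<bullet> weak_grad \<Omega> \<phi> x + F x * \<phi> x) =
      - (LINT x|?M. G x \<bullet> D k x) - (LINT x|?M. F x * e k x)" for k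
  proof -
    have int: "integrable ?M (\<lambda>x. G x \<bullet> v x)" if "v \<in> L2 \<Omega>" for v
      by (rule integrable_bounded_inner[OF L2_imp_integrable[OF \<Omega> that] G])
    have int': "integrable ?M (\<lambda>x. F x * v x)" if "v \<in> L2 \<Omega>" for v
      using integrable_bounded_scaleR[OF L2_imp_integrable[OF \<Omega> that] F] by simp
    have "(LINT x|?M. G x \<bullet> weak_grad \<Omega> \<phi> x + F x * \<phi> x) =
      (LINT x|?M. (G x \<bullet> classical_grad (\<psi> k) x + F x * \<psi> k x) - (G x \<bullet> D k x + F x * e k x))"
      by (intro Bochner_Integration.integral_cong) (auto simp: D_def e_def inner_diff_right algebra_simps)
    also have "\<dots> = (LINT x|?M. G x \<bullet> classical_grad (\<psi> k) x + F x * \<psi> k x) - (LINT x|?M. G x \<bullet> D k x + F x * e k x)"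
      using int int' test_function_L2[OF \<Omega> \<psi>(1)] eL DL
      by (intro Bochner_Integration.integral_diff Bochner_Integration.integrable_add) auto
    also have "\<dots> = - (LINT x|?M. G x \<bullet> D k x) - (LINT x|?M. F x * e k x)"
      using zero[OF \<psi>(1)] int[OF DL] int'[OF eL] by simp
    finally show ?thesis .
  qed
  have "(\<lambda>k. LINT x|?M. G x \<bullet> weak_grad \<Omega> \<phi> x + F x * \<phi> x) \<longlonglongrightarrow> - 0 - 0"
    using tendsto_diff[OF tendsto_minus[OF lim1] lim2] eq by simp
  then show ?thesis by (simp add: LIMSEQ_const_iff)
qed

end


section \<open>From radial profiles to weak solutions\<close>

lemma Ck_antiderivative:
  fixes S :: "real \<Rightarrow> real"
  assumes "\<And>m. Ck m S"
  obtains A where "\<And>m. Ck m A" "\<And>t. (A has_real_derivative S t) (at t)" "A c = 0"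
proof -
  have "isCont S t" for t
    using Ck_continuous_on[OF assms[of 0]] by (simp add: continuous_on_eq_continuous_at)
  then obtain A where A: "\<And>t. (A has_real_derivative S t) (at t)"
    using einterval_antiderivative[of "-\<infinity>" "\<infinity>" S]
    by (auto simp: has_real_derivative_iff_has_vector_derivative)
  let ?A = "\<lambda>t. A t - A c"
  have D: "(?A has_real_derivative S t) (at t)" for t
    using DERIV_diff[OF A DERIV_const[of "A c"]] by simp
  have "Ck m ?A" for m
    by (rule Ck_decr[OF Ck_Suc_realI[OF D assms]])
  with D show thesis using that[of ?A] by simp
qed

lemma Ck_real_polynomial:
  assumes "real_polynomial_function (p :: real \<Rightarrow> real)"
  shows "Ck m p"
proof -
  obtain a n where "p = (\<lambda>x. \<Sum>i\<le>n. a i * x ^ i)"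
    using assms unfolding real_polynomial_function_iff_sum by blast
  then show ?thesis
    by (auto intro!: Ck_sum Ck_mult Ck_const Ck_power Ck_id)
qed

text \<open>The derivative \<open>V\<close> is approximated rather than \<open>U\<close>:
  polynomials near \<open>V\<close>, cut off before t = T, are integrated from T downwards. The
  resulting profiles vanish near the sphere, so composed with x \<bullet> x they are test functions,
  and their gradients converge boundedly.\<close>

lemma radial_H10:
  fixes U V :: "real \<Rightarrow> real"
  assumes R: "0 < R" and V: "continuous_on {0..R\<^sup>2} V"
    and U: "\<And>t. t \<in> {0..R\<^sup>2} \<Longrightarrow> (U has_real_derivative V t) (at t within {0..R\<^sup>2})" "U (R\<^sup>2) = 0"
  shows "(\<lambda>x::'a::euclidean_space. U (x \<bullet> x)) \<in> H10 (ball 0 R)"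
    "(\<lambda>x::'a. (2 * V (x \<bullet> x)) *\<^sub>R x) \<in> L2 (ball 0 R)"
    "is_weak_grad (ball 0 R) (\<lambda>x::'a. U (x \<bullet> x)) (\<lambda>x. (2 * V (x \<bullet> x)) *\<^sub>R x)"
proof -
  define T where "T = R\<^sup>2"
  have T: "0 < T" using R by (simp add: T_def)
  obtain C where C: "0 \<le> C" "\<And>t. t \<in> {0..T} \<Longrightarrow> norm (V t) \<le> C"
    using pwc_bounded[OF pwc_continuous[OF V]] unfolding T_def by metis
  have "\<exists>g. real_polynomial_function g \<and> (\<forall>x\<in>{0..T}. \<bar>V x - g x\<bar> < 1 / real (Suc k))" for k
    using Stone_Weierstrass_real_polynomial_function[OF compact_Icc V, of "1 / real (Suc k)"]
    unfolding T_def by (metis of_nat_0_less_iff zero_less_Suc zero_less_divide_1_iff)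
  then obtain P where P: "\<And>k. real_polynomial_function (P k)"
    "\<And>k x. x \<in> {0..T} \<Longrightarrow> \<bar>V x - P k x\<bar> < 1 / real (Suc k)"
    by metis
  \<comment> \<open>The cutoff makes \<open>S k\<close> vanish as soon as T - t <= 1/(k+1).\<close>
  define S where "S k t = P k t * step (real (Suc k) * (T - t) - 1)" for k t
  have CkS: "Ck m (S k)" for k m
  proof -
    have "Ck m (\<lambda>t. real (Suc k) * (T + - 1 * t) + - 1)"
      by (intro Ck_add Ck_mult Ck_const Ck_id)
    then have "Ck m (\<lambda>t. real (Suc k) * (T - t) - 1)" by (simp add: algebra_simps)
    from Ck_mult[OF Ck_real_polynomial[OF P(1)] Ck_compose[OF Ck_step this]]
    show ?thesis unfolding S_def .
  qed
  have "\<exists>A. (\<forall>m. Ck m A) \<and> (\<forall>t. (A has_real_derivative S k t) (at t)) \<and> A T = 0" for k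
    using Ck_antiderivative[OF CkS, of k T] by metis
  then obtain W where W: "\<And>k m. Ck m (W k)" "\<And>k t. (W k has_real_derivative S k t) (at t)" "\<And>k. W k T = 0"
    by metis
  have SC: "\<bar>S k t\<bar> \<le> C + 1" if "t \<in> {0..T}" for k t
  proof -
    have "1 / real (Suc k) \<le> 1" by simp
    then have "\<bar>P k t\<bar> \<le> C + 1" using P(2)[OF that, of k] C(2)[OF that] unfolding real_norm_def by linarith
    then have "\<bar>P k t\<bar> * \<bar>step (real (Suc k) * (T - t) - 1)\<bar> \<le> (C + 1) * 1"
      using step_simps C(1) by (intro mult_mono) auto
    then show ?thesis by (simp add: S_def abs_mult)
  qed
  have Slim: "(\<lambda>k. S k t) \<longlonglongrightarrow> V t" if "t \<in> {0..<T}" for t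
  proof -
    have "(\<lambda>k. V t - P k t) \<longlonglongrightarrow> 0"
      by (rule Lim_null_comparison[OF _ LIMSEQ_inverse_real_of_nat])
        (use P(2)[of t] that in \<open>auto simp: inverse_eq_divide intro!: always_eventually less_imp_le\<close>)
    then have "(\<lambda>k. P k t) \<longlonglongrightarrow> V t" using tendsto_diff[OF tendsto_const[of "V t"]] by fastforce
    then have "(\<lambda>k. S k t) \<longlonglongrightarrow> V t * 1"
      unfolding S_def by (intro tendsto_mult tendsto_step) (use that in auto)
    then show ?thesis by simp
  qed
  have FTC: "(S k has_integral - W k t) {t..T}" if "t \<in> {0..T}" for k t
    using fundamental_theorem_of_calculus[of t T "W k" "S k"] W(2)[of k] W(3)[of k] that
    by (auto simp: has_real_derivative_iff_has_vector_derivative has_vector_derivative_at_within)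
  have WC: "\<bar>W k t\<bar> \<le> (C + 1) * T" if t: "t \<in> {0..T}" for k t
  proof -
    have "norm (- W k t) \<le> (C + 1) * (T - t)"
      using has_integral_bound_real[OF _ finite.emptyI FTC[OF t], of "C + 1"] SC C(1) t by force
    also have "\<dots> \<le> (C + 1) * T" using C(1) t by (intro mult_left_mono) auto
    finally show ?thesis by simp
  qed
  have Wlim: "(\<lambda>k. W k t) \<longlonglongrightarrow> U t" if t: "t \<in> {0..T}" for t
  proof -
    have FTCU: "(V has_integral (U T - U t)) {t..T}"
    proof (rule fundamental_theorem_of_calculus)
      fix s assume s: "s \<in> {t..T}"
      have "(U has_real_derivative V s) (at s within {t..T})"
        by (rule DERIV_subset[OF U(1)[of s]]) (use s t in \<open>auto simp: T_def\<close>)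
      then show "(U has_vector_derivative V s) (at s within {t..T})"
        by (simp add: has_real_derivative_iff_has_vector_derivative)
    qed (use t in auto)
    \<comment> \<open>The endpoint is left out because S k T = 0 for all k, so convergence to
      \<open>V\<close> may fail there.\<close>
    have "(\<lambda>k. integral {t<..<T} (S k)) \<longlonglongrightarrow> integral {t<..<T} V"
    proof (rule dominated_convergence(2)[where h = "\<lambda>_. C + 1"])
      show "S k integrable_on {t<..<T}" for k
        using has_integral_integrable[OF FTC[OF t]] by (simp add: integrable_on_open_interval_real)
      show "norm (S k s) \<le> C + 1" if "s \<in> {t<..<T}" for k s using SC[of s k] that t by simp
      show "(\<lambda>s. C + 1) integrable_on {t<..<T}"
        by (simp add: integrable_on_open_interval_real integrable_const_ivl)
      show "(\<lambda>k. S k s) \<longlonglongrightarrow> V s" if "s \<in> {t<..<T}" for s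
        by (rule Slim) (use that t in auto)
    qed
    then have "(\<lambda>k. - W k t) \<longlonglongrightarrow> U T - U t"
      using integral_unique[OF FTC[OF t]] integral_unique[OF FTCU]
      by (simp add: integral_open_interval_real)
    then have "(\<lambda>k. - W k t) \<longlonglongrightarrow> - U t" using U(2) by (simp add: T_def)
    then show ?thesis by (simp add: tendsto_minus_cancel_left)
  qed
  define \<phi> where "\<phi> k x = W k (x \<bullet> x)" for k and x :: 'a
  have D\<phi>: "(\<phi> k has_derivative (\<lambda>v. S k (x \<bullet> x) * (2 * (x \<bullet> v)))) (at x)" for k x
  proof -
    have "((\<lambda>x::'a. x \<bullet> x) has_derivative (\<lambda>v. 2 * (x \<bullet> v))) (at x)"
      by (auto intro!: derivative_eq_intros simp: inner_commute)
    from has_derivative_compose[OF this W(2)[of k "x \<bullet> x", unfolded has_field_derivative_def]]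
    show ?thesis unfolding \<phi>_def .
  qed
  have grad: "classical_grad (\<phi> k) x = (2 * S k (x \<bullet> x)) *\<^sub>R x" for k x
    by (rule euclidean_eqI) (simp add: classical_grad_inner[OF D\<phi>])
  have test: "\<phi> k \<in> test_functions (ball 0 R)" for k
  proof -
    \<comment> \<open>Past \<open>T'\<close> the derivative \<open>S k\<close> is zero, so
      \<open>W k\<close> is constant there and equals its value 0 at \<open>T\<close>.\<close>
    define T' where "T' = T - 1 / real (Suc k)"
    have T': "T' < T" by (simp add: T'_def)
    have W0: "W k t = 0" if "T' < t" for t
    proof -
      have S0: "S k s = 0" if "T' < s" for s
      proof -
        have "real (Suc k) * (T - s) < 1" using that by (simp add: T'_def field_simps)
        then show ?thesis by (simp add: S_def step_simps)
      qed
      have "W k t = W k T"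
        by (rule DERIV_isconst3[of T' "max t T + 1"]) (use S0 W(2)[of k] that T' in \<open>auto, metis\<close>)
      then show ?thesis using W(3) by simp
    qed
    let ?K = "{x::'a. x \<bullet> x \<le> T'}"
    have sub: "?K \<subseteq> ball 0 R"
    proof
      fix x assume "x \<in> ?K"
      then have "x \<bullet> x < R\<^sup>2" using T' by (simp add: T_def)
      then show "x \<in> ball 0 R" using inner_self_less[OF R] by blast
    qed
    have "closed ?K" by (intro closed_Collect_le continuous_intros)
    then have "compact ?K" using bounded_subset[OF bounded_ball sub] by (simp add: compact_eq_bounded_closed)
    moreover have "Ck m (\<phi> k)" for m
      unfolding \<phi>_def by (rule Ck_compose[OF W(1)], subst euclidean_inner)
        (intro Ck_sum Ck_mult Ck_inner)
    ultimately show ?thesis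
      using sub W0 by (intro test_functionsI[of _ ?K]) (auto simp: \<phi>_def)
  qed
  define B where "B = max ((C + 1) * T) (2 * (C + 1) * R)"
  note lim = H10_limit[of "ball (0::'a) R" \<phi> B "\<lambda>x. U (x \<bullet> x)" "\<lambda>x. (2 * V (x \<bullet> x)) *\<^sub>R x", OF open_ball bounded_ball test]
  have x_T: "x \<bullet> x \<in> {0..<T}" if "x \<in> ball 0 R" for x :: 'a
    using inner_self_less[OF R, of x] that by (simp add: T_def)
  have 1: "\<bar>\<phi> k x\<bar> \<le> B" if "x \<in> ball 0 R" for k x
    using WC[of "x \<bullet> x" k] x_T[OF that] by (simp add: \<phi>_def B_def)
  have 2: "norm (classical_grad (\<phi> k) x) \<le> B" if "x \<in> ball 0 R" for k x
  proof -
    have "2 * \<bar>S k (x \<bullet> x)\<bar> * norm x \<le> 2 * (C + 1) * R"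
      using SC[of "x \<bullet> x" k] x_T[OF that] that C(1) by (intro mult_mono) auto
    then show ?thesis unfolding grad by (simp add: B_def abs_mult)
  qed
  have 3: "(\<lambda>k. \<phi> k x) \<longlonglongrightarrow> U (x \<bullet> x)" if "x \<in> ball 0 R" for x
    using Wlim[of "x \<bullet> x"] x_T[OF that] by (simp add: \<phi>_def)
  have 4: "(\<lambda>k. classical_grad (\<phi> k) x) \<longlonglongrightarrow> (2 * V (x \<bullet> x)) *\<^sub>R x" if "x \<in> ball 0 R" for x
    unfolding grad by (intro tendsto_intros Slim x_T that)
  show "(\<lambda>x::'a. U (x \<bullet> x)) \<in> H10 (ball 0 R)"
    "(\<lambda>x::'a. (2 * V (x \<bullet> x)) *\<^sub>R x) \<in> L2 (ball 0 R)"
    "is_weak_grad (ball 0 R) (\<lambda>x::'a. U (x \<bullet> x)) (\<lambda>x. (2 * V (x \<bullet> x)) *\<^sub>R x)"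
    using lim 1 2 3 4 by blast+
qed

text \<open>The bridge from profiles to the weak formulation. The equation -\<Delta>u + c = h says
  that \<Delta>u is c - h, hence the right-hand side \<open>Cf t - Hf t\<close>. The divergence
  identity for test functions extends to all of H^1_0 by \<open>H10_density\<close>.\<close>

lemma radial_weak_dirichlet_solution:
  fixes U Cf Hf :: "real \<Rightarrow> real" and c h :: "'a::euclidean_space \<Rightarrow> real"
  assumes R: "0 < R" and t0: "0 < t0" and pwc: "pwc t0 (R\<^sup>2) Cf" "pwc t0 (R\<^sup>2) Hf"
    and U: "\<And>t. t \<in> {0..R\<^sup>2} \<Longrightarrow> U t = a + rint DIM('a) (\<lambda>t. Cf t - Hf t) t" "U (R\<^sup>2) = 0"
    and u: "\<And>x. u x = U (x \<bullet> x)"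
    and c: "\<And>x. x \<in> ball 0 R \<Longrightarrow> c x = Cf (x \<bullet> x)" and h: "\<And>x. x \<in> ball 0 R \<Longrightarrow> h x = Hf (x \<bullet> x)"
  shows "weak_dirichlet_solution (ball (0::'a) R) u c h"
proof -
  let ?M = "lebesgue_on (ball (0::'a) R)"
  define F where "F t = Cf t - Hf t" for t
  have F: "pwc t0 (R\<^sup>2) F"
    using pwc_add[OF pwc(1) pwc_scaleR[OF pwc(2), of "-1"]] by (simp add: F_def[abs_def])
  define V where "V t = ravg DIM('a) F t / 2" for t
  define G where "G x = (2 * V (x \<bullet> x)) *\<^sub>R x" for x :: 'a
  have ueq: "u = (\<lambda>x. U (x \<bullet> x))" using u by blast
  have cR: "continuous_on {0..R\<^sup>2} (ravg DIM('a) F)" by (rule continuous_on_ravg[OF F t0])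
  then have Vc: "continuous_on {0..R\<^sup>2} V" unfolding V_def by (intro continuous_intros) auto
  have dU: "(U has_real_derivative V t) (at t within {0..R\<^sup>2})" if t: "t \<in> {0..R\<^sup>2}" for t
  proof -
    have "((\<lambda>t. a + rint DIM('a) F t) has_vector_derivative V t) (at t within {0..R\<^sup>2})"
      using has_vector_derivative_add[OF has_vector_derivative_const rint_has_derivative[OF F t0 t]]
      by (simp add: V_def)
    then have "(U has_vector_derivative V t) (at t within {0..R\<^sup>2})"
      by (rule has_vector_derivative_transform[OF t, rotated]) (use U(1) in \<open>auto simp: F_def[abs_def]\<close>)
    then show ?thesis by (simp add: has_real_derivative_iff_has_vector_derivative)
  qed
  have H: "u \<in> H10 (ball 0 R)" "G \<in> L2 (ball 0 R)" "is_weak_grad (ball 0 R) u G"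
    unfolding ueq G_def[abs_def] using radial_H10[OF R Vc, of U] dU U(2) by blast+
  note wg = weak_gradI[OF open_ball bounded_ball H(2,3)]
  have sub: "(\<lambda>x::'a. x \<bullet> x) ` ball 0 R \<subseteq> {0..R\<^sup>2}" using inner_self_mem_ball by blast
  have cont: "continuous_on UNIV (\<lambda>x::'a. x \<bullet> x)" by (intro continuous_intros)
  have meas: "(\<lambda>x. K (x \<bullet> x)) \<in> borel_measurable ?M" if "pwc t0 (R\<^sup>2) K" for K :: "real \<Rightarrow> real"
    by (rule pwc_measurable[OF that cont _ sub]) auto
  have cm: "c \<in> borel_measurable ?M"
    using meas[OF pwc(1)] by (rule measurable_cong[THEN iffD2, rotated]) (simp add: c)
  have hm: "h \<in> borel_measurable ?M"
    using meas[OF pwc(2)] by (rule measurable_cong[THEN iffD2, rotated]) (simp add: h)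
  obtain C1 where C1: "\<And>t. t \<in> {0..R\<^sup>2} \<Longrightarrow> norm (Cf t) \<le> C1" using pwc_bounded[OF pwc(1)] by metis
  obtain C2 where C2: "\<And>t. t \<in> {0..R\<^sup>2} \<Longrightarrow> norm (Hf t) \<le> C2" using pwc_bounded[OF pwc(2)] by metis
  obtain C3 where C3: "\<And>t. t \<in> {0..R\<^sup>2} \<Longrightarrow> norm (F t) \<le> C3" using pwc_bounded[OF F] by metis
  have cb: "\<bar>c x\<bar> \<le> C1" if "x \<in> ball 0 R" for x using C1 inner_self_mem_ball[OF that] c[OF that] by auto
  have hb: "\<bar>h x\<bar> \<le> C2" if "x \<in> ball 0 R" for x using C2 inner_self_mem_ball[OF that] h[OF that] by auto
  have Gm: "G \<in> borel_measurable ?M"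
    using H(2) by (simp add: L2_def)
  have Gb: "norm (G x) \<le> C3 * R" if x: "x \<in> ball 0 R" for x
  proof -
    note xx = inner_self_mem_ball[OF x]
    have "norm (ravg DIM('a) F (x \<bullet> x)) \<le> C3"
      by (rule ravg_bound[OF xx F]) (use C3 xx in auto)
    moreover have "0 \<le> C3" using norm_ge_zero order_trans[OF _ C3[OF xx]] by blast
    ultimately have "\<bar>ravg DIM('a) F (x \<bullet> x)\<bar> * norm x \<le> C3 * R" using x by (intro mult_mono) auto
    then show ?thesis by (simp add: G_def V_def)
  qed
  have "(LINT x|?M. weak_grad (ball 0 R) u x \<bullet> weak_grad (ball 0 R) \<phi> x + c x * \<phi> x) = (LINT x|?M. h x * \<phi> x)"
    if \<phi>: "\<phi> \<in> H10 (ball 0 R)" for \<phi>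
  proof -
    obtain g where g: "g \<in> L2 (ball 0 R)" "is_weak_grad (ball 0 R) \<phi> g" and \<phi>L: "\<phi> \<in> L2 (ball 0 R)"
      using \<phi> by (auto simp: H10_def H1_def)
    note w = weak_gradI[OF open_ball bounded_ball g]
    have i1: "integrable ?M (\<lambda>x. G x \<bullet> weak_grad (ball 0 R) \<phi> x)"
      by (rule integrable_bounded_inner[OF L2_imp_integrable[OF open_ball bounded_ball w(1)] Gm Gb])
    have i2: "integrable ?M (\<lambda>x. c x * \<phi> x)" "integrable ?M (\<lambda>x. h x * \<phi> x)"
      using integrable_bounded_scaleR[OF L2_imp_integrable[OF open_ball bounded_ball \<phi>L] cm cb]
        integrable_bounded_scaleR[OF L2_imp_integrable[OF open_ball bounded_ball \<phi>L] hm hb] by auto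
    have "(LINT x|?M. weak_grad (ball 0 R) u x \<bullet> weak_grad (ball 0 R) \<phi> x + c x * \<phi> x) =
        (LINT x|?M. G x \<bullet> weak_grad (ball 0 R) \<phi> x + c x * \<phi> x)"
    proof (rule integral_cong_AE)
      show "AE x in ?M. weak_grad (ball 0 R) u x \<bullet> weak_grad (ball 0 R) \<phi> x + c x * \<phi> x =
          G x \<bullet> weak_grad (ball 0 R) \<phi> x + c x * \<phi> x"
        using wg(3) by eventually_elim simp
    qed (use wg(1) w(1) \<phi>L cm Gm in \<open>auto simp: L2_def\<close>)
    also have "\<dots> = (LINT x|?M. (G x \<bullet> weak_grad (ball 0 R) \<phi> x + F (x \<bullet> x) * \<phi> x) + h x * \<phi> x)"
      by (rule Bochner_Integration.integral_cong) (auto simp: c h F_def algebra_simps)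
    also have "\<dots> = (LINT x|?M. G x \<bullet> weak_grad (ball 0 R) \<phi> x + F (x \<bullet> x) * \<phi> x) + (LINT x|?M. h x * \<phi> x)"
    proof (rule Bochner_Integration.integral_add[OF _ i2(2)])
      have "integrable ?M (\<lambda>x. F (x \<bullet> x) * \<phi> x)"
        by (rule Bochner_Integration.integrable_cong[THEN iffD2, OF refl _ Bochner_Integration.integrable_diff[OF i2]])
          (auto simp: c h F_def algebra_simps)
      with i1 show "integrable ?M (\<lambda>x. G x \<bullet> weak_grad (ball 0 R) \<phi> x + F (x \<bullet> x) * \<phi> x)" by simp
    qed
    also have "(LINT x|?M. G x \<bullet> weak_grad (ball 0 R) \<phi> x + F (x \<bullet> x) * \<phi> x) = 0"
    proof (rule H10_density[OF open_ball bounded_ball \<phi> Gm _ meas[OF F]])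
      show "norm (G x) \<le> max (C3 * R) C3" if "x \<in> ball 0 R" for x using Gb[OF that] by simp
      show "\<bar>F (x \<bullet> x)\<bar> \<le> max (C3 * R) C3" if "x \<in> ball 0 R" for x :: 'a
        using C3[OF inner_self_mem_ball[OF that]] by simp
      show "(LINT x|?M. G x \<bullet> classical_grad \<psi> x + F (x \<bullet> x) * \<psi> x) = 0"
        if "\<psi> \<in> test_functions (ball 0 R)" for \<psi>
        using div_defect_pwc[OF R that F t0] by (simp add: div_defect_def[OF R that] G_def V_def)
    qed
    finally show ?thesis by simp
  qed
  moreover have "integrable ?M c"
    by (rule integrable_lebesgue_on_bounded[OF open_ball bounded_ball cm]) (use cb in auto)
  ultimately show ?thesis
    using H(1) by (simp add: weak_dirichlet_solution_def)
qed


subsection \<open>Radial initial value problems\<close>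

lemma pwc_const: "pwc t0 T (\<lambda>_. c)"
  by (rule pwc_continuous) (rule continuous_on_const)

lemma ravg_zero: "ravg n (\<lambda>_. 0) = (\<lambda>_. 0)"
  by (simp add: ravg_def[abs_def])

text \<open>In the application \<open>t0\<close> and \<open>T\<close> are the squared radii of the
  two balls and \<open>n\<close> is the dimension of the space.\<close>

locale radial_interval =
  fixes t0 T :: real and n :: nat
  assumes t0: "0 < t0" and T: "0 < T" and n: "1 \<le> n"
begin

lemma ravg_integrable_on:
  fixes F :: "real \<Rightarrow> 'b::euclidean_space"
  assumes "pwc t0 T F" "t \<in> {0..T}"
  shows "ravg n F integrable_on {0..t}"
  by (rule integrable_continuous_interval, rule continuous_on_subset[OF continuous_on_ravg[OF assms(1) t0]])
    (use assms(2) in auto)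

lemma rint_add:
  fixes F :: "real \<Rightarrow> 'b::euclidean_space"
  assumes "pwc t0 T F" "pwc t0 T G" "t \<in> {0..T}"
  shows "rint n (\<lambda>t. F t + G t) t = rint n F t + rint n G t"
proof -
  have "integral {0..t} (ravg n (\<lambda>t. F t + G t)) = integral {0..t} (\<lambda>s. ravg n F s + ravg n G s)"
    by (intro integral_cong ravg_add[OF _ assms(1,2)]) (use assms(3) in auto)
  then show ?thesis
    using ravg_integrable_on[OF assms(1,3)] ravg_integrable_on[OF assms(2,3)]
    by (simp add: rint_def Henstock_Kurzweil_Integration.integral_add scaleR_add_right)
qed

lemma rint_scaleR:
  fixes F :: "real \<Rightarrow> 'b::euclidean_space"
  shows "rint n (\<lambda>t. c *\<^sub>R F t) t = c *\<^sub>R rint n F t"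
  unfolding rint_def ravg_scaleR by simp

lemma rint_cong:
  fixes F :: "real \<Rightarrow> 'b::euclidean_space"
  assumes "t \<in> {0..T}" "\<And>s. s \<in> {0..t} \<Longrightarrow> F s = G s"
  shows "rint n F t = rint n G t"
  unfolding rint_def
  by (intro arg_cong[of _ _ "(*\<^sub>R) _"] integral_cong ravg_cong[where T = T]) (use assms in auto)

lemma continuous_on_rint:
  fixes F :: "real \<Rightarrow> 'b::euclidean_space"
  assumes "pwc t0 T F"
  shows "continuous_on {0..T} (rint n F)"
  using rint_has_derivative[OF assms t0]
  by (meson continuous_on_eq_continuous_within has_vector_derivative_continuous)

lemma rint_mono:
  fixes F G :: "real \<Rightarrow> real"
  assumes "t \<in> {0..T}" "pwc t0 T F" "pwc t0 T G" "\<And>s. s \<in> {0..t} \<Longrightarrow> F s \<le> G s"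
  shows "rint n F t \<le> rint n G t"
proof -
  have "integral {0..t} (ravg n F) \<le> integral {0..t} (ravg n G)"
    by (intro integral_le ravg_integrable_on ravg_mono[OF _ assms(2,3)]) (use assms in auto)
  then show ?thesis by (simp add: rint_def)
qed

lemma rint_nonneg:
  fixes F :: "real \<Rightarrow> real"
  assumes "t \<in> {0..T}" "pwc t0 T F" "\<And>s. s \<in> {0..t} \<Longrightarrow> 0 \<le> F s"
  shows "0 \<le> rint n F t"
  using rint_mono[OF assms(1) pwc_const assms(2,3)]
  by (simp add: rint_def ravg_zero)

lemma ravg_le:
  fixes F :: "real \<Rightarrow> real"
  assumes "t \<in> {0..T}" "pwc t0 T F" "\<And>s. s \<in> {0..t} \<Longrightarrow> F s \<le> C" "0 \<le> C"
  shows "ravg n F t \<le> C"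
proof -
  have "ravg n F t \<le> ravg n (\<lambda>_. C) t"
    by (rule ravg_mono[OF assms(1,2) pwc_const]) (use assms in auto)
  also have "\<dots> \<le> C"
    using ravg_bound[OF assms(1) pwc_const, of C C n] assms(4) by simp
  finally show ?thesis .
qed

text \<open>One-sided on purpose: later it bounds \<open>y\<close> from below by an upper bound on
  its right-hand side alone, so the size of \<open>f\<close> does not enter.\<close>

lemma rint_diff_le:
  fixes F :: "real \<Rightarrow> real"
  assumes "s \<in> {0..T}" "t \<in> {s..T}" "pwc t0 T F" "\<And>r. r \<in> {0..T} \<Longrightarrow> F r \<le> C" "0 \<le> C"
  shows "rint n F t - rint n F s \<le> C * (t - s) / 2"
proof -
  have i: "ravg n F integrable_on {0..t}" using ravg_integrable_on[OF assms(3)] assms by simp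
  have "integral {0..s} (ravg n F) + integral {s..t} (ravg n F) = integral {0..t} (ravg n F)"
    by (rule Henstock_Kurzweil_Integration.integral_combine) (use assms i in auto)
  moreover have "integral {s..t} (ravg n F) \<le> integral {s..t} (\<lambda>_. C)"
  proof (rule integral_le)
    show "ravg n F integrable_on {s..t}"
      by (rule integrable_subinterval_real[OF i]) (use assms in auto)
    show "ravg n F r \<le> C" if "r \<in> {s..t}" for r
      by (rule ravg_le[OF _ assms(3)]) (use assms that in auto)
  qed auto
  ultimately show ?thesis using assms(2) by (simp add: rint_def mult.commute)
qed

lemma rint_bounded_linear:
  fixes F :: "real \<Rightarrow> 'b::euclidean_space" and h :: "'b \<Rightarrow> 'c::euclidean_space"
  assumes h: "bounded_linear h" and F: "pwc t0 T F" and t: "t \<in> {0..T}"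
  shows "h (rint n F t) = rint n (\<lambda>s. h (F s)) t"
proof -
  have r: "ravg n (\<lambda>s. h (F s)) s = h (ravg n F s)" if "s \<in> {0..T}" for s
    unfolding ravg_def
    by (subst integral_bounded_linear[OF h ravg_integrable[OF that F], symmetric])
      (simp add: linear_scale[OF bounded_linear.linear[OF h]])
  have "integral {0..t} (ravg n (\<lambda>s. h (F s))) = integral {0..t} (h \<circ> ravg n F)"
    by (rule integral_cong) (use r t in auto)
  also have "\<dots> = h (integral {0..t} (ravg n F))"
    by (rule integral_linear[OF ravg_integrable_on[OF F t] h])
  finally show ?thesis
    by (simp add: rint_def linear_scale[OF bounded_linear.linear[OF h]])
qed

text \<open>In the sup norm with weight e^(-L t) the operator \<open>rint\<close> gains the factor 1
  / (2 L): averaging preserves an increasing bound, integrating e^(L s) yields 1 / L, and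
  \<open>rint\<close> contributes 1/2. An \<open>L\<close>-Lipschitz nonlinearity thus leads to a
  contraction with factor 1/2.\<close>

lemma rint_diff_bound:
  fixes F G :: "real \<Rightarrow> 'b::euclidean_space"
  assumes F: "pwc t0 T F" and G: "pwc t0 T G" and t: "t \<in> {0..T}" and L: "0 < L" and B: "0 \<le> B"
    and bd: "\<And>s. s \<in> {0..T} \<Longrightarrow> norm (F s - G s) \<le> B * exp (L * s)"
  shows "norm (rint n F t - rint n G t) \<le> B / (2 * L) * exp (L * t)"
proof -
  have FG: "pwc t0 T (\<lambda>s. F s - G s)"
    using pwc_add[OF F pwc_scaleR[OF G, of "-1"]] by simp
  have i: "ravg n F integrable_on {0..t}" "ravg n G integrable_on {0..t}"
    using ravg_integrable_on F G t by auto
  have ex: "((\<lambda>s. B * exp (L * s)) has_integral (B / L * exp (L * t) - B / L * exp (L * 0))) {0..t}"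
    using t L by (intro fundamental_theorem_of_calculus)
      (auto simp: has_real_derivative_iff_has_vector_derivative[symmetric] intro!: derivative_eq_intros)
  have "norm (integral {0..t} (\<lambda>s. ravg n F s - ravg n G s)) \<le> integral {0..t} (\<lambda>s. B * exp (L * s))"
  proof (rule integral_norm_bound_integral)
    show "(\<lambda>s. ravg n F s - ravg n G s) integrable_on {0..t}" using i by (rule integrable_diff)
    show "(\<lambda>s. B * exp (L * s)) integrable_on {0..t}" using ex by blast
    fix s assume s: "s \<in> {0..t}"
    then have sT: "s \<in> {0..T}" using t by auto
    have "norm (ravg n (\<lambda>s. F s - G s) s) \<le> B * exp (L * s)"
    proof (rule ravg_bound[OF sT FG])
      fix r assume r: "r \<in> {0..s}"
      then have "norm (F r - G r) \<le> B * exp (L * r)" using bd sT by simp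
      also have "\<dots> \<le> B * exp (L * s)" using r L B by (intro mult_left_mono) auto
      finally show "norm (F r - G r) \<le> B * exp (L * s)" .
    qed
    then show "norm (ravg n F s - ravg n G s) \<le> B * exp (L * s)"
      by (simp add: ravg_diff[OF sT F G])
  qed
  also have "\<dots> \<le> B / L * exp (L * t)"
    unfolding integral_unique[OF ex] using B L by simp
  finally have "norm (integral {0..t} (ravg n F) - integral {0..t} (ravg n G)) \<le> B / L * exp (L * t)"
    using i by (simp add: Henstock_Kurzweil_Integration.integral_diff)
  then show ?thesis
    unfolding rint_def scaleR_diff_right[symmetric] by simp
qed

text \<open>Banach's fixed point theorem in the exponentially weighted sup norm, which gives a
  solution on the whole interval in one go.\<close>

lemma volterra_exists:
  fixes \<Phi> :: "real \<Rightarrow> 'b::euclidean_space \<Rightarrow> 'b"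
  assumes L: "0 < L"
    and pwc: "\<And>u. continuous_on {0..T} u \<Longrightarrow> pwc t0 T (\<lambda>t. \<Phi> t (u t))"
    and lip: "\<And>t v w. t \<in> {0..T} \<Longrightarrow> norm (\<Phi> t v - \<Phi> t w) \<le> L * norm (v - w)"
  obtains u where "continuous_on {0..T} u" "\<And>t. t \<in> {0..T} \<Longrightarrow> u t = c + rint n (\<lambda>t. \<Phi> t (u t)) t"
proof -
  \<comment> \<open>Clamping to [0, T] turns functions on the interval into bounded continuous
    functions on the line, a complete space.\<close>
  define p where "p t = max 0 (min T t)" for t
  have p: "p t \<in> {0..T}" "continuous_on UNIV p" for t
    unfolding p_def using T by (auto intro!: continuous_intros)
  \<comment> \<open>The unknown \<open>v\<close> of the fixed point problem is the weighted function
    e^(-L t) u; \<open>U\<close> undoes the weight.\<close>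
  define U where "U v t = exp (L * t) *\<^sub>R apply_bcontfun v t" for v :: "real \<Rightarrow>\<^sub>C 'b" and t
  define N where "N v = rint n (\<lambda>t. \<Phi> t (U v t))" for v
  have pw: "pwc t0 T (\<lambda>t. \<Phi> t (U v t))" for v
    unfolding U_def
    by (intro pwc continuous_intros) (simp add: continuous_on_apply_bcontfun)
  define S where "S v t = exp (- L * p t) *\<^sub>R (c + N v (p t))" for v t
  have S: "S v \<in> bcontfun" for v
  proof -
    have cN: "continuous_on {0..T} (N v)" unfolding N_def by (rule continuous_on_rint[OF pw])
    have cc: "continuous_on {0..T} (\<lambda>t. exp (- L * t) *\<^sub>R (c + N v t))"
      by (intro continuous_intros cN)
    have "continuous_on UNIV (S v)"
      unfolding S_def by (rule continuous_on_compose2[OF cc p(2)]) (use p(1) in auto)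
    have "bounded ((\<lambda>t. exp (- L * t) *\<^sub>R (c + N v t)) ` {0..T})"
      by (intro compact_imp_bounded compact_continuous_image cc compact_Icc)
    then obtain M where M: "\<And>t. t \<in> {0..T} \<Longrightarrow> norm (exp (- L * t) *\<^sub>R (c + N v t)) \<le> M"
      unfolding bounded_iff by blast
    have "norm (S v t) \<le> M" for t
      unfolding S_def by (rule M[OF p(1)])
    with \<open>continuous_on UNIV (S v)\<close> show ?thesis
      by (auto simp: bcontfun_def bounded_iff)
  qed
  have contr: "dist (Bcontfun (S v)) (Bcontfun (S w)) \<le> 1/2 * dist v w" for v w
  proof (rule dist_bound)
    fix t
    have "norm (N v (p t) - N w (p t)) \<le> L * dist v w / (2 * L) * exp (L * p t)"
      unfolding N_def
    proof (rule rint_diff_bound[OF pw pw p(1) L])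
      fix s assume s: "s \<in> {0..T}"
      have "norm (U v s - U w s) = exp (L * s) * dist (apply_bcontfun v s) (apply_bcontfun w s)"
        unfolding U_def by (simp add: dist_norm scaleR_diff_right[symmetric])
      also have "\<dots> \<le> exp (L * s) * dist v w"
        by (intro mult_left_mono dist_bounded) auto
      finally have "L * norm (U v s - U w s) \<le> L * (exp (L * s) * dist v w)" using L by simp
      then show "norm (\<Phi> s (U v s) - \<Phi> s (U w s)) \<le> L * dist v w * exp (L * s)"
        using lip[OF s, of "U v s" "U w s"] by (simp add: algebra_simps)
    qed (use L in auto)
    also have "\<dots> = 1/2 * dist v w * exp (L * p t)" using L by simp
    finally have "exp (- L * p t) * norm (N v (p t) - N w (p t)) \<le> exp (- L * p t) * (1/2 * dist v w * exp (L * p t))"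
      by (rule mult_left_mono) simp
    also have "\<dots> = 1/2 * dist v w" by (simp add: exp_minus)
    finally show "dist (apply_bcontfun (Bcontfun (S v)) t) (apply_bcontfun (Bcontfun (S w)) t) \<le> 1/2 * dist v w"
      unfolding Bcontfun_inverse[OF S] S_def dist_norm scaleR_diff_right[symmetric] by simp
  qed
  obtain v where v: "Bcontfun (S v) = v"
    using banach_fix_type[of "1/2" "\<lambda>v. Bcontfun (S v)"] contr by auto
  have fixpoint: "U v t = c + rint n (\<lambda>t. \<Phi> t (U v t)) t" if "t \<in> {0..T}" for t
  proof -
    have "p t = t" using that by (simp add: p_def)
    have "apply_bcontfun v t = S v t" using Bcontfun_inverse[OF S, of v] v by metis
    then have "U v t = c + N v t"
      unfolding S_def \<open>p t = t\<close> by (simp add: U_def exp_minus)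
    then show ?thesis by (simp only: N_def)
  qed
  show thesis
  proof (rule that[OF _ fixpoint])
    show "continuous_on {0..T} (U v)"
      unfolding U_def by (intro continuous_intros) (simp add: continuous_on_apply_bcontfun)
  qed
qed

text \<open>At a maximum point of the weighted difference \<open>h\<close> the equation gives h m <=
  norm (c - d) + h m / 2. The lemma provides the continuity of the shooting map.\<close>

lemma volterra_dependence:
  fixes \<Phi> :: "real \<Rightarrow> 'b::euclidean_space \<Rightarrow> 'b"
  assumes L: "0 < L"
    and pwc: "\<And>u. continuous_on {0..T} u \<Longrightarrow> pwc t0 T (\<lambda>t. \<Phi> t (u t))"
    and lip: "\<And>t v w. t \<in> {0..T} \<Longrightarrow> norm (\<Phi> t v - \<Phi> t w) \<le> L * norm (v - w)"
    and u: "continuous_on {0..T} u" "\<And>t. t \<in> {0..T} \<Longrightarrow> u t = c + rint n (\<lambda>t. \<Phi> t (u t)) t"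
    and v: "continuous_on {0..T} v" "\<And>t. t \<in> {0..T} \<Longrightarrow> v t = d + rint n (\<lambda>t. \<Phi> t (v t)) t"
  shows "norm (u T - v T) \<le> 2 * exp (L * T) * norm (c - d)"
proof -
  define h where "h t = exp (- L * t) * norm (u t - v t)" for t
  have "continuous_on {0..T} h" unfolding h_def using u v by (intro continuous_intros)
  then obtain m where m: "m \<in> {0..T}" "\<And>t. t \<in> {0..T} \<Longrightarrow> h t \<le> h m"
    using continuous_attains_sup[of "{0..T}" h] T by auto
  have uv: "norm (u t - v t) = h t * exp (L * t)" for t
    by (simp add: h_def exp_minus)
  have h0: "0 \<le> h m" by (simp add: h_def)
  have "norm (rint n (\<lambda>t. \<Phi> t (u t)) m - rint n (\<lambda>t. \<Phi> t (v t)) m) \<le> L * h m / (2 * L) * exp (L * m)"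
  proof (rule rint_diff_bound[OF pwc[OF u(1)] pwc[OF v(1)] m(1) L])
    fix s assume s: "s \<in> {0..T}"
    have "norm (u s - v s) \<le> h m * exp (L * s)" unfolding uv using m(2)[OF s] by simp
    then have "L * norm (u s - v s) \<le> L * (h m * exp (L * s))" using L by simp
    then show "norm (\<Phi> s (u s) - \<Phi> s (v s)) \<le> L * h m * exp (L * s)"
      using lip[OF s, of "u s" "v s"] by (simp add: algebra_simps)
  qed (use L h0 in auto)
  then have "norm (u m - v m) \<le> norm (c - d) + h m / 2 * exp (L * m)"
    using norm_triangle_ineq[of "c - d" "rint n (\<lambda>t. \<Phi> t (u t)) m - rint n (\<lambda>t. \<Phi> t (v t)) m"]
      u(2)[OF m(1)] v(2)[OF m(1)] L by (simp add: algebra_simps)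
  then have "h m * exp (L * m) \<le> norm (c - d) * exp (L * m) + h m / 2 * exp (L * m)"
    using uv[of m] mult_left_mono[of 1 "exp (L * m)" "norm (c - d)"] m(1) L by simp
  then have "h m * exp (L * m) \<le> (norm (c - d) + h m / 2) * exp (L * m)"
    by (simp add: algebra_simps)
  then have "h m \<le> norm (c - d) + h m / 2" by simp
  then have "h m \<le> 2 * norm (c - d)" by simp
  then have "h T \<le> 2 * norm (c - d)" using m(2)[of T] T by simp
  then show ?thesis unfolding uv[of T] by (simp add: mult.commute mult.left_commute mult_right_mono)
qed

subsection \<open>A maximum principle\<close>

text \<open>
  Up to a constant factor, \<open>t\<^bsup>n/2\<^esup> ravg n F t\<close> is the integral of \<open>F\<close> over the ball of radius \<open>sqrt t\<close>,
  hence increases on intervals where \<open>F\<close> is nonnegative.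
\<close>

lemma ravg_nonneg_propagates:
  fixes F :: "real \<Rightarrow> real"
  assumes F: "pwc t0 T F" and a: "0 \<le> a" "a \<le> t" "t \<le> T"
    and F0: "\<And>s. s \<in> {a..t} \<Longrightarrow> 0 \<le> F s" and start: "a = 0 \<or> 0 \<le> ravg n F a"
  shows "0 \<le> ravg n F t"
proof (cases "a = 0")
  case True
  have "ravg n (\<lambda>_. 0) t \<le> ravg n F t"
    by (rule ravg_mono[OF _ pwc_const F]) (use a F0 True in auto)
  then show ?thesis by (simp add: ravg_def)
next
  case False
  then have t: "0 < t" "0 < a" "t \<in> {0..T}" using a by auto
  \<comment> \<open>Splits the averaging integral where t * s^2 = a. Rescaling [0, \<theta>] to
    [0, 1] makes the lower part equal to \<theta>^n times \<open>ravg n F a\<close>; the upper part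
    samples \<open>F\<close> on [a, t] only.\<close>
  define \<theta> where "\<theta> = sqrt (a / t)"
  have \<theta>: "0 < \<theta>" "\<theta> \<le> 1" "\<theta>\<^sup>2 = a / t" using t a by (auto simp: \<theta>_def)
  define f where "f s = s ^ (n - 1) * F (t * s\<^sup>2)" for s
  have int: "integrable (lebesgue_on {0..1}) f"
    using ravg_integrable[OF t(3) F, of n] by (simp add: f_def[abs_def])
  then have f: "f integrable_on {0..1}" by (rule integrable_on_lebesgue_on) simp
  have rt: "ravg n F t = integral {0..1} f"
    using lebesgue_integral_eq_integral[OF int] by (simp add: ravg_def f_def[abs_def])
  have fs: "f integrable_on {0..\<theta>}" "f integrable_on {\<theta>..1}"
    by (rule integrable_subinterval_real[OF f]; use \<theta> in auto)+
  have "((\<lambda>x. f (\<theta> * x)) has_integral (1 / \<bar>\<theta>\<bar>) * integral {0..\<theta>} f) ((\<lambda>x. x / \<theta>) ` {0..\<theta>})"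
    using has_integral_stretch_real[of f "integral {0..\<theta>} f" 0 \<theta> \<theta>] fs(1) \<theta>
    by (simp add: integrable_integral)
  moreover have "(\<lambda>x. x / \<theta>) ` {0..\<theta>} = {0..1}"
    using \<theta>(1) by (simp add: image_divide_atLeastAtMost)
  moreover have "(\<lambda>x. f (\<theta> * x)) = (\<lambda>x. \<theta> ^ (n - 1) * (x ^ (n - 1) * F (a * x\<^sup>2)))"
  proof
    fix x
    have "t * (\<theta> * x)\<^sup>2 = a * x\<^sup>2" using \<theta>(3) t by (simp add: power_mult_distrib)
    then show "f (\<theta> * x) = \<theta> ^ (n - 1) * (x ^ (n - 1) * F (a * x\<^sup>2))"
      unfolding f_def by (simp only: power_mult_distrib[of \<theta> x "n - 1"] mult.assoc)
  qed
  ultimately have "integral {0..1} (\<lambda>x. \<theta> ^ (n - 1) * (x ^ (n - 1) * F (a * x\<^sup>2))) = integral {0..\<theta>} f / \<theta>"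
    using \<theta>(1) by (intro integral_unique) simp
  moreover have "ravg n F a = integral {0..1} (\<lambda>x. x ^ (n - 1) * F (a * x\<^sup>2))"
    using lebesgue_integral_eq_integral[OF ravg_integrable[OF _ F, of a n]] t a by (simp add: ravg_def)
  ultimately have "\<theta> ^ (n - 1) * ravg n F a = integral {0..\<theta>} f / \<theta>"
    by simp
  then have "integral {0..\<theta>} f = \<theta> * (\<theta> ^ (n - 1) * ravg n F a)" using \<theta>(1) by (simp add: field_simps)
  moreover have "0 \<le> ravg n F a" using start t by auto
  ultimately have "0 \<le> integral {0..\<theta>} f" using \<theta>(1) by simp
  moreover have "0 \<le> integral {\<theta>..1} f"
  proof (rule integral_nonneg[OF fs(2)])
    fix s assume s: "s \<in> {\<theta>..1}"
    have "\<theta>\<^sup>2 \<le> s\<^sup>2" using s \<theta>(1) by (intro power_mono) auto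
    moreover have "s\<^sup>2 \<le> 1" using s \<theta>(1) by (intro power_le_one) auto
    ultimately have "a \<le> t * s\<^sup>2" "t * s\<^sup>2 \<le> t"
      using \<theta>(3) t by (auto simp: divide_le_eq mult.commute mult_left_le)
    then show "0 \<le> f s" using F0[of "t * s\<^sup>2"] s \<theta>(1) by (simp add: f_def)
  qed
  moreover have "integral {0..\<theta>} f + integral {\<theta>..1} f = integral {0..1} f"
    by (rule Henstock_Kurzweil_Integration.integral_combine) (use \<theta> f in auto)
  ultimately show ?thesis unfolding rt by linarith
qed

text \<open>Starting from a positive maximum at \<open>m\<close>, \<open>F\<close> is nonnegative as
  long as \<open>u\<close> is positive, so \<open>ravg n F\<close> stays nonnegative and
  \<open>u\<close> cannot decrease before its first return to nonpositive values. This is a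
  contradiction. No second derivative of \<open>u\<close> is used, as \<open>F\<close> may
  jump.\<close>

lemma max_principle:
  fixes u :: "real \<Rightarrow> real"
  assumes F: "pwc t0 T F" and u: "\<And>t. t \<in> {0..T} \<Longrightarrow> u t = c + rint n F t" and uT: "u T \<le> 0"
    and pos: "\<And>t. t \<in> {0..T} \<Longrightarrow> 0 < u t \<Longrightarrow> 0 \<le> F t" and t: "t \<in> {0..T}"
  shows "u t \<le> 0"
proof (rule ccontr)
  assume neg: "\<not> u t \<le> 0"
  have D: "(u has_real_derivative ravg n F s / 2) (at s)" if s: "s \<in> {0<..<T}" for s
  proof -
    have "((\<lambda>t. c + rint n F t) has_vector_derivative (1/2) *\<^sub>R ravg n F s) (at s within {0..T})"
      using has_vector_derivative_add[OF has_vector_derivative_const rint_has_derivative[OF F t0, of s n]] s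
      by simp
    then have "(u has_vector_derivative (1/2) *\<^sub>R ravg n F s) (at s within {0..T})"
      by (rule has_vector_derivative_transform[rotated 2]) (use s u in auto)
    moreover have "at s within {0..T} = at s"
      using s by (intro at_within_interior) (simp add: interior_atLeastAtMost_real)
    ultimately show ?thesis by (simp add: has_real_derivative_iff_has_vector_derivative)
  qed
  have cu: "continuous_on {0..T} u"
    by (rule continuous_on_eq[OF continuous_on_add[OF continuous_on_const continuous_on_rint[OF F]]])
      (use u in simp)
  obtain m where m: "m \<in> {0..T}" "\<And>s. s \<in> {0..T} \<Longrightarrow> u s \<le> u m"
    using continuous_attains_sup[OF _ _ cu] T by auto
  have um: "0 < u m" using m(2)[OF t] neg by simp
  then have mT: "m < T" using uT m(1) by (cases "m = T") auto
  \<comment> \<open>A maximum at the origin gives no derivative condition;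
    \<open>ravg_nonneg_propagates\<close> treats it as the separate case a = 0.\<close>
  have start: "m = 0 \<or> 0 \<le> ravg n F m"
  proof (cases "m = 0")
    case False
    then have mi: "m \<in> {0<..<T}" using m mT by auto
    have "ravg n F m / 2 = 0"
    proof (rule DERIV_local_max[OF D[OF mi], of "min m (T - m)"])
      show "\<forall>y. \<bar>m - y\<bar> < min m (T - m) \<longrightarrow> u y \<le> u m"
      proof (intro allI impI)
        fix y assume "\<bar>m - y\<bar> < min m (T - m)"
        then have "y \<in> {0..T}" by (simp add: abs_less_iff)
        then show "u y \<le> u m" by (rule m(2))
      qed
    qed (use mi in auto)
    then show ?thesis by simp
  qed auto
  define Z where "Z = {s \<in> {m..T}. u s \<le> 0}"
  have "closed ({m..T} \<inter> u -` {..0})"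
    by (rule continuous_closed_preimage[OF continuous_on_subset[OF cu]]) (use m in auto)
  moreover have "Z = {m..T} \<inter> u -` {..0}" by (auto simp: Z_def)
  ultimately have "closed Z" by simp
  moreover have "T \<in> Z" "bdd_below Z" using uT m by (auto simp: Z_def)
  ultimately have \<gamma>: "Inf Z \<in> Z" using closed_contains_Inf by blast
  define \<gamma> where "\<gamma> = Inf Z"
  have g: "m \<le> \<gamma>" "\<gamma> \<le> T" "u \<gamma> \<le> 0" using \<gamma> by (auto simp: Z_def \<gamma>_def)
  have before: "0 < u s" if "s \<in> {m..<\<gamma>}" for s
  proof (rule ccontr)
    assume "\<not> 0 < u s"
    then have "s \<in> Z" using that g by (auto simp: Z_def)
    then have "\<gamma> \<le> s" unfolding \<gamma>_def using \<open>bdd_below Z\<close> by (rule cInf_lower)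
    then show False using that by simp
  qed
  have "m < \<gamma>" using g um by (cases "m = \<gamma>") auto
  have "u m \<le> u \<gamma>"
  proof (rule DERIV_nonneg_imp_increasing_open[OF \<open>m \<le> \<gamma>\<close>])
    fix s assume s: "m < s" "s < \<gamma>"
    have "0 \<le> ravg n F s"
      by (rule ravg_nonneg_propagates[OF F _ _ _ _ start]) (use s m g before pos in auto)
    then show "\<exists>y. DERIV u s :> y \<and> 0 \<le> y"
      using D[of s] s m g by (intro exI[of _ "ravg n F s / 2"]) auto
  next
    show "continuous_on {m..\<gamma>} u" by (rule continuous_on_subset[OF cu]) (use m g in auto)
  qed
  then show False using g(3) um by simp
qed

end


subsection \<open>A negative solution vanishing at the boundary\<close>

context radial_interval
begin

lemma rint_bound:
  fixes F :: "real \<Rightarrow> 'b::euclidean_space"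
  assumes "pwc t0 T F" "t \<in> {0..T}" "\<And>s. s \<in> {0..T} \<Longrightarrow> norm (F s) \<le> C"
  shows "norm (rint n F t) \<le> C * t / 2"
proof -
  have "norm (integral {0..t} (ravg n F)) \<le> integral {0..t} (\<lambda>_. C)"
  proof (rule integral_norm_bound_integral[OF ravg_integrable_on[OF assms(1,2)]])
    show "norm (ravg n F s) \<le> C" if "s \<in> {0..t}" for s
      by (rule ravg_bound[OF _ assms(1)]) (use assms(2,3) that in auto)
  qed auto
  then show ?thesis using assms(2) by (simp add: rint_def mult.commute)
qed

text \<open>\<open>F\<close> may vanish up to \<open>t0\<close>; the strict sign comes from the
  values of \<open>s\<close> near 1, for which t * s^2 lies in the part where \<open>F\<close> is
  positive.\<close>

lemma ravg_pos:
  fixes F :: "real \<Rightarrow> real"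
  assumes F: "pwc t0 T F" and nonneg: "\<And>t. t \<in> {0..T} \<Longrightarrow> 0 \<le> F t"
    and pos: "\<And>t. t \<in> {t0<..<T} \<Longrightarrow> 0 < F t" and t: "t \<in> {t0<..<T}"
  shows "0 < ravg n F t"
proof -
  let ?h = "\<lambda>s. s ^ (n - 1) *\<^sub>R F (t * s\<^sup>2)"
  let ?M = "lebesgue_on {0..1::real}"
  have tT: "t \<in> {0..T}" using t t0 by auto
  have mem: "t * s\<^sup>2 \<in> {0..T}" if "s \<in> {0..1}" for s
    using mult_square_mem[OF tT that] tT by auto
  have h0: "0 \<le> ?h s" if "s \<in> {0..1}" for s
    using nonneg[OF mem[OF that]] that by simp
  have "0 \<le> ravg n F t"
    unfolding ravg_def by (rule integral_nonneg_AE) (use h0 in \<open>auto intro!: AE_I2\<close>)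
  moreover have "ravg n F t \<noteq> 0"
  proof
    assume "ravg n F t = 0"
    then have "AE s in ?M. ?h s = 0"
      unfolding ravg_def
      by (subst (asm) integral_nonneg_eq_0_iff_AE[OF ravg_integrable[OF tT F]])
        (use h0 in \<open>auto intro!: AE_I2\<close>)
    then have ae: "AE s in lebesgue. s \<in> {0..1} \<longrightarrow> ?h s = 0"
      by (subst (asm) AE_restrict_space_iff) auto
    \<comment> \<open>Exactly for s > \<theta> does t * s^2 exceed \<open>t0\<close>; the interval
      from \<theta> to 1 has positive measure.\<close>
    define \<theta> where "\<theta> = sqrt (t0 / t)"
    have \<theta>: "0 < \<theta>" "\<theta> < 1" "\<theta>\<^sup>2 = t0 / t" using t t0 by (auto simp: \<theta>_def)
    have hpos: "?h s \<noteq> 0" if s: "s \<in> {\<theta><..<1}" for s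
    proof -
      have "\<theta>\<^sup>2 < s\<^sup>2" using s \<theta> by (intro power_strict_mono) auto
      then have 1: "t0 < t * s\<^sup>2" using \<theta>(3) t t0 by (simp add: divide_less_eq mult.commute)
      have "s\<^sup>2 \<le> 1" using s \<theta> by (intro power_le_one) auto
      then have "t * s\<^sup>2 \<le> t" using t t0 by (simp add: mult_left_le)
      then have "0 < F (t * s\<^sup>2)" using 1 t by (intro pos) auto
      then show ?thesis using s \<theta> by simp
    qed
    have "AE s in lebesgue. s \<notin> {\<theta><..<1}"
      using ae by eventually_elim (use hpos \<theta> in fastforce)
    then have "emeasure lebesgue {\<theta><..<1} = 0"
      by (subst (asm) AE_iff_measurable[where N = "{\<theta><..<1}"]) auto
    then show False using \<theta> by simp
  qed
  ultimately show ?thesis by simp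
qed

lemma rint_pos:
  fixes F :: "real \<Rightarrow> real"
  assumes F: "pwc t0 T F" and nonneg: "\<And>t. t \<in> {0..T} \<Longrightarrow> 0 \<le> F t"
    and pos: "\<And>t. t \<in> {t0<..<T} \<Longrightarrow> 0 < F t" and lt: "t0 < T"
  shows "0 < rint n F T"
proof -
  have "0 \<le> rint n F T" by (rule rint_nonneg[OF _ F]) (use T nonneg in auto)
  moreover have "integral {0..T} (ravg n F) \<noteq> 0"
  proof
    assume 0: "integral {0..T} (ravg n F) = 0"
    have "ravg n F t = 0" if "t \<in> {0..T}" for t
    proof -
      have "0 \<le> ravg n F t" if "t \<in> {0..T}" for t
        using ravg_mono[OF that pwc_const F, of 0 n] nonneg that by (simp add: ravg_zero)
      then show ?thesis
        using integral_eq_0_iff[OF continuous_on_ravg[OF F t0, of n] T] 0 that by auto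
    qed
    moreover have "0 < ravg n F ((t0 + T) / 2)"
      by (rule ravg_pos[OF F nonneg pos]) (use lt in auto)
    ultimately show False using lt t0 T by fastforce
  qed
  ultimately show ?thesis by (simp add: rint_def)
qed

end

text \<open>As f'' is continuous only away from 0, \<open>f'\<close> is Lipschitz merely on
  intervals bounded away from 0; the lower end -1 suffices since the solution is kept above it. In
  \<open>ne\<close> the condition f'' <> 0 survives in the integrated form that the boundary
  argument uses.\<close>

locale radial_nonlinearity = radial_interval +
  fixes f f' :: "real \<Rightarrow> real"
  assumes lt: "t0 < T"
    and deriv: "(f has_real_derivative f' y) (at y)"
    and cont: "continuous_on UNIV f'"
    and nonneg: "0 \<le> f' y"
    and f0: "f 0 = 0"
    and lipschitz: "\<And>d. 0 < d \<Longrightarrow> \<exists>M. \<forall>x\<in>{-1..-d}. \<forall>y\<in>{-1..-d}. \<bar>f' x - f' y\<bar> \<le> M * \<bar>x - y\<bar>"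
    and ne: "y < 0 \<Longrightarrow> f' y \<noteq> f' 0"
begin

lemma f_mono: "x \<le> y \<Longrightarrow> f x \<le> f y"
  using DERIV_nonneg_imp_nondecreasing[of x y f] deriv nonneg by blast

lemma f_cont: "continuous_on S f"
  using deriv by (meson DERIV_isCont continuous_at_imp_continuous_on)

text \<open>\<open>f'\<close> maps the negative half-line onto a connected set that avoids
  \<open>f' 0\<close>. Recording the sign as a factor \<open>s\<close> spares a case distinction
  between the convex and the concave case later.\<close>

lemma sign:
  obtains s :: real where "\<And>y. y < 0 \<Longrightarrow> 0 < s * (f' y - f' 0)"
proof -
  have same: "f' y < f' 0 \<longleftrightarrow> f' z < f' 0" if "y < 0" "z < 0" for y z
  proof (rule ccontr)
    assume diff: "\<not> (f' y < f' 0 \<longleftrightarrow> f' z < f' 0)"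
    have "connected (f' ` {..<0})"
      by (intro connected_continuous_image continuous_on_subset[OF cont]) auto
    moreover have "f' y \<in> f' ` {..<0}" "f' z \<in> f' ` {..<0}" using that by auto
    moreover have "(f' y \<le> f' 0 \<and> f' 0 \<le> f' z) \<or> (f' z \<le> f' 0 \<and> f' 0 \<le> f' y)" using diff by linarith
    ultimately have "f' 0 \<in> f' ` {..<0}" unfolding connected_iff_interval by blast
    then show False using ne by force
  qed
  show thesis
  proof (cases "f' (-1) < f' 0")
    case True
    then show thesis using that[of "-1"] same[of "-1"] by force
  next
    case False
    then have "f' 0 < f' y" if "y < 0" for y
      using same[of "-1" y] ne[OF that] that by force
    then show thesis using that[of 1] by force
  qed
qed

text \<open>The right-hand side \<open>G\<close> of the second equation is identified only for t <
  t0. Near the boundary \<open>y\<close> approaches 0, where the truncation of \<open>f'\<close> is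
  active and \<open>G\<close> differs from f'(y) q in general; but there \<open>q\<close> no longer
  enters the equation for \<open>y\<close>.\<close>

lemma negative_solution:
  obtains y q G :: "real \<Rightarrow> real" and a e where
    "continuous_on {0..T} y" "continuous_on {0..T} q" "continuous_on {0..T} G"
    "\<And>t. t \<in> {0..T} \<Longrightarrow> y t = a + rint n (\<lambda>t. f (y t) + (if t < t0 then q t else 0)) t"
    "\<And>t. t \<in> {0..T} \<Longrightarrow> q t = e + rint n G t"
    "\<And>t. t \<in> {0..<t0} \<Longrightarrow> G t = f' (y t) * q t"
    "y T = 0" "\<And>t. t \<in> {0..<T} \<Longrightarrow> y t < 0"
proof -
  have "bounded (f' ` {-1..0})"
    by (intro compact_imp_bounded compact_continuous_image continuous_on_subset[OF cont]) auto
  then obtain L0 where L0: "\<And>y. y \<in> {-1..0} \<Longrightarrow> norm (f' y) \<le> L0"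
    unfolding bounded_iff by blast
  define L where "L = max 1 L0"
  have L1: "1 \<le> L" "0 < L" by (auto simp: L_def)
  have L: "f' y \<le> L" if "y \<in> {-1..0}" for y
    using L0[OF that] by (simp add: L_def)
  \<comment> \<open>\<open>M\<close> will be the cap for \<open>q\<close>; as 1 / T it is small
    enough to keep \<open>y\<close> above -1. The value \<open>\<epsilon>\<close> of
    \<open>q\<close> at the origin is such that the Gronwall bound 2 \<epsilon> e^(L T) is exactly
    \<open>M\<close>.\<close>
  define \<epsilon> where "\<epsilon> = exp (- L * T) / (2 * T)"
  define M where "M = 1 / T"
  have \<epsilon>: "0 < \<epsilon>" "2 * \<epsilon> * exp (L * T) = M" using T by (auto simp: \<epsilon>_def M_def exp_minus)
  have M: "0 < M" using T by (simp add: M_def)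
  have "1 \<le> exp (L * T)" using L1 T by simp
  then have \<epsilon>M: "\<epsilon> \<le> M" using \<epsilon> mult_left_mono[of 1 "exp (L * T)" \<epsilon>] by linarith
  \<comment> \<open>\<open>\<kappa> * \<phi>\<close> is a subsolution for \<open>- y\<close> that does not depend on the truncation below.\<close>
  define \<omega> where "\<omega> = (2 * real n + L) / (4 * t0) + 1"
  define \<kappa> where "\<kappa> = \<epsilon> / (2 * real n * \<omega> + L)"
  define \<phi> where "\<phi> t = exp (- \<omega> * t) - exp (- \<omega> * T)" for t
  \<comment> \<open>In the annulus there is no source, and the convexity of the exponential must
    outweigh the slope \<open>L\<close> of \<open>f\<close>: this fixes \<open>\<omega>\<close>. In
    the small ball the Laplacian of the barrier may be as low as -2 n \<omega> \<kappa>;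
    \<open>\<kappa>\<close> is so small that the source, at least \<open>\<epsilon>\<close> there,
    pays for this and for the \<open>L\<close> term.\<close>
  have lam: "1 \<le> \<omega>" "L \<le> 4 * t0 * \<omega> - 2 * real n"
    using t0 L1 by (auto simp: \<omega>_def field_simps)
  have den: "0 < 2 * real n * \<omega> + L" using lam L1 by (intro add_nonneg_pos) auto
  have kap: "0 < \<kappa>" "\<kappa> * (2 * real n * \<omega> + L) = \<epsilon>" using \<epsilon> den by (auto simp: \<kappa>_def)
  have phi_pos: "0 < \<phi> t" if "t < T" for t using that lam by (simp add: \<phi>_def)
  have phi_le: "\<phi> t \<le> exp (- \<omega> * t)" for t by (simp add: \<phi>_def)
  \<comment> \<open>\<open>\<phi>\<close> decreases, so \<open>\<kappa> * \<phi> t0\<close> bounds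
    the barrier from below on the small ball, and \<open>y\<close> will stay below -d there. The cap
    1 keeps the interval [-1, -d] nonempty.\<close>
  define d where "d = min 1 (\<kappa> * \<phi> t0)"
  have d: "0 < d" "d \<le> 1" using kap phi_pos[OF lt] by (auto simp: d_def)
  obtain M0 where M0: "\<And>x y. x \<in> {-1..-d} \<Longrightarrow> y \<in> {-1..-d} \<Longrightarrow> \<bar>f' x - f' y\<bar> \<le> M0 * \<bar>x - y\<bar>"
    using lipschitz[OF d(1)] by blast
  define M' where "M' = max 0 M0"
  have M': "\<bar>f' x - f' y\<bar> \<le> M' * \<bar>x - y\<bar>" "0 \<le> M'" if "x \<in> {-1..-d}" "y \<in> {-1..-d}" for x y
    using M0[OF that] mult_right_mono[of M0 M' "\<bar>x - y\<bar>"] by (auto simp: M'_def)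
  \<comment> \<open>Truncations make the system globally Lipschitz; \<open>f'\<close> is also cut off near \<open>0\<close>, where it need not
    be Lipschitz. The solution found below stays in the range where they have no effect.\<close>
  define ft where "ft y = f (max (-1) (min y 0))" for y
  define g where "g y = f' (max (-1) (min y (- d)))" for y
  define m where "m q = min \<bar>q\<bar> M" for q :: real
  have f_lip: "\<bar>f x - f y\<bar> \<le> L * \<bar>x - y\<bar>" if "x \<in> {-1..0}" "y \<in> {-1..0}" for x y
  proof -
    have "norm (f x - f y) \<le> L * norm (x - y)"
    proof (rule field_differentiable_bound[of "{-1..0}" f f'])
      show "norm (f' z) \<le> L" if "z \<in> {-1..0}" for z using L[OF that] nonneg[of z] by simp
      show "(f has_field_derivative f' z) (at z within {-1..0})" for z
        using deriv by (rule has_field_derivative_at_within)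
    qed (use that in auto)
    then show ?thesis by simp
  qed
  have ft_lip: "\<bar>ft x - ft y\<bar> \<le> L * \<bar>x - y\<bar>" for x y
  proof -
    have "\<bar>ft x - ft y\<bar> \<le> L * \<bar>max (-1) (min x 0) - max (-1) (min y 0)\<bar>"
      unfolding ft_def by (rule f_lip) auto
    also have "\<dots> \<le> L * \<bar>x - y\<bar>" using L1 by (intro mult_left_mono) auto
    finally show ?thesis .
  qed
  have g_lip: "\<bar>g x - g y\<bar> \<le> M' * \<bar>x - y\<bar>" for x y
  proof -
    have "\<bar>g x - g y\<bar> \<le> M' * \<bar>max (-1) (min x (-d)) - max (-1) (min y (-d))\<bar>"
      unfolding g_def by (rule M') (use d in auto)
    also have "\<dots> \<le> M' * \<bar>x - y\<bar>" by (intro mult_left_mono) (auto simp: M'_def)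
    finally show ?thesis .
  qed
  have g_bd: "0 \<le> g y" "g y \<le> L" for y
    unfolding g_def using nonneg d by (auto intro!: L)
  have m_bd: "0 \<le> m q" "m q \<le> M" "\<bar>m q - m q'\<bar> \<le> \<bar>q - q'\<bar>" for q q'
    using M by (auto simp: m_def)
  have ft_le: "ft y \<le> 0" for y
    unfolding ft_def using f_mono[of _ 0] f0 by simp
  have ft_ge: "- L \<le> ft y" "y \<le> 0 \<Longrightarrow> L * y \<le> ft y" for y
  proof -
    let ?c = "max (-1) (min y 0)"
    have "\<bar>f ?c - f 0\<bar> \<le> L * \<bar>?c - 0\<bar>" by (rule f_lip) auto
    then have *: "L * ?c \<le> ft y" unfolding ft_def f0 by (simp add: abs_le_iff)
    then show "- L \<le> ft y" using mult_left_mono[of "-1" ?c L] L1 by simp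
    show "L * y \<le> ft y" if "y \<le> 0"
    proof -
      have "L * y \<le> L * ?c" using that L1 by (intro mult_left_mono) auto
      with * show ?thesis by linarith
    qed
  qed
  have cont_ft: "continuous_on UNIV ft"
    unfolding ft_def by (intro continuous_on_compose2[OF f_cont[of UNIV]] continuous_intros) auto
  have cont_g: "continuous_on UNIV g"
    unfolding g_def by (intro continuous_on_compose2[OF cont] continuous_intros) auto
  define \<Phi> where "\<Phi> t v = (ft (fst v) + (if t < t0 then m (snd v) else 0), g (fst v) * m (snd v))"
    for t and v :: "real \<times> real"
  define \<Lambda> where "\<Lambda> = 2 * L + 1 + M' * M"
  have M'0: "0 \<le> M'" by (simp add: M'_def)
  have \<Lambda>: "0 < \<Lambda>" unfolding \<Lambda>_def using L1 M M'0 by (intro add_pos_nonneg) auto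
  have lip: "norm (\<Phi> t v - \<Phi> t w) \<le> \<Lambda> * norm (v - w)" for t v w
  proof -
    have n1: "\<bar>fst v - fst w\<bar> \<le> norm (v - w)" "\<bar>snd v - snd w\<bar> \<le> norm (v - w)"
      using norm_fst_le[of "fst v - fst w" "snd v - snd w"] norm_snd_le[of "snd v - snd w" "fst v - fst w"]
      by (simp_all add: minus_prod_def)
    have "\<bar>fst (\<Phi> t v - \<Phi> t w)\<bar> \<le> \<bar>ft (fst v) - ft (fst w)\<bar> + \<bar>m (snd v) - m (snd w)\<bar>"
      by (auto simp: \<Phi>_def)
    also have "\<dots> \<le> L * norm (v - w) + norm (v - w)"
    proof -
      have "L * \<bar>fst v - fst w\<bar> \<le> L * norm (v - w)" using n1(1) L1 by (intro mult_left_mono) auto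
      then show ?thesis
        using ft_lip[of "fst v" "fst w"] m_bd(3)[of "snd v" "snd w"] n1(2) by linarith
    qed
    finally have 1: "\<bar>fst (\<Phi> t v - \<Phi> t w)\<bar> \<le> (L + 1) * norm (v - w)" by (simp add: algebra_simps)
    have "snd (\<Phi> t v - \<Phi> t w) = g (fst v) * (m (snd v) - m (snd w)) + (g (fst v) - g (fst w)) * m (snd w)"
      by (simp add: \<Phi>_def algebra_simps)
    then have "\<bar>snd (\<Phi> t v - \<Phi> t w)\<bar> \<le> \<bar>g (fst v)\<bar> * \<bar>m (snd v) - m (snd w)\<bar> + \<bar>g (fst v) - g (fst w)\<bar> * \<bar>m (snd w)\<bar>"
      by (metis abs_mult abs_triangle_ineq)
    also have "\<dots> \<le> L * norm (v - w) + (M' * norm (v - w)) * M"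
    proof (intro add_mono mult_mono)
      show "\<bar>m (snd v) - m (snd w)\<bar> \<le> norm (v - w)" using m_bd(3) n1(2) order_trans by blast
      show "\<bar>g (fst v) - g (fst w)\<bar> \<le> M' * norm (v - w)"
        using g_lip[of "fst v" "fst w"] mult_left_mono[OF n1(1) M'0] by linarith
    qed (use g_bd m_bd M'0 L1 in auto)
    finally have 2: "\<bar>snd (\<Phi> t v - \<Phi> t w)\<bar> \<le> (L + M' * M) * norm (v - w)" by (simp add: algebra_simps)
    have "norm (\<Phi> t v - \<Phi> t w) \<le> \<bar>fst (\<Phi> t v - \<Phi> t w)\<bar> + \<bar>snd (\<Phi> t v - \<Phi> t w)\<bar>"
      using norm_Pair_le[of "fst (\<Phi> t v - \<Phi> t w)" "snd (\<Phi> t v - \<Phi> t w)"]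
      unfolding prod.collapse real_norm_def .
    with 1 2 show ?thesis by (simp add: \<Lambda>_def algebra_simps)
  qed
  have pwc\<Phi>: "pwc t0 T (\<lambda>t. \<Phi> t (u t))" if u: "continuous_on {0..T} u" for u
  proof -
    have c: "continuous_on {0..T} (\<lambda>t. ft (fst (u t)))" "continuous_on {0..T} (\<lambda>t. g (fst (u t)))"
      "continuous_on {0..T} (\<lambda>t. m (snd (u t)))"
      unfolding m_def
      by (intro continuous_on_compose2[OF cont_ft] continuous_on_compose2[OF cont_g] continuous_intros u; simp)+
    have "pwc t0 T (\<lambda>t. if t < t0 then (ft (fst (u t)) + m (snd (u t)), g (fst (u t)) * m (snd (u t)))
        else (ft (fst (u t)), g (fst (u t)) * m (snd (u t))))"
      by (intro pwc_if continuous_intros c)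
    then show ?thesis by (rule pwc_cong[THEN iffD1, rotated]) (auto simp: \<Phi>_def)
  qed
  have "\<exists>u. continuous_on {0..T} u \<and> (\<forall>t\<in>{0..T}. u t = (a, \<epsilon>) + rint n (\<lambda>t. \<Phi> t (u t)) t)" for a
    using volterra_exists[OF \<Lambda> pwc\<Phi> lip] by metis
  then obtain u where u: "\<And>a. continuous_on {0..T} (u a)"
    "\<And>a t. t \<in> {0..T} \<Longrightarrow> u a t = (a, \<epsilon>) + rint n (\<lambda>t. \<Phi> t (u a t)) t"
    by metis
  have comp: "fst (u a t) = a + rint n (\<lambda>t. fst (\<Phi> t (u a t))) t"
    "snd (u a t) = \<epsilon> + rint n (\<lambda>t. snd (\<Phi> t (u a t))) t" if t: "t \<in> {0..T}" for a t
    by (subst u(2)[OF t], simp add: rint_bounded_linear[OF bounded_linear_fst pwc\<Phi>[OF u(1)] t]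
      rint_bounded_linear[OF bounded_linear_snd pwc\<Phi>[OF u(1)] t])+
  have pwc1: "pwc t0 T (\<lambda>t. fst (\<Phi> t (u a t)))" for a
  proof -
    have "continuous_on {0..T} (\<lambda>t. ft (fst (u a t)))" "continuous_on {0..T} (\<lambda>t. m (snd (u a t)))"
      unfolding m_def by (intro continuous_on_compose2[OF cont_ft] continuous_intros u(1); simp)+
    then have "pwc t0 T (\<lambda>t. if t < t0 then ft (fst (u a t)) + m (snd (u a t)) else ft (fst (u a t)))"
      by (intro pwc_if continuous_intros)
    then show ?thesis by (rule pwc_cong[THEN iffD1, rotated]) (auto simp: \<Phi>_def)
  qed
  have cont2: "continuous_on {0..T} (\<lambda>t. snd (\<Phi> t (u a t)))" for a
    unfolding \<Phi>_def m_def by (simp, intro continuous_on_compose2[OF cont_g] continuous_intros u(1)) auto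
  have F1: "\<bar>fst (\<Phi> t v)\<bar> \<le> L + M" "fst (\<Phi> t v) \<le> M" for t v
    using ft_le[of "fst v"] ft_ge(1)[of "fst v"] m_bd(1,2)[of "snd v"] M by (auto simp: \<Phi>_def)
  \<comment> \<open>Shooting: the initial value \<open>a\<close> is adjusted so that the first component vanishes at \<open>T\<close>.\<close>
  define A where "A = (L + M) * T / 2"
  have A0: "0 \<le> A" unfolding A_def using L1 M T by simp
  have "continuous_on {-A..A} (\<lambda>a. fst (u a T))"
  proof (rule continuous_on_fst, rule lipschitz_on_continuous_on)
    show "(2 * exp (\<Lambda> * T))-lipschitz_on {-A..A} (\<lambda>a. u a T)"
    proof (rule lipschitz_onI)
      fix a b
      have "norm (u a T - u b T) \<le> 2 * exp (\<Lambda> * T) * norm ((a, \<epsilon>) - (b, \<epsilon>))"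
        by (rule volterra_dependence[OF \<Lambda> pwc\<Phi> lip u(1) u(2) u(1) u(2)])
      then show "dist (u a T) (u b T) \<le> 2 * exp (\<Lambda> * T) * dist a b"
        by (simp add: dist_norm norm_Pair)
    qed simp
  qed
  moreover have rA: "norm (rint n (\<lambda>t. fst (\<Phi> t (u a t))) T) \<le> A" for a
    unfolding A_def using T by (intro rint_bound pwc1) (auto simp: F1)
  have "fst (u (-A) T) \<le> 0" "0 \<le> fst (u A T)"
    using comp(1)[of T "-A"] comp(1)[of T A] T rA[of A] rA[of "-A"]
    by (simp_all add: abs_le_iff)
  ultimately obtain a where a: "fst (u a T) = 0"
    using IVT'[of "\<lambda>a. fst (u a T)" "-A" 0 A] A0 by auto
  define y where "y t = fst (u a t)" for t
  define q where "q t = snd (u a t)" for t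
  define Fy where "Fy t = fst (\<Phi> t (u a t))" for t
  define G where "G t = snd (\<Phi> t (u a t))" for t
  have y: "y t = a + rint n Fy t" and q: "q t = \<epsilon> + rint n G t" if "t \<in> {0..T}" for t
    using comp[OF that, of a] by (simp_all add: y_def q_def Fy_def[abs_def] G_def[abs_def])
  have Fy: "Fy t = ft (y t) + (if t < t0 then m (q t) else 0)" and G: "G t = g (y t) * m (q t)" for t
    by (simp_all add: Fy_def G_def \<Phi>_def y_def q_def)
  have pwFy: "pwc t0 T Fy" unfolding Fy_def by (rule pwc1)
  have cG: "continuous_on {0..T} G" unfolding G_def by (rule cont2)
  have yT: "y T = 0" using a by (simp add: y_def)
  have cy: "continuous_on {0..T} y" and cq: "continuous_on {0..T} q"
    unfolding y_def q_def by (intro continuous_intros u(1))+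
  \<comment> \<open>\<open>m\<close> and \<open>g\<close> are nonnegative for every argument, so G
    >= 0 holds without knowing the sign of \<open>q\<close> beforehand.\<close>
  have q_ge: "\<epsilon> \<le> q t" if "t \<in> {0..T}" for t
    using q[OF that] rint_nonneg[OF that pwc_continuous[OF cG]] g_bd m_bd by (simp add: G)
  \<comment> \<open>Gronwall through the weighted maximum: at the maximum of e^(-L t) q the equation
    gives h k <= \<epsilon> + h k / 2. The resulting bound is \<open>M\<close>, so the cap in
    \<open>m\<close> is never active.\<close>
  have q_le: "q t \<le> M" if t: "t \<in> {0..T}" for t
  proof -
    define h where "h t = exp (- L * t) * q t" for t
    have "continuous_on {0..T} h" unfolding h_def using cq by (intro continuous_intros)
    then obtain k where k: "k \<in> {0..T}" "\<And>t. t \<in> {0..T} \<Longrightarrow> h t \<le> h k"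
      using continuous_attains_sup[of "{0..T}" h] T by auto
    have qh: "q t = h t * exp (L * t)" for t by (simp add: h_def exp_minus)
    have h0: "0 \<le> h k" unfolding h_def using q_ge[OF k(1)] \<epsilon> by simp
    have "norm (rint n G k - rint n (\<lambda>_. 0) k) \<le> L * h k / (2 * L) * exp (L * k)"
    proof (rule rint_diff_bound[OF pwc_continuous[OF cG] pwc_const k(1)])
      fix s assume s: "s \<in> {0..T}"
      have "0 \<le> q s" using q_ge[OF s] \<epsilon> by simp
      then have "m (q s) \<le> q s" by (simp add: m_def)
      also have "q s \<le> h k * exp (L * s)"
        unfolding qh[of s] by (intro mult_right_mono k(2)[OF s]) simp
      finally have "m (q s) \<le> h k * exp (L * s)" .
      then have "g (y s) * m (q s) \<le> L * (h k * exp (L * s))"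
        using g_bd m_bd L1 by (intro mult_mono) auto
      then show "norm (G s - 0) \<le> L * h k * exp (L * s)"
        using g_bd m_bd by (simp add: G abs_mult mult.assoc)
    qed (use L1 h0 in auto)
    then have "rint n G k \<le> h k / 2 * exp (L * k)"
      using L1 by (simp add: rint_def ravg_zero abs_le_iff)
    then have "h k * exp (L * k) \<le> \<epsilon> + h k / 2 * exp (L * k)"
      using q[OF k(1)] qh[of k] by simp
    moreover have "\<epsilon> \<le> \<epsilon> * exp (L * k)" using \<epsilon> L1 k(1) by simp
    ultimately have "h k * exp (L * k) \<le> (\<epsilon> + h k / 2) * exp (L * k)" by (simp add: algebra_simps)
    then have "h k \<le> 2 * \<epsilon>" by simp
    then have "q t \<le> 2 * \<epsilon> * exp (L * t)" unfolding qh using k(2)[OF t] by simp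
    also have "\<dots> \<le> 2 * \<epsilon> * exp (L * T)"
      using \<epsilon>(1) L1 t by (intro mult_left_mono) auto
    finally show ?thesis unfolding \<epsilon>(2) .
  qed
  have mq: "m (q t) = q t" if "t \<in> {0..T}" for t
    using q_ge[OF that] q_le[OF that] \<epsilon> by (simp add: m_def)
  define p' where "p' t = - \<kappa> * \<omega> * exp (- \<omega> * t)" for t
  define p'' where "p'' t = \<kappa> * \<omega>\<^sup>2 * exp (- \<omega> * t)" for t
  define Lp where "Lp t = 4 * t * p'' t + 2 * real n * p' t" for t
  have p: "\<kappa> * \<phi> t = \<kappa> * \<phi> 0 + rint n Lp t" if "t \<in> {0..T}" for t
    unfolding Lp_def
  proof (rule rint_laplacian)
    show "((\<lambda>t. \<kappa> * \<phi> t) has_real_derivative p' t) (at t)" for t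
      unfolding \<phi>_def p'_def by (auto intro!: derivative_eq_intros)
    show "(p' has_real_derivative p'' t) (at t)" for t
      unfolding p'_def p''_def by (auto intro!: derivative_eq_intros simp: power2_eq_square)
    show "continuous_on UNIV p''" unfolding p''_def by (intro continuous_intros)
  qed (use that n in auto)
  have cLp: "continuous_on {0..T} Lp"
    unfolding Lp_def p'_def p''_def by (intro continuous_intros)
  \<comment> \<open>Where the sum is positive, -y is below \<open>\<kappa> * \<phi> t\<close>, and
    ft(y) >= -L \<kappa> E follows from the slope bound alone. As this holds for the truncated
    \<open>ft\<close> as well, the barrier can be used before the truncations are known to be
    inactive.\<close>
  have comparison: "\<kappa> * \<phi> t + y t \<le> 0" if "t \<in> {0..T}" for t
  proof (rule max_principle[OF pwc_add[OF pwc_continuous[OF cLp] pwFy] _ _ _ that])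
    show "\<kappa> * \<phi> t + y t = (\<kappa> * \<phi> 0 + a) + rint n (\<lambda>t. Lp t + Fy t) t" if "t \<in> {0..T}" for t
      using p[OF that] y[OF that] rint_add[OF pwc_continuous[OF cLp] pwFy that] by simp
    show "\<kappa> * \<phi> T + y T \<le> 0" by (simp add: \<phi>_def yT)
    fix t assume t: "t \<in> {0..T}" and pos: "0 < \<kappa> * \<phi> t + y t"
    define E where "E = exp (- \<omega> * t)"
    have E: "0 < E" "E \<le> 1" using t lam by (auto simp: E_def)
    have Lp: "Lp t = \<kappa> * \<omega> * E * (4 * t * \<omega> - 2 * real n)"
      by (simp add: Lp_def p'_def p''_def E_def algebra_simps power2_eq_square)
    have kE: "\<kappa> * \<phi> t \<le> \<kappa> * E" using phi_le[of t] kap by (simp add: E_def)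
    have ft: "- (L * (\<kappa> * E)) \<le> ft (y t)"
    proof (cases "y t \<le> 0")
      case True
      have "L * (- (\<kappa> * E)) \<le> L * y t" using pos kE L1 by (intro mult_left_mono) auto
      then show ?thesis using ft_ge(2)[OF True] by simp
    next
      case False
      then have "ft (y t) = 0" by (simp add: ft_def f0)
      then show ?thesis using L1 kap E by simp
    qed
    show "0 \<le> Lp t + Fy t"
    proof (cases "t < t0")
      case True
      have "\<kappa> * \<omega> * E * (4 * t * \<omega>) \<ge> 0" using t kap lam E by simp
      then have "- (\<kappa> * \<omega> * E * (2 * real n)) \<le> Lp t" unfolding Lp by (simp add: algebra_simps)
      moreover have "\<epsilon> \<le> m (q t)" using mq[OF t] q_ge[OF t] by simp
      moreover have "\<kappa> * (2 * real n * \<omega> + L) * E \<le> \<epsilon>"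
        using E \<epsilon> unfolding kap(2) by simp
      ultimately show ?thesis using ft True by (simp add: Fy algebra_simps)
    next
      case False
      have "4 * t0 * \<omega> \<le> 4 * t * \<omega>" using False lam by simp
      then have "L \<le> 4 * t * \<omega> - 2 * real n" using lam(2) by linarith
      then have "1 * L \<le> \<omega> * (4 * t * \<omega> - 2 * real n)" using lam L1 by (intro mult_mono) auto
      then have "(\<kappa> * E) * (1 * L) \<le> (\<kappa> * E) * (\<omega> * (4 * t * \<omega> - 2 * real n))"
        using kap E by (intro mult_left_mono) auto
      then show ?thesis using ft False unfolding Lp by (simp add: Fy algebra_simps)
    qed
  qed
  have y_neg: "y t < 0" if "t \<in> {0..<T}" for t
    using comparison[of t] mult_pos_pos[OF kap(1) phi_pos[of t]] that by simp
  have y_ge: "- 1 \<le> y t" if t: "t \<in> {0..T}" for t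
  proof -
    have "rint n Fy T - rint n Fy t \<le> M * (T - t) / 2"
      by (rule rint_diff_le[OF t _ pwFy]) (use t M F1 in \<open>auto simp: Fy_def\<close>)
    also have "\<dots> \<le> M * T / 2" using M t by simp
    also have "\<dots> \<le> 1" using T by (simp add: M_def)
    finally show ?thesis using y[OF t] y[of T] yT T by simp
  qed
  show thesis
  proof (rule that[OF cy cq cG _ q _ yT y_neg])
    show "y t = a + rint n (\<lambda>t. f (y t) + (if t < t0 then q t else 0)) t" if t: "t \<in> {0..T}" for t
    proof -
      have "rint n Fy t = rint n (\<lambda>t. f (y t) + (if t < t0 then q t else 0)) t"
      proof (rule rint_cong[OF t])
        fix s assume "s \<in> {0..t}"
        then have s: "s \<in> {0..T}" using t by auto
        have "y s \<le> 0" using y_neg[of s] yT s by (cases "s = T") auto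
        then show "Fy s = f (y s) + (if s < t0 then q s else 0)"
          using y_ge[OF s] mq[OF s] by (simp add: Fy ft_def)
      qed
      then show ?thesis using y[OF t] by simp
    qed
    show "G t = f' (y t) * q t" if t: "t \<in> {0..<t0}" for t
    proof -
      have tT: "t \<in> {0..T}" using t lt by auto
      have "\<phi> t0 \<le> \<phi> t" using t lam by (simp add: \<phi>_def)
      then have "d \<le> \<kappa> * \<phi> t" using kap by (simp add: d_def min_le_iff_disj)
      then have "y t \<le> - d" using comparison[OF tT] by simp
      then have "max (-1) (min (y t) (- d)) = y t" using y_ge[OF tT] by simp
      then show ?thesis by (simp add: G g_def mq[OF tT])
    qed
  qed
qed

end


subsection \<open>The common target\<close>

context radial_nonlinearity
begin

text \<open>The resulting \<open>q\<close> keeps the one found by shooting only in the small ball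
  and is continued anew in the annulus. The equation for \<open>y\<close> does not notice, because
  its source is cut off at \<open>t0\<close>.\<close>

lemma two_profiles:
  assumes \<beta>: "\<beta> > 0"
  obtains y q p Z :: "real \<Rightarrow> real" and a e where
    "continuous_on {0..T} y" "continuous_on {0..T} q" "continuous_on {0..T} p" "continuous_on {0..T} Z"
    "y T = 0" "q T = 0" "p T = 0" "\<And>t. t \<in> {0..<T} \<Longrightarrow> y t < 0" "\<And>t. t < t0 \<Longrightarrow> p t = 0"
    "\<And>t. t \<in> {0..T} \<Longrightarrow> y t = a + rint n (\<lambda>t. f (y t) - (if t < t0 then - q t else 0)) t"
    "\<And>t. t \<in> {0..T} \<Longrightarrow> q t = e + rint n (\<lambda>t. f' (y t) * q t - (if t < t0 then 0 else \<beta> * (y t - Z t))) t"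
    "\<And>t. t \<in> {0..T} \<Longrightarrow> p t = rint n (\<lambda>t. f' 0 * p t - (if t < t0 then 0 else \<beta> * (0 - Z t))) t"
proof -
  obtain y q G :: "real \<Rightarrow> real" and a e where
    cy: "continuous_on {0..T} y" and cq: "continuous_on {0..T} q" and cG: "continuous_on {0..T} G"
    and y: "\<And>t. t \<in> {0..T} \<Longrightarrow> y t = a + rint n (\<lambda>t. f (y t) + (if t < t0 then q t else 0)) t"
    and q: "\<And>t. t \<in> {0..T} \<Longrightarrow> q t = e + rint n G t"
    and G: "\<And>t. t \<in> {0..<t0} \<Longrightarrow> G t = f' (y t) * q t"
    and yT: "y T = 0" and y_neg: "\<And>t. t \<in> {0..<T} \<Longrightarrow> y t < 0"
    using negative_solution by blast
  obtain s where s: "\<And>y. y < 0 \<Longrightarrow> 0 < s * (f' y - f' 0)" using sign by blast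
  have cf: "continuous_on {0..T} (\<lambda>t. f' (y t))"
    by (rule continuous_on_compose2[OF cont cy]) auto
  obtain L0 where L0: "\<And>t. t \<in> {0..T} \<Longrightarrow> norm (f' (y t)) \<le> L0"
    using pwc_bounded[OF pwc_continuous[OF cf]] by metis
  define L where "L = max 1 L0"
  have L: "0 < L" "\<And>t. t \<in> {0..T} \<Longrightarrow> \<bar>f' (y t)\<bar> \<le> L"
    using L0 by (auto simp: L_def le_max_iff_disj)
  have lipL: "norm (f' (y t) * v - f' (y t) * w) \<le> L * norm (v - w)" if "t \<in> {0..T}" for t and v w :: real
    using mult_right_mono[OF L(2)[OF that], of "\<bar>v - w\<bar>"] by (simp add: right_diff_distrib[symmetric] abs_mult)
  \<comment> \<open>All derivatives of \<open>step\<close> vanish at 0, so \<open>b\<close> and its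
    radial Laplacian join continuously with 0 at \<open>t0\<close>, which makes the target
    continuous; the factor T - t gives the boundary value 0 and keeps \<open>b\<close> positive in
    between.\<close>
  define b where "b t = step (t - t0) * (T - t)" for t
  let ?D = "\<lambda>p :: real poly. [:0,0,1:] * (p - pderiv p)"
  define b' where "b' t = bump (?D 1) (t - t0) * (T - t) - step (t - t0)" for t
  define b'' where "b'' t = bump (?D (?D 1)) (t - t0) * (T - t) - 2 * bump (?D 1) (t - t0)" for t
  define Lb where "Lb t = 4 * t * b'' t + 2 * real n * b' t" for t
  have dbump: "((\<lambda>t. bump r (t - t0)) has_real_derivative bump (?D r) (t - t0)) (at t)" for r t
    using bump_has_derivative[of r "t + - t0"] unfolding DERIV_shift by simp
  have db: "(b has_real_derivative b' t) (at t)" for t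
    unfolding b_def b'_def step_def
    by (rule DERIV_cong[OF DERIV_mult[OF dbump DERIV_diff[OF DERIV_const DERIV_ident]]]) simp
  have db': "(b' has_real_derivative b'' t) (at t)" for t
    unfolding b'_def b''_def step_def
    by (rule DERIV_cong[OF DERIV_diff[OF DERIV_mult[OF dbump DERIV_diff[OF DERIV_const DERIV_ident]] dbump]]) simp
  have cbump: "continuous_on S (\<lambda>t. bump r (t - t0))" for r S
    using dbump[THEN DERIV_isCont] by (simp add: continuous_at_imp_continuous_on)
  have cb'': "continuous_on S b''" and cb': "continuous_on S b'" and cb: "continuous_on S b" for S
    unfolding b''_def b'_def b_def step_def by (intro continuous_intros cbump)+
  have cLb: "continuous_on {0..T} Lb"
    unfolding Lb_def by (intro continuous_intros cb' cb'')
  have b0: "b t = 0" "Lb t = 0" if "t < t0" for t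
    using that by (simp_all add: b_def Lb_def b'_def b''_def step_def bump_def)
  have bT: "b T = 0" by (simp add: b_def)
  have b_nonneg: "0 \<le> b t" if "t \<in> {0..T}" for t
    using that step_simps by (simp add: b_def)
  have b_pos: "0 < b t" if "t \<in> {t0<..<T}" for t
    using that by (simp add: b_def step_def bump_def)
  have Lb: "b t = rint n Lb t" if "t \<in> {0..T}" for t
    using rint_laplacian[OF db db' cb'' n, of t] b0(1)[of 0] t0 that by (simp add: Lb_def[abs_def])
  \<comment> \<open>\<open>w0 + c * w1\<close> is the difference of the two adjoint states when \<open>p = c * s * b\<close>\<close>
  obtain w0 where w0: "continuous_on {0..T} w0"
    "\<And>t. t \<in> {0..T} \<Longrightarrow> w0 t = e + rint n (\<lambda>t. if t < t0 then G t else f' (y t) * w0 t - \<beta> * y t) t"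
  proof (rule volterra_exists[OF L(1), where c = e and \<Phi> = "\<lambda>t v. if t < t0 then G t else f' (y t) * v - \<beta> * y t"])
    show "pwc t0 T (\<lambda>t. if t < t0 then G t else f' (y t) * u t - \<beta> * y t)"
      if "continuous_on {0..T} u" for u
      by (intro pwc_if continuous_intros cG cf cy that)
  qed (use lipL L(1) in auto)
  \<comment> \<open>With \<open>\<bar>w1\<bar>\<close> the right-hand side is nonnegative, so that \<open>w1 \<ge> 0\<close> and \<open>\<bar>w1\<bar> = w1\<close> a posteriori.\<close>
  obtain w1 where w1: "continuous_on {0..T} w1"
    "\<And>t. t \<in> {0..T} \<Longrightarrow> w1 t = 0 + rint n (\<lambda>t. if t < t0 then 0 else f' (y t) * \<bar>w1 t\<bar> + s * (f' (y t) - f' 0) * b t) t"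
  proof (rule volterra_exists[OF L(1), where c = 0 and \<Phi> = "\<lambda>t v. if t < t0 then 0 else f' (y t) * \<bar>v\<bar> + s * (f' (y t) - f' 0) * b t"])
    show "pwc t0 T (\<lambda>t. if t < t0 then 0 else f' (y t) * \<bar>u t\<bar> + s * (f' (y t) - f' 0) * b t)"
      if "continuous_on {0..T} u" for u
      by (intro pwc_if continuous_intros cf cb that)
    show "norm ((if t < t0 then 0 else f' (y t) * \<bar>v\<bar> + s * (f' (y t) - f' 0) * b t) -
        (if t < t0 then 0 else f' (y t) * \<bar>w\<bar> + s * (f' (y t) - f' 0) * b t)) \<le> L * norm (v - w)"
      if "t \<in> {0..T}" for t v w
    proof -
      have "norm (f' (y t) * \<bar>v\<bar> - f' (y t) * \<bar>w\<bar>) \<le> L * \<bar>\<bar>v\<bar> - \<bar>w\<bar>\<bar>"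
        using lipL[OF that, of "\<bar>v\<bar>" "\<bar>w\<bar>"] by simp
      also have "\<dots> \<le> L * \<bar>v - w\<bar>" using L(1) by (intro mult_left_mono abs_triangle_ineq3) auto
      finally show ?thesis using L(1) by auto
    qed
  qed blast
  define F0 where "F0 t = (if t < t0 then G t else f' (y t) * w0 t - \<beta> * y t)" for t
  define F1 where "F1 t = (if t < t0 then 0 else f' (y t) * \<bar>w1 t\<bar> + s * (f' (y t) - f' 0) * b t)" for t
  have pF0: "pwc t0 T F0" unfolding F0_def by (intro pwc_if continuous_intros cG cf cy w0(1))
  have pF1: "pwc t0 T F1" unfolding F1_def by (intro pwc_if continuous_intros cf cb w1(1))
  have w0_eq: "w0 t = e + rint n F0 t" and w1_eq: "w1 t = rint n F1 t" if "t \<in> {0..T}" for t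
    using w0(2)[OF that] w1(2)[OF that] by (simp_all add: F0_def[abs_def] F1_def[abs_def])
  have y_le: "y t \<le> 0" if "t \<in> {0..T}" for t
    using y_neg[of t] yT that by (cases "t = T") auto
  have sign': "0 \<le> s * (f' (y t) - f' 0)" if "t \<in> {0..T}" for t
    using s[of "y t"] y_le[OF that] by (cases "y t = 0") auto
  have F1_nonneg: "0 \<le> F1 t" if "t \<in> {0..T}" for t
    unfolding F1_def using sign'[OF that] b_nonneg[OF that] nonneg by simp
  have F1_pos: "0 < F1 t" if "t \<in> {t0<..<T}" for t
  proof -
    have "0 < s * (f' (y t) - f' 0) * b t"
      using s[OF y_neg[of t]] b_pos[OF that] that t0 by simp
    then show ?thesis unfolding F1_def using that nonneg[of "y t"] by (simp add: add_nonneg_pos)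
  qed
  have w1_nonneg: "0 \<le> w1 t" if "t \<in> {0..T}" for t
    unfolding w1_eq[OF that] by (rule rint_nonneg[OF that pF1]) (use F1_nonneg that in auto)
  \<comment> \<open>Here the strict sign of \<open>f' (y t) - f' 0\<close> is used: it allows the
    boundary value of \<open>w0 + c * w1\<close> to be steered by \<open>c\<close>.\<close>
  have w1T: "0 < w1 T"
    using w1_eq[of T] rint_pos[OF pF1 F1_nonneg F1_pos lt] T by simp
  \<comment> \<open>In the small ball the right-hand side of \<open>w0\<close> is \<open>G\<close>
    itself, with the same initial value \<open>e\<close>, so \<open>w0\<close> continues
    \<open>q\<close> beyond \<open>t0\<close>.\<close>
  have w0_q: "w0 t = q t" if t: "t \<in> {0..<t0}" for t
  proof -
    have tT: "t \<in> {0..T}" using t lt by auto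
    have "rint n F0 t = rint n G t" by (rule rint_cong[OF tT]) (use t in \<open>auto simp: F0_def\<close>)
    then show ?thesis using w0_eq[OF tT] q[OF tT] by simp
  qed
  have w1_0: "w1 t = 0" if t: "t \<in> {0..<t0}" for t
  proof -
    have tT: "t \<in> {0..T}" using t lt by auto
    have "rint n F1 t = rint n (\<lambda>_. 0) t" by (rule rint_cong[OF tT]) (use t in \<open>auto simp: F1_def\<close>)
    then show ?thesis using w1_eq[OF tT] by (simp add: rint_def ravg_zero)
  qed
  \<comment> \<open>Solves w0 T + c * w1 T = 0; since \<open>p\<close> vanishes at \<open>T\<close>,
    this is the boundary condition for \<open>Q\<close>.\<close>
  define c where "c = - w0 T / w1 T"
  define p where "p t = c * s * b t" for t
  define Lp where "Lp t = c * s * Lb t" for t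
  define Q where "Q t = w0 t + c * w1 t + p t" for t
  \<comment> \<open>Read off from the adjoint equation at the zero state: in the annulus \<Delta>p =
    f'(0) p + \<beta> z.\<close>
  define Z where "Z t = (Lp t - f' 0 * p t) / \<beta>" for t
  have cp: "continuous_on {0..T} p" unfolding p_def by (intro continuous_intros cb)
  have cLp: "continuous_on {0..T} Lp" unfolding Lp_def by (intro continuous_intros cLb)
  have \<beta>Z: "\<beta> * Z t = Lp t - f' 0 * p t" for t using \<beta> by (simp add: Z_def)
  have p_eq: "p t = rint n Lp t" if "t \<in> {0..T}" for t
    using Lb[OF that] rint_scaleR[of "c * s" Lb t] by (simp add: p_def Lp_def[abs_def])
  have Q_q: "Q t = q t" if t: "t \<in> {0..<t0}" for t
    using w0_q[OF t] w1_0[OF t] b0(1)[of t] t by (simp add: Q_def p_def)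
  show thesis
  proof (rule that[of y Q p Z a e])
    show "continuous_on {0..T} Q" unfolding Q_def by (intro continuous_intros w0(1) w1(1) cp)
    show "continuous_on {0..T} Z" unfolding Z_def using \<beta> by (intro continuous_intros cLp cp) auto
    show "Q T = 0" using w1T bT by (simp add: Q_def p_def c_def)
    show "p T = 0" using bT by (simp add: p_def)
    show "p t = 0" if "t < t0" for t using b0(1)[OF that] by (simp add: p_def)
    show "y t = a + rint n (\<lambda>t. f (y t) - (if t < t0 then - Q t else 0)) t" if t: "t \<in> {0..T}" for t
    proof -
      have "rint n (\<lambda>t. f (y t) + (if t < t0 then q t else 0)) t = rint n (\<lambda>t. f (y t) - (if t < t0 then - Q t else 0)) t"
        by (rule rint_cong[OF t]) (use Q_q in auto)
      then show ?thesis using y[OF t] by simp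
    qed
    show "p t = rint n (\<lambda>t. f' 0 * p t - (if t < t0 then 0 else \<beta> * (0 - Z t))) t" if t: "t \<in> {0..T}" for t
    proof -
      have "rint n Lp t = rint n (\<lambda>t. f' 0 * p t - (if t < t0 then 0 else \<beta> * (0 - Z t))) t"
        by (rule rint_cong[OF t]) (use b0 \<beta>Z in \<open>auto simp: p_def Lp_def\<close>)
      then show ?thesis using p_eq[OF t] by simp
    qed
    show "Q t = e + rint n (\<lambda>t. f' (y t) * Q t - (if t < t0 then 0 else \<beta> * (y t - Z t))) t" if t: "t \<in> {0..T}" for t
    proof -
      have pc: "pwc t0 T (\<lambda>t. c * F1 t)" using pwc_scaleR[OF pF1, of c] by simp
      have "Q t = e + (rint n F0 t + c * rint n F1 t + rint n Lp t)"
        using w0_eq[OF t] w1_eq[OF t] p_eq[OF t] by (simp add: Q_def)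
      also have "c * rint n F1 t = rint n (\<lambda>t. c * F1 t) t"
        using rint_scaleR[of c F1 t] by simp
      also have "rint n F0 t + rint n (\<lambda>t. c * F1 t) t + rint n Lp t = rint n (\<lambda>t. F0 t + c * F1 t + Lp t) t"
        using rint_add[OF pF0 pc t] rint_add[OF pwc_add[OF pF0 pc] pwc_continuous[OF cLp] t] by simp
      also have "\<dots> = rint n (\<lambda>t. f' (y t) * Q t - (if t < t0 then 0 else \<beta> * (y t - Z t))) t"
      proof (rule rint_cong[OF t])
        fix r assume "r \<in> {0..t}"
        then have r: "r \<in> {0..T}" using t by auto
        show "F0 r + c * F1 r + Lp r = f' (y r) * Q r - (if r < t0 then 0 else \<beta> * (y r - Z r))"
        proof (cases "r < t0")
          case True
          then show ?thesis using G[of r] Q_q[of r] r b0(2)[of r] by (simp add: F0_def F1_def Lp_def)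
        next
          case False
          \<comment> \<open>With the absolute value gone and c * s * b = p, the terms (f'(y) -
            f'(0)) p and Lp = \<beta> Z + f'(0) p add up to f'(y) p + \<beta> Z, which is the
            missing \<open>p\<close> part of the equation for \<open>Q\<close>.\<close>
          have "\<bar>w1 r\<bar> = w1 r" using w1_nonneg[OF r] by simp
          then have "F0 r + c * F1 r + Lp r =
              f' (y r) * w0 r - \<beta> * y r + c * (f' (y r) * w1 r) + (f' (y r) - f' 0) * p r + Lp r"
            using False by (simp add: F0_def F1_def p_def algebra_simps)
          also have "\<dots> = f' (y r) * Q r - \<beta> * y r + \<beta> * Z r"
            unfolding \<beta>Z Q_def by (simp add: algebra_simps)
          finally show ?thesis using False by (simp add: algebra_simps)
        qed
      qed
      finally show ?thesis .
    qed
  qed (use cy cp yT y_neg in auto)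
qed

end

subsection \<open>Nonuniqueness\<close>

text \<open>The hypotheses on \<open>f\<close> reach the locale in three ways: monotonicity gives a
  nonnegative derivative, continuity of f'' on [-1, -d] gives the Lipschitz bound, and Rolle's
  theorem turns f'' <> 0 into f'(y) <> f'(0) for y < 0.\<close>

lemma nonuniqueness:
  fixes f :: "real \<Rightarrow> real" and r R \<beta> :: real
  assumes r: "0 < r" and rR: "r < R" and \<beta>: "0 < \<beta>"
    and f1: "f C1_differentiable_on UNIV" and f2: "deriv f C1_differentiable_on (- {0})"
    and mono: "strict_mono f" and f0: "f 0 = 0"
    and ne: "\<forall>y. y \<noteq> 0 \<longrightarrow> deriv (deriv f) y \<noteq> 0"
  shows "\<exists>z :: 'a::euclidean_space \<Rightarrow> real. z \<in> Linf (ball 0 R - ball 0 r) \<and>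
    (\<exists>y1 q1 y2 q2.
       coupled_system_solution r R \<beta> f z y1 q1 \<and>
       coupled_system_solution r R \<beta> f z y2 q2 \<and>
       \<not> (AE x in lebesgue_on (ball 0 R). y1 x = y2 x \<and> q1 x = q2 x))"
proof -
  have R: "0 < R" using r rR by simp
  obtain D where D: "\<And>x. (f has_real_derivative D x) (at x)" "continuous_on UNIV D"
    using f1 unfolding C1_differentiable_on_def has_real_derivative_iff_has_vector_derivative by auto
  then have D_eq: "deriv f = D" using DERIV_imp_deriv by blast
  obtain E where E: "\<And>x. x \<noteq> 0 \<Longrightarrow> (deriv f has_real_derivative E x) (at x)" "continuous_on (- {0}) E"
    using f2 unfolding C1_differentiable_on_def has_real_derivative_iff_has_vector_derivative by auto
  interpret radial_nonlinearity "r\<^sup>2" "R\<^sup>2" "DIM('a)" f "deriv f"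
  proof
    show "0 < r\<^sup>2" "0 < R\<^sup>2" "r\<^sup>2 < R\<^sup>2" using r rR by (auto intro: power_strict_mono)
    show "1 \<le> DIM('a)" by (simp add: Suc_leI)
    show "(f has_real_derivative deriv f y) (at y)" for y using D D_eq by simp
    show "continuous_on UNIV (deriv f)" using D D_eq by simp
    show "0 \<le> deriv f y" for y
    proof (rule mono_on_imp_deriv_nonneg[of UNIV f])
      show "mono_on UNIV f" using mono by (simp add: strict_mono_mono)
      show "(f has_real_derivative deriv f y) (at y)" using D D_eq by simp
    qed simp
    show "f 0 = 0" by (rule f0)
    show "\<exists>M. \<forall>x\<in>{-1..-d}. \<forall>y\<in>{-1..-d}. \<bar>deriv f x - deriv f y\<bar> \<le> M * \<bar>x - y\<bar>" if d: "0 < d" for d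
    proof -
      have "bounded (E ` {-1..-d})"
        by (intro compact_imp_bounded compact_continuous_image continuous_on_subset[OF E(2)])
          (use d in auto)
      then obtain M where M: "\<And>x. x \<in> {-1..-d} \<Longrightarrow> norm (E x) \<le> M" unfolding bounded_iff by blast
      have "norm (deriv f x - deriv f y) \<le> M * norm (x - y)" if "x \<in> {-1..-d}" "y \<in> {-1..-d}" for x y
      proof (rule field_differentiable_bound[of "{-1..-d}" "deriv f" E])
        show "(deriv f has_field_derivative E z) (at z within {-1..-d})" if "z \<in> {-1..-d}" for z
          by (rule has_field_derivative_at_within[OF E(1)]) (use that d in auto)
      qed (use M that in auto)
      then show ?thesis unfolding real_norm_def by blast
    qed
    show "deriv f y \<noteq> deriv f 0" if y: "y < 0" for y
    proof
      assume eq: "deriv f y = deriv f 0"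
      have "\<exists>z>y. z < 0 \<and> DERIV (deriv f) z :> 0"
      proof (rule Rolle[OF y eq])
        show "continuous_on {y..0} (deriv f)" using D D_eq continuous_on_subset by blast
        show "deriv f differentiable (at x)" if "y < x" "x < 0" for x
          using E(1)[of x] that by (auto simp: real_differentiable_def)
      qed
      then obtain z where z: "z < 0" "DERIV (deriv f) z :> 0" by blast
      then show False using ne DERIV_imp_deriv[OF z(2)] by simp
    qed
  qed
  obtain y q p Z :: "real \<Rightarrow> real" and a e where
    cont: "continuous_on {0..R\<^sup>2} y" "continuous_on {0..R\<^sup>2} q" "continuous_on {0..R\<^sup>2} p" "continuous_on {0..R\<^sup>2} Z"
    and bdry: "y (R\<^sup>2) = 0" "q (R\<^sup>2) = 0" "p (R\<^sup>2) = 0"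
    and y_neg: "\<And>t. t \<in> {0..<R\<^sup>2} \<Longrightarrow> y t < 0" and p0: "\<And>t. t < r\<^sup>2 \<Longrightarrow> p t = 0"
    and y: "\<And>t. t \<in> {0..R\<^sup>2} \<Longrightarrow> y t = a + rint DIM('a) (\<lambda>t. f (y t) - (if t < r\<^sup>2 then - q t else 0)) t"
    and q: "\<And>t. t \<in> {0..R\<^sup>2} \<Longrightarrow> q t = e + rint DIM('a) (\<lambda>t. deriv f (y t) * q t - (if t < r\<^sup>2 then 0 else \<beta> * (y t - Z t))) t"
    and p: "\<And>t. t \<in> {0..R\<^sup>2} \<Longrightarrow> p t = rint DIM('a) (\<lambda>t. deriv f 0 * p t - (if t < r\<^sup>2 then 0 else \<beta> * (0 - Z t))) t"
    by (rule two_profiles[OF \<beta>]) blast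
  have p': "p t = 0 + rint DIM('a) (\<lambda>t. deriv f 0 * p t - (if t < r\<^sup>2 then 0 else \<beta> * (0 - Z t))) t"
    if "t \<in> {0..R\<^sup>2}" for t using p[OF that] by simp
  let ?z = "\<lambda>x::'a. Z (x \<bullet> x)"
  let ?A = "ball (0::'a) R - ball 0 r"
  note weak = radial_weak_dirichlet_solution[OF R t0, where 'a='a]
  have ind: "indicator (ball 0 r) x = (if x \<bullet> x < r\<^sup>2 then 1 else 0 :: real)" for x :: 'a
    using inner_self_less[OF r, of x] by (simp add: indicator_def)
  have ind': "indicator ?A x = (if x \<bullet> x < r\<^sup>2 then 0 else 1 :: real)" if "x \<in> ball 0 R" for x :: 'a
    using inner_self_less[OF r, of x] that by (simp add: indicator_def)
  have cf: "continuous_on {0..R\<^sup>2} (\<lambda>t. deriv f (y t))" "continuous_on {0..R\<^sup>2} (\<lambda>t. f (y t))"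
    using D D_eq by (auto intro!: continuous_on_compose2[OF _ cont(1)] f_cont[of UNIV])
  have src: "pwc (r\<^sup>2) (R\<^sup>2) (\<lambda>t. if t < r\<^sup>2 then - v t else 0)"
    "pwc (r\<^sup>2) (R\<^sup>2) (\<lambda>t. if t < r\<^sup>2 then 0 else \<beta> * (v t - Z t))"
    if "continuous_on {0..R\<^sup>2} v" for v
    by (intro pwc_if continuous_intros cont that)+
  have "?z \<in> Linf ?A"
  proof -
    have sub: "(\<lambda>x::'a. x \<bullet> x) ` ?A \<subseteq> {0..R\<^sup>2}" using inner_self_mem_ball by blast
    have "?z \<in> borel_measurable (lebesgue_on ?A)"
      by (rule pwc_measurable[OF pwc_continuous[OF cont(4)] _ _ sub]) (auto intro!: continuous_intros)
    moreover obtain C where "\<And>t. t \<in> {0..R\<^sup>2} \<Longrightarrow> norm (Z t) \<le> C"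
      using pwc_bounded[OF pwc_continuous[OF cont(4)]] by metis
    then have "AE x in lebesgue_on ?A. \<bar>?z x\<bar> \<le> C"
      using sub by (intro AE_I2) (auto simp: image_subset_iff)
    ultimately show ?thesis by (auto simp: Linf_def)
  qed
  moreover have "coupled_system_solution r R \<beta> f ?z (\<lambda>_. 0) (\<lambda>x. p (x \<bullet> x))"
    unfolding coupled_system_solution_def
  proof
    have zero: "(\<lambda>t. f 0 - (if t < r\<^sup>2 then - p t else 0)) = (\<lambda>_. 0)"
      using p0 f0 by auto
    show "weak_dirichlet_solution (ball (0::'a) R) (\<lambda>_. 0) (\<lambda>x. f 0) (\<lambda>x. - p (x \<bullet> x) * indicator (ball 0 r) x)"
      by (rule weak[OF pwc_const[where c = "f 0"] src(1)[OF cont(3)], where U = "\<lambda>_. 0" and a = 0])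
        (auto simp: zero rint_def ravg_zero ind)
    show "weak_dirichlet_solution (ball (0::'a) R) (\<lambda>x. p (x \<bullet> x)) (\<lambda>x. deriv f 0 * p (x \<bullet> x))
        (\<lambda>x. \<beta> * (0 - ?z x) * indicator ?A x)"
      by (rule weak[OF pwc_continuous[OF continuous_on_mult[OF continuous_on_const[where c = "deriv f 0"] cont(3)]]
            src(2)[OF continuous_on_const[where c = 0]], where U = p and a = 0])
        ((erule p' | rule bdry refl | simp add: ind')+)
  qed
  moreover have "coupled_system_solution r R \<beta> f ?z (\<lambda>x. y (x \<bullet> x)) (\<lambda>x. q (x \<bullet> x))"
    unfolding coupled_system_solution_def
  proof
    show "weak_dirichlet_solution (ball (0::'a) R) (\<lambda>x. y (x \<bullet> x)) (\<lambda>x. f (y (x \<bullet> x)))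
        (\<lambda>x. - q (x \<bullet> x) * indicator (ball 0 r) x)"
      by (rule weak[OF pwc_continuous[OF cf(2)] src(1)[OF cont(2)], where U = y and a = a])
        ((erule y | rule bdry refl | simp add: ind)+)
    show "weak_dirichlet_solution (ball (0::'a) R) (\<lambda>x. q (x \<bullet> x)) (\<lambda>x. deriv f (y (x \<bullet> x)) * q (x \<bullet> x))
        (\<lambda>x. \<beta> * (y (x \<bullet> x) - ?z x) * indicator ?A x)"
      by (rule weak[OF pwc_continuous[OF continuous_on_mult[OF cf(1) cont(2)]] src(2)[OF cont(1)],
            where U = q and a = e])
        ((erule q | rule bdry refl | simp add: ind')+)
  qed
  moreover have "\<not> (AE x in lebesgue_on (ball (0::'a) R). 0 = y (x \<bullet> x) \<and> p (x \<bullet> x) = q (x \<bullet> x))"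
  proof
    assume "AE x in lebesgue_on (ball (0::'a) R). 0 = y (x \<bullet> x) \<and> p (x \<bullet> x) = q (x \<bullet> x)"
    then have ae: "AE x in lebesgue. x \<in> ball (0::'a) R \<longrightarrow> 0 = y (x \<bullet> x) \<and> p (x \<bullet> x) = q (x \<bullet> x)"
      by (subst (asm) AE_restrict_space_iff) auto
    \<comment> \<open>The first components differ at every point of the open ball, so equality
      almost everywhere would make the ball a null set.\<close>
    have neg: "y (x \<bullet> x) < 0" if "x \<in> ball 0 R" for x :: 'a
      using y_neg[of "x \<bullet> x"] inner_self_less[OF R, of x] that by simp
    from ae have "AE x in lebesgue. x \<notin> ball (0::'a) R"
      by eventually_elim (metis neg less_irrefl)
    then have "negligible (ball (0::'a) R)"
      by (simp add: negligible_iff_null_sets AE_iff_null_sets)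
    then show False using R open_not_negligible[OF open_ball, of "0::'a" R] by simp
  qed
  ultimately show ?thesis by blast
qed

theorem corollary1:
  fixes f :: "real \<Rightarrow> real" and r R \<beta> :: real
  assumes "CARD('n::finite) \<in> {1, 2, 3}"
    and "0 < r" and "r < R" and "0 < \<beta>"
    and "f C1_differentiable_on UNIV"
    and "deriv f C1_differentiable_on (- {0})"
    and "strict_mono f" and "f 0 = 0"
    and "\<forall>y. y \<noteq> 0 \<longrightarrow> deriv (deriv f) y \<noteq> 0"
  shows "\<exists>z :: real ^ 'n \<Rightarrow> real. z \<in> Linf (ball 0 R - ball 0 r) \<and>
    (\<exists>y1 q1 y2 q2.
       coupled_system_solution r R \<beta> f z y1 q1 \<and>
       coupled_system_solution r R \<beta> f z y2 q2 \<and>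
       \<not> (AE x in lebesgue_on (ball 0 R). y1 x = y2 x \<and> q1 x = q2 x))"
  by (rule nonuniqueness) (use assms in auto)

end
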